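(* Let $k_0\ge 1$ be an integer and let $s\ge 2$ be an integer. There exist a constant $K>0$, depending only on $s$ and $k_0$, and a function $C:(0,2\pi k_0)\to(0,\infty)$ with $C(T)\to\infty$ as $T\to 2\pi k_0$, such that the following holds. For every $T$ with $0<T<2\pi k_0$ there is $\delta>0$ such that for every real-valued $a\in H^{s+1}(\mathbb{T})$ with $|a-\bar a|_{H^{s+1}}\le\delta$ there is $\varepsilon_0>0$ such that, for every $\varepsilon\in(0,\varepsilon_0)$ with $k_0/\varepsilon\in\mathbb{Z}$, the initial datum $$u(\varepsilon,0,x)=a\!\left(\frac{k_0x}{\varepsilon}\right)$$ generates a unique solution $u\in C^0([0,T],H^s(\mathbb{T}))$ to $$\partial_t u+u\,\partial_x u-\varepsilon\,\partial_x^2u=i ,$$ and there holds $$u(\varepsilon,t,x)=it+v\!\left(\varepsilon,\frac{t}{\varepsilon},\frac{x}{\varepsilon}\right),\qquad 0\le t\le T,$$ where, for all $t\in[0,T/\varepsilon]$, the function $v(t)=v(\varepsilon,t,\cdot)$ satisfies $$|\mathrm{Re}\,v(t)-\bar a|_{H^s}\le K\,\big(1+\varepsilon t\,C(T)\big)\,|a(k_0\,\cdot)-\bar a|_{H^{s+1}},$$ $$|\mathrm{Im}\,v(t)|_{H^s}\le K\,\varepsilon t\,\big(1+\varepsilon t\,C(T)\big)\,|a(k_0\,\cdot)-\bar a|_{H^{s+1}}.$$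
   Context: $\mathbb{T}=\mathbb{R}/\mathbb{Z}$; functions on $\mathbb{T}$ are identified with $1$-periodic functions on $\mathbb{R}$. The unknown $u(\varepsilon,t,x)\in\mathbb{C}$ is complex-valued, with $t\ge 0$, $x\in\mathbb{T}$, and $\varepsilon>0$ is a small viscosity parameter. $\bar a=\int_{\mathbb{T}}a(x)\,dx$ denotes the mean value of $a$. For a nonnegative integer $s$, $H^s=H^s(\mathbb{T})$ is the $L^2$-based Sobolev space with norm $|w|_{H^s}^2=\sum_{0\le j\le s}|\partial_x^jw|_{L^2(\mathbb{T})}^2$. The function $a(k_0\,\cdot)$ is $y\mapsto a(k_0y)$. The datum $x\mapsto a(k_0x/\varepsilon)$ is well defined on $\mathbb{T}$ since $k_0/\varepsilon\in\mathbb{Z}$. The function $v$ is the rescaling $v(\varepsilon,t,y)=u(\varepsilon,\varepsilon t,\varepsilon y)-i\varepsilon t$, which is $1/k_0$-periodic in $y$, in particular $1$-periodic; its $H^s$ norm is taken over $\mathbb{T}$ in $y$. *)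

theory Defs
  imports "HOL-Analysis.Analysis"
begin

text \<open>
  Functions on \<open>\<real>/\<int>\<close> are 1-periodic functions on \<open>\<real>\<close>. Elements of the Lebesgue and Sobolev
  spaces are represented by functions (not by classes modulo null sets), so that equality in
  these spaces is equality almost everywhere.
\<close>

definition periodic1 :: "(real \<Rightarrow> 'a) \<Rightarrow> bool" where
  "periodic1 w \<longleftrightarrow> (\<forall>x. w (x + 1) = w x)"

definition torus_mean :: "(real \<Rightarrow> 'a::euclidean_space) \<Rightarrow> 'a" where
  "torus_mean w = (LINT x:{0..1}|lebesgue. w x)"

definition torus_L2 :: "(real \<Rightarrow> 'a::euclidean_space) set" where
  "torus_L2 = {w. periodic1 w \<and> w \<in> borel_measurable lebesgue \<and>
                  set_integrable lebesgue {0..1} (\<lambda>x. (norm (w x))\<^sup>2)}"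

definition torus_test :: "(real \<Rightarrow> real) set" where
  "torus_test = {\<phi>. periodic1 \<phi> \<and> (\<forall>n x. ((deriv ^^ n) \<phi>) differentiable (at x))}"

text \<open>
  \<open>g\<close> is the derivative of order \<open>j\<close> of \<open>w\<close> in the sense of periodic distributions. Real test
  functions suffice, also when \<open>w\<close> is complex-valued.
\<close>

definition is_weak_deriv ::
  "nat \<Rightarrow> (real \<Rightarrow> 'a::euclidean_space) \<Rightarrow> (real \<Rightarrow> 'a) \<Rightarrow> bool" where
  "is_weak_deriv j w g \<longleftrightarrow> (\<forall>\<phi>\<in>torus_test.
     (LINT x:{0..1}|lebesgue. (deriv ^^ j) \<phi> x *\<^sub>R w x) =
     (- 1) ^ j *\<^sub>R (LINT x:{0..1}|lebesgue. \<phi> x *\<^sub>R g x))"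

definition sobolev :: "nat \<Rightarrow> (real \<Rightarrow> 'a::euclidean_space) set" where
  "sobolev s = {w \<in> torus_L2. \<forall>j\<le>s. \<exists>g\<in>torus_L2. is_weak_deriv j w g}"

text \<open>
  The derivative is determined up to null sets when it exists. The values of \<open>weak_deriv\<close>,
  and hence of \<open>sobolev_norm s\<close>, are meaningless outside of \<open>sobolev j\<close> and \<open>sobolev s\<close>.
\<close>

definition weak_deriv :: "nat \<Rightarrow> (real \<Rightarrow> 'a::euclidean_space) \<Rightarrow> real \<Rightarrow> 'a" where
  "weak_deriv j w = (SOME g. g \<in> torus_L2 \<and> is_weak_deriv j w g)"

definition sobolev_norm :: "nat \<Rightarrow> (real \<Rightarrow> 'a::euclidean_space) \<Rightarrow> real" where
  "sobolev_norm s w = sqrt (\<Sum>j\<le>s. LINT x:{0..1}|lebesgue. (norm (weak_deriv j w x))\<^sup>2)"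

definition sobolev_tendsto ::
  "nat \<Rightarrow> ('b \<Rightarrow> real \<Rightarrow> 'a::euclidean_space) \<Rightarrow> (real \<Rightarrow> 'a) \<Rightarrow> 'b filter \<Rightarrow> bool" where
  "sobolev_tendsto s f l F \<longleftrightarrow>
     (\<forall>\<^sub>F t in F. f t \<in> sobolev s) \<and> l \<in> sobolev s \<and>
     ((\<lambda>t. sobolev_norm s (\<lambda>x. f t x - l x)) \<longlongrightarrow> 0) F"

definition sobolev_continuous_on ::
  "nat \<Rightarrow> real set \<Rightarrow> (real \<Rightarrow> real \<Rightarrow> 'a::euclidean_space) \<Rightarrow> bool" where
  "sobolev_continuous_on s S u \<longleftrightarrow>
     (\<forall>t\<in>S. u t \<in> sobolev s \<and> sobolev_tendsto s u (u t) (at t within S))"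

definition sobolev_has_time_deriv ::
  "nat \<Rightarrow> (real \<Rightarrow> real \<Rightarrow> 'a::euclidean_space) \<Rightarrow> (real \<Rightarrow> 'a) \<Rightarrow> real \<Rightarrow> real set \<Rightarrow> bool" where
  "sobolev_has_time_deriv s u d t S \<longleftrightarrow>
     sobolev_tendsto s (\<lambda>r x. (u r x - u t x) /\<^sub>R (r - t)) d (at t within S)"

text \<open>
  Solutions in \<open>C\<^sup>0([0,T], H\<^sup>s)\<close>, \<open>s \<ge> 2\<close>, of the Cauchy problem
  \<open>\<partial>\<^sub>t u + u \<partial>\<^sub>x u - \<epsilon> \<partial>\<^sub>x\<^sup>2 u = \<i>\<close>, \<open>u(0) = u\<^sub>0\<close>. Here \<open>u \<partial>\<^sub>x u\<close> and \<open>\<partial>\<^sub>x\<^sup>2 u\<close> are continuous in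
  time with values in \<open>H\<^bsup>s-2\<^esup>\<close>, which is the space in which the time derivative is taken
  (one-sided at the end points).
\<close>

definition burgers_solution ::
  "nat \<Rightarrow> real \<Rightarrow> real \<Rightarrow> (real \<Rightarrow> complex) \<Rightarrow> (real \<Rightarrow> real \<Rightarrow> complex) \<Rightarrow> bool" where
  "burgers_solution s \<epsilon> T u0 u \<longleftrightarrow>
     sobolev_continuous_on s {0..T} u \<and>
     (\<forall>t\<in>{0..T}. \<exists>ut. sobolev_has_time_deriv (s - 2) u ut t {0..T} \<and>
        (AE x in lebesgue.
           ut x + u t x * weak_deriv 1 (u t) x - of_real \<epsilon> * weak_deriv 2 (u t) x = \<i>)) \<and>
     (AE x in lebesgue. u 0 x = u0 x)"

end

theory Submission
  imports Defs
begin

text \<open>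
  The forcing \<open>\<i>\<close> only acts through a translation with the complex velocity \<open>\<i> t\<close>, and the Cole-Hopf
  transformation removes the nonlinearity. Put \<open>N = k0/\<epsilon>\<close>, a positive integer, and \<open>z = N x\<close>. If
  \<open>G (t, z)\<close> is 1-periodic in \<open>z\<close> and solves the linear equation

    \<open>\<partial>\<^sub>t G + N (abar + \<i> t) \<partial>\<^sub>z G = k0 N \<partial>\<^sub>z\<^sup>2 G\<close>,

  then \<open>u (t, x) = \<i> t + abar - 2 k0 (\<partial>\<^sub>z G / G) (t, N x)\<close> solves the forced Burgers equation wherever \<open>G\<close> has
  no zeros, and \<open>u\<close> starts at \<open>a (N x)\<close> if \<open>G (0, \<cdot>) = exp P\<close> with \<open>P' = - (a - abar) / (2 k0)\<close>. In the
  rescaled variables of the statement, \<open>v (t, y) = abar - 2 k0 (\<partial>\<^sub>z G / G) (\<epsilon> t, k0 y)\<close>.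

  The equation for \<open>G\<close> is solved mode by mode. The mode \<open>n\<close> is multiplied by
  \<open>exp (N (- 2 pi \<i> n abar t + pi n t\<^sup>2 - 4 pi\<^sup>2 n\<^sup>2 k0 t))\<close>, whose modulus does not exceed 1 for
  \<open>0 \<le> t < 2 pi k0\<close> (\<open>norm_\<mu>\<close>). Consequently absolutely convergent Fourier series with a polynomial weight
  (the Wiener algebra) are not enlarged by the evolution: if \<open>exp P - 1\<close> is small in this algebra, then
  \<open>G - 1\<close> remains small, \<open>G\<close> has no zeros, and all quotients \<open>\<partial>\<^sub>z\<^sup>j G / G\<close> are small. The derivatives of
  \<open>\<partial>\<^sub>z G / G\<close> are polynomials without constant term in these quotients, which yields the estimate of the
  real part, by constants that depend only on \<open>s\<close> and \<open>k0\<close>.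

  For the imaginary part, \<open>G (0, \<cdot>)\<close> is real, so the coefficients of \<open>G\<close> and of its complex conjugate
  differ only through the multipliers of \<open>n\<close> and \<open>-n\<close>. That difference is at most \<open>t\<close>
  (\<open>norm_\<mu>_conj_diff\<close>), since the decay of the diffusion absorbs the factor \<open>n N\<close>. The variable \<open>t\<close> here is
  \<open>\<epsilon> t\<close> in the bounds of the statement.

  The Wiener norm of \<open>P\<close> is controlled by the \<open>H\<^sup>s\<^sup>+\<^sup>1\<close> norm of \<open>a - abar\<close> through Bessel's inequality and
  Cauchy-Schwarz (\<open>sobolev_fcoef_sum_le\<close>), and suprema of derivatives control Sobolev norms
  (\<open>cchain_sobolev_norm_le\<close>). Regularity in time is obtained from dominated convergence for Fourier
  series (\<open>fser_uniform_limit\<close>).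

  Uniqueness is an energy estimate in \<open>L\<^sup>2\<close> for the difference of two solutions
  (\<open>burgers_solution_unique\<close>). The link between the weak derivatives and Fourier series is the uniqueness
  theorem for Fourier coefficients of integrable functions (\<open>fcoef_zero_imp_AE_zero\<close>).
\<close>

section \<open>Integration over one period\<close>

abbreviation T01 :: "real measure" where "T01 \<equiv> lebesgue_on {0..1}"

lemma lint_T01:
  fixes f :: "real \<Rightarrow> 'a::euclidean_space"
  shows "(LINT x:{0..1}|lebesgue. f x) = integral\<^sup>L T01 f"
  by (simp add: set_lebesgue_integral_def integral_restrict_space)

lemma set_integrable_T01:
  fixes f :: "real \<Rightarrow> 'a::euclidean_space"
  shows "set_integrable lebesgue {0..1} f \<longleftrightarrow> integrable T01 f"
  by (simp add: set_integrable_def integrable_restrict_space)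

lemma measure_T01 [simp]: "measure T01 {0..1} = 1"
  by (simp add: measure_restrict_space)

lemma integral_const_T01 [simp]: "integral\<^sup>L T01 (\<lambda>x. c :: 'a::euclidean_space) = c"
  by simp

lemma integrable_T01_continuous:
  fixes f :: "real \<Rightarrow> 'a::euclidean_space"
  assumes "continuous_on {0..1} f"
  shows "integrable T01 f"
  using assms by (metis continuous_imp_integrable_real)

lemma integrable_T01_bounded:
  fixes f :: "real \<Rightarrow> 'a::euclidean_space"
  assumes "f \<in> borel_measurable T01" "\<And>x. norm (f x) \<le> B"
  shows "integrable T01 f"
  by (rule Bochner_Integration.integrable_bound[of T01 "\<lambda>_. B"])
     (use assms in \<open>auto intro!: AE_I2 intro: order_trans[OF _ abs_ge_self]\<close>)

lemma integral_T01_norm_le: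
  fixes f :: "real \<Rightarrow> 'a::euclidean_space"
  assumes "\<And>x. norm (f x) \<le> B" "0 \<le> B"
  shows "norm (integral\<^sup>L T01 f) \<le> B"
proof (cases "integrable T01 f")
  case True
  have "norm (integral\<^sup>L T01 f) \<le> (\<integral>x. norm (f x) \<partial>T01)" by (rule integral_norm_bound)
  also have "\<dots> \<le> (\<integral>x. B \<partial>T01)" by (rule integral_mono) (use True assms in auto)
  finally show ?thesis by simp
qed (use assms in \<open>simp add: not_integrable_integral_eq\<close>)

lemma measurable_T01: "w \<in> borel_measurable lebesgue \<Longrightarrow> w \<in> borel_measurable T01"
  by (rule measurable_restrict_space1)

lemma periodic1_int:
  assumes "periodic1 w"
  shows "w (x + of_int n) = w x"
proof -
  have nat: "w (x + of_nat n) = w x" for x n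
  proof (induction n)
    case (Suc n)
    have "w (x + of_nat (Suc n)) = w ((x + of_nat n) + 1)" by (simp add: algebra_simps)
    with Suc assms show ?case by (simp add: periodic1_def)
  qed simp
  show ?thesis
  proof (cases "n \<ge> 0")
    case True
    then show ?thesis using nat[of x "nat n"] by simp
  next
    case False
    then show ?thesis using nat[of "x + of_int n" "nat (-n)"] by simp
  qed
qed

lemma AE_T01_iff: "(AE x in T01. P x) \<longleftrightarrow> (AE x in lebesgue. x \<in> {0..1} \<longrightarrow> P x)"
  by (rule AE_restrict_space_iff) simp

lemma AE_T01I: "(AE x in lebesgue. P x) \<Longrightarrow> (AE x in T01. P x)"
  unfolding AE_T01_iff by auto

text \<open>
  An affine bijection is differentiable, hence maps null sets to null sets.
\<close>

lemma AE_lebesgue_affine: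
  fixes c t :: real
  assumes "AE x in lebesgue. P x" "c \<noteq> 0"
  shows "AE x in lebesgue. P (t + c * x)"
proof -
  obtain N where N: "{x. \<not> P x} \<subseteq> N" "N \<in> null_sets lebesgue"
    using assms(1) by (auto simp: eventually_ae_filter)
  have "(\<lambda>x. (- t / c) + (1 / c) *\<^sub>R x) ` N \<in> null_sets lebesgue"
  proof -
    have "negligible ((\<lambda>x. (- t / c) + (1 / c) *\<^sub>R x) ` N)"
      using N(2)
      by (intro negligible_differentiable_image_negligible)
         (auto simp: negligible_iff_null_sets divide_inverse intro!: derivative_intros)
    then show ?thesis by (simp add: negligible_iff_null_sets)
  qed
  moreover have "{x. \<not> P (t + c * x)} \<subseteq> (\<lambda>x. (- t / c) + (1 / c) *\<^sub>R x) ` N"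
  proof
    fix x assume "x \<in> {x. \<not> P (t + c * x)}"
    then have "t + c * x \<in> N" using N(1) by auto
    moreover have "x = (- t / c) + (1 / c) *\<^sub>R (t + c * x)" using assms(2) by (simp add: field_simps)
    ultimately show "x \<in> (\<lambda>x. (- t / c) + (1 / c) *\<^sub>R x) ` N" by blast
  qed
  ultimately show ?thesis by (auto simp: eventually_ae_filter)
qed

lemma AE_T01_periodic:
  assumes "AE x in T01. P x" "periodic1 P"
  shows "AE x in lebesgue. P x"
proof -
  have 1: "AE x in lebesgue. x \<in> {0..1} \<longrightarrow> P x" using assms(1) by (simp add: AE_T01_iff)
  have "AE x in lebesgue. (of_int n + 1 * x) \<in> {0..1} \<longrightarrow> P (of_int n + 1 * x)" for n
    by (rule AE_lebesgue_affine[OF 1]) simp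
  then have "AE x in lebesgue. \<forall>n. (of_int n + 1 * x) \<in> {0..1} \<longrightarrow> P (of_int n + 1 * x)"
    by (simp add: AE_all_countable)
  then show ?thesis
  proof (rule AE_mp, intro AE_I2 impI)
    fix x :: real
    assume *: "\<forall>n. (of_int n + 1 * x) \<in> {0..1} \<longrightarrow> P (of_int n + 1 * x)"
    have "of_int (- floor x) + 1 * x \<in> {0..1}" by (simp; linarith)
    with * have "P (x + of_int (- floor x))" by (metis add.commute mult_1)
    then show "P x" using periodic1_int[OF assms(2)] by blast
  qed
qed

section \<open>Uniqueness of Fourier coefficients\<close>

definition fbase :: "int \<Rightarrow> real \<Rightarrow> complex" where
  "fbase n x = cis (2 * pi * of_int n * x)"

definition fcoef :: "(real \<Rightarrow> complex) \<Rightarrow> int \<Rightarrow> complex" where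
  "fcoef w n = integral\<^sup>L T01 (\<lambda>x. w x * fbase (- n) x)"

lemma norm_fbase [simp]: "norm (fbase n x) = 1"
  by (simp add: fbase_def)

lemma fbase_mult: "fbase m x * fbase n x = fbase (m + n) x"
  by (simp add: fbase_def cis_mult algebra_simps)

lemma fbase_0 [simp]: "fbase 0 x = 1" by (simp add: fbase_def)

lemma cnj_fbase [simp]: "cnj (fbase n x) = fbase (- n) x"
  by (simp add: fbase_def cis_cnj)

lemma continuous_fbase [continuous_intros]: "continuous_on S (fbase n)"
  unfolding fbase_def by (intro continuous_intros)

lemma measurable_fbase [measurable]: "fbase n \<in> borel_measurable lebesgue"
  "fbase n \<in> borel_measurable T01"
proof -
  have "fbase n \<in> borel_measurable borel" by (intro borel_measurable_continuous_onI continuous_intros)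
  then show "fbase n \<in> borel_measurable lebesgue" by (rule measurable_completion[OF measurable_lborel2[THEN equalityD2, THEN subsetD]])
  then show "fbase n \<in> borel_measurable T01" by (rule measurable_T01)
qed

lemma periodic_fbase: "fbase n (x + 1) = fbase n x"
proof -
  have "fbase n (x + 1) = fbase n x * cis (2 * pi * of_int n)"
    by (simp add: fbase_def cis_mult algebra_simps)
  also have "cis (2 * pi * of_int n) = 1" by (simp add: complex_eq_iff cos_int_2pin sin_int_2pin)
  finally show ?thesis by simp
qed

lemma integrable_mult_fbase:
  "integrable T01 h \<Longrightarrow> integrable T01 (\<lambda>x. h x * fbase n x)"
  by (rule Bochner_Integration.integrable_bound[of T01 h]) (auto simp: norm_mult)

text \<open>
  The functions all of whose Fourier coefficients vanish. The proof that they vanish almost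
  everywhere enlarges the class of multipliers \<open>m\<close> with \<open>\<integral> h m = 0\<close> step by step: from the
  exponentials to polynomials in \<open>cos\<close> and \<open>sin\<close>, to indicators of open arcs, to intervals.
\<close>

definition fourier_null :: "(real \<Rightarrow> complex) set" where
  "fourier_null = {h. integrable T01 h \<and> (\<forall>n. integral\<^sup>L T01 (\<lambda>x. h x * fbase n x) = 0)}"

lemma fourier_null_fbase: "h \<in> fourier_null \<Longrightarrow> (\<lambda>x. h x * fbase m x) \<in> fourier_null"
  by (auto simp: fourier_null_def mult.assoc fbase_mult intro: integrable_mult_fbase)

lemma fourier_null_add: "h \<in> fourier_null \<Longrightarrow> k \<in> fourier_null \<Longrightarrow> (\<lambda>x. h x + k x) \<in> fourier_null"
  by (auto simp: fourier_null_def distrib_right integrable_mult_fbase)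

lemma fourier_null_cmult: "h \<in> fourier_null \<Longrightarrow> (\<lambda>x. c * h x) \<in> fourier_null"
  by (auto simp: fourier_null_def mult.assoc)

text \<open>
  Products of polynomial functions need no expansion into exponentials, because the class is
  stable under each factor in turn.
\<close>

lemma fourier_null_polynomial:
  assumes "real_polynomial_function p"
  shows "h \<in> fourier_null \<Longrightarrow> (\<lambda>x. h x * of_real (p (fbase 1 x))) \<in> fourier_null"
  using assms
proof (induction p arbitrary: h rule: real_polynomial_function.induct)
  case (linear f)
  interpret bounded_linear f by fact
  have f: "f z = Re z * f 1 + Im z * f \<i>" for z
  proof -
    have "z = Re z *\<^sub>R 1 + Im z *\<^sub>R \<i>"
      by (simp add: complex_eq_iff)
    then have "f z = f (Re z *\<^sub>R 1 + Im z *\<^sub>R \<i>)" by (rule arg_cong)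
    then show ?thesis by (simp only: add scaleR) simp
  qed
  have "h x * of_real (f (fbase 1 x)) =
     ((f 1 - \<i> * f \<i>) / 2) * (h x * fbase 1 x) + ((f 1 + \<i> * f \<i>) / 2) * (h x * fbase (-1) x)" for x
    by (subst f) (simp add: fbase_def complex_eq_iff field_simps)
  then show ?case using linear.prems by (simp only:) (intro fourier_null_add fourier_null_cmult fourier_null_fbase)
next
  case (const c)
  then show ?case using fourier_null_cmult[of h "of_real c"] by (simp add: mult.commute)
next
  case (add f g)
  then show ?case by (auto simp: distrib_left intro!: fourier_null_add)
next
  case (mult f g)
  have "(\<lambda>x. (h x * of_real (f (fbase 1 x))) * of_real (g (fbase 1 x))) \<in> fourier_null"
    by (intro mult.IH mult.prems)
  then show ?case by (simp add: mult.assoc)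
qed

text \<open>
  The indicator of \<open>U\<close> is the increasing limit of the continuous functions \<open>min 1 (k dist(z, -U))\<close>,
  each of which is within \<open>1/(k+1)\<close> of a polynomial on the unit circle by Stone-Weierstrass.
\<close>

lemma fourier_null_open:
  assumes h: "h \<in> fourier_null" and "open U" "U \<noteq> UNIV"
  shows "integral\<^sup>L T01 (\<lambda>x. h x * indicator U (fbase 1 x)) = 0"
proof -
  define f where "f = (\<lambda>(k::nat) z. min 1 (k * infdist z (- U)))"
  have "\<exists>p. real_polynomial_function p \<and> (\<forall>z\<in>sphere 0 1. \<bar>f k z - p z\<bar> < 1 / (k + 1))" for k
    by (rule Stone_Weierstrass_real_polynomial_function[of "sphere 0 1" "f k" "1 / (k + 1)"])
       (auto simp: f_def add.commute intro!: continuous_intros)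
  then obtain p where p: "\<And>k. real_polynomial_function (p k)"
    "\<And>k z. z \<in> sphere 0 1 \<Longrightarrow> \<bar>f k z - p k z\<bar> < 1 / (k + 1)" by metis
  have hint: "integrable T01 h" using h by (simp add: fourier_null_def)
  have lim: "(\<lambda>k. f k z) \<longlonglongrightarrow> indicator U z" for z
  proof (cases "z \<in> U")
    case True
    have "infdist z (- U) > 0"
    proof -
      have "infdist z (- U) \<noteq> 0"
        using in_closed_iff_infdist_zero[of "- U" z] assms True by auto
      then show ?thesis using infdist_nonneg[of z "- U"] by linarith
    qed
    then have "eventually (\<lambda>k. f k z = 1) sequentially"
    proof -
      obtain n :: nat where n: "1 < n * infdist z (- U)"
        using reals_Archimedean3[OF \<open>infdist z (- U) > 0\<close>] by blast
      have "f k z = 1" if "k \<ge> n" for k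
      proof -
        have "n * infdist z (- U) \<le> k * infdist z (- U)"
          using that by (intro mult_right_mono) (auto simp: infdist_nonneg)
        then show ?thesis using n by (simp add: f_def)
      qed
      then show ?thesis by (auto simp: eventually_sequentially)
    qed
    then show ?thesis using True by (simp add: tendsto_eventually)
  next
    case False
    then show ?thesis by (simp add: f_def infdist_zero)
  qed
  have lim2: "(\<lambda>k. p k (fbase 1 x)) \<longlonglongrightarrow> indicator U (fbase 1 x)" for x
  proof -
    have "(\<lambda>k. p k (fbase 1 x) - f k (fbase 1 x)) \<longlonglongrightarrow> 0"
    proof (rule Lim_null_comparison)
      show "\<forall>\<^sub>F k in sequentially. norm (p k (fbase 1 x) - f k (fbase 1 x)) \<le> 1 / real (k + 1)"
        using p(2)[of "fbase 1 x"] by (auto intro!: always_eventually less_imp_le simp: abs_minus_commute add.commute)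
      show "(\<lambda>k. 1 / real (k + 1)) \<longlonglongrightarrow> 0"
        using LIMSEQ_inverse_real_of_nat by (simp add: inverse_eq_divide)
    qed
    from tendsto_add[OF this lim[of "fbase 1 x"]] show ?thesis by simp
  qed
  have "(\<lambda>k. integral\<^sup>L T01 (\<lambda>x. h x * of_real (p k (fbase 1 x)))) \<longlonglongrightarrow>
     integral\<^sup>L T01 (\<lambda>x. h x * of_real (indicator U (fbase 1 x)))"
  proof (rule integral_dominated_convergence[where w = "\<lambda>x. 2 * norm (h x)"])
    show "AE x in T01. norm (h x * of_real (p k (fbase 1 x))) \<le> 2 * norm (h x)" for k
    proof (intro AE_I2)
      fix x
      have "\<bar>f k (fbase 1 x)\<bar> \<le> 1" by (auto simp: f_def abs_if infdist_nonneg min_def)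
        (smt (verit) infdist_nonneg mult_nonneg_nonneg of_nat_0_le_iff)
      moreover have "\<bar>f k (fbase 1 x) - p k (fbase 1 x)\<bar> < 1 / (k + 1)"
        using p(2)[of "fbase 1 x" k] by (simp add: add.commute)
      moreover have "1 / real (k + 1) \<le> 1" by simp
      ultimately have "\<bar>p k (fbase 1 x)\<bar> \<le> 2" by linarith
      then show "norm (h x * of_real (p k (fbase 1 x))) \<le> 2 * norm (h x)"
        using mult_left_mono[of "\<bar>p k (fbase 1 x)\<bar>" 2 "norm (h x)"] by (simp add: norm_mult mult.commute)
    qed
    show "AE x in T01. (\<lambda>k. h x * of_real (p k (fbase 1 x))) \<longlonglongrightarrow> h x * of_real (indicator U (fbase 1 x))"
      by (intro AE_I2 tendsto_intros lim2)
    show "(\<lambda>x. h x * of_real (p k (fbase 1 x))) \<in> borel_measurable T01" for k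
      using fourier_null_polynomial[OF p(1)[of k] h] by (auto simp: fourier_null_def)
    have "(\<lambda>x. indicat_real U (fbase 1 x)) \<in> borel_measurable T01"
      using borel_open[OF \<open>open U\<close>] by measurable
    then show "(\<lambda>x. h x * complex_of_real (indicat_real U (fbase 1 x))) \<in> borel_measurable T01"
      using hint by measurable
  qed (use hint in auto)
  moreover have "integral\<^sup>L T01 (\<lambda>x. h x * of_real (p k (fbase 1 x))) = 0" for k
  proof -
    have "(\<lambda>x. h x * of_real (p k (fbase 1 x))) \<in> fourier_null" by (rule fourier_null_polynomial[OF p(1) h])
    then have "\<forall>n. integral\<^sup>L T01 (\<lambda>x. h x * of_real (p k (fbase 1 x)) * fbase n x) = 0"
      unfolding fourier_null_def by blast
    from spec[OF this, of 0] show ?thesis by simp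
  qed
  ultimately have "integral\<^sup>L T01 (\<lambda>x. h x * of_real (indicator U (fbase 1 x))) = 0"
    by (simp add: LIMSEQ_const_iff)
  then show ?thesis by (simp add: of_real_indicator)
qed

lemma fbase_eq_imp:
  assumes "fbase 1 x = fbase 1 y" "0 < x" "x < 1" "0 \<le> y" "y \<le> 1"
  shows "x = y"
proof -
  have "sin (2*pi*x) = sin (2*pi*y) \<and> cos (2*pi*x) = cos (2*pi*y)"
    using assms(1) by (simp add: fbase_def complex_eq_iff)
  then obtain n :: int where n: "2*pi*x = 2*pi*y + 2 * pi * n" using sin_cos_eq_iff by blast
  then have "2 * pi * x = 2 * pi * (y + n)" by (simp add: algebra_simps)
  then have "x = y + n" by simp
  with assms have "real_of_int n < 1 \<and> real_of_int n > -1" by linarith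
  then have "n = 0" by linarith
  with \<open>x = y + n\<close> show ?thesis by simp
qed

text \<open>
  The integral of \<open>h\<close> over every subinterval vanishes, and by Lebesgue's differentiation theorem
  \<open>h\<close> is almost everywhere the limit of its means over shrinking intervals.
\<close>

lemma fourier_null_imp_AE_zero:
  assumes h: "h \<in> fourier_null"
  shows "AE x in T01. h x = 0"
proof -
  have hint: "integrable T01 h" using h by (simp add: fourier_null_def)
  have 1: "integral\<^sup>L T01 (\<lambda>x. h x * indicator {a<..<b} x) = 0" if "0 \<le> a" "a < b" "b \<le> 1" for a b
  proof -
    \<comment> \<open>The arc over \<open>(a, b)\<close>, as the complement of a compact set.\<close>
    define U where "U = - (fbase 1 ` ({0..a} \<union> {b..1}))"
    have "compact (fbase 1 ` ({0..a} \<union> {b..1}))"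
      by (intro compact_continuous_image continuous_fbase compact_Un compact_Icc)
    then have "open U" unfolding U_def by (simp add: compact_imp_closed open_Compl)
    moreover have "U \<noteq> UNIV"
    proof -
      have "fbase 1 0 \<notin> U" using that by (auto simp: U_def)
      then show ?thesis by blast
    qed
    ultimately have "integral\<^sup>L T01 (\<lambda>x. h x * indicator U (fbase 1 x)) = 0" by (rule fourier_null_open[OF h])
    moreover have "integral\<^sup>L T01 (\<lambda>x. h x * indicator U (fbase 1 x)) = integral\<^sup>L T01 (\<lambda>x. h x * indicator {a<..<b} x)"
    proof (rule integral_cong_AE)
      have "{0,1} \<in> null_sets (lebesgue :: real measure)" by (simp add: finite_imp_null_set_lborel null_sets_completionI)
      then have "AE x in lebesgue. x \<notin> {0,1::real}" by (rule AE_not_in)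
      then have "AE x in T01. x \<in> {0<..<1}"
        unfolding AE_T01_iff by eventually_elim auto
      then show "AE x in T01. h x * indicator U (fbase 1 x) = h x * indicator {a<..<b} x"
      proof eventually_elim
        case (elim x)
        have "fbase 1 x \<in> U \<longleftrightarrow> a < x \<and> x < b"
        proof
          assume U: "fbase 1 x \<in> U"
          show "a < x \<and> x < b"
          proof (rule ccontr)
            assume "\<not> (a < x \<and> x < b)"
            then have "x \<in> {0..a} \<union> {b..1}" using elim by auto
            then show False using U by (auto simp: U_def)
          qed
        next
          assume ab: "a < x \<and> x < b"
          show "fbase 1 x \<in> U"
          proof (rule ccontr)
            assume "fbase 1 x \<notin> U"
            then obtain y where "y \<in> {0..a} \<union> {b..1}" "fbase 1 x = fbase 1 y"
              unfolding U_def by blast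
            then show False using fbase_eq_imp[of x y] elim ab that by auto
          qed
        qed
        then show ?case by (auto simp: indicator_def)
      qed
      show "(\<lambda>x. h x * indicator U (fbase 1 x)) \<in> borel_measurable T01"
        using hint borel_open[OF \<open>open U\<close>] by measurable
      have "indicator {a<..<b} \<in> borel_measurable T01"
        by (intro measurable_T01 measurable_completion) auto
      then show "(\<lambda>x. h x * indicator {a<..<b} x) \<in> borel_measurable T01"
        using hint by measurable
    qed
    ultimately show ?thesis by simp
  qed
  define H where "H = (\<lambda>x. if x \<in> {0..1} then h x else 0)"
  have Hint: "integrable lebesgue H"
    unfolding H_def using hint Lebesgue_Measure.integrable_restrict_UNIV[of "{0..1}" h] by simp
  then have Hon: "H integrable_on cbox a b" for a b
    by (meson integrable_on_lebesgue integrable_on_subcbox subset_UNIV)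
  obtain N where N: "negligible N" "\<And>x e. x \<notin> N \<Longrightarrow> 0 < e \<Longrightarrow>
      \<exists>d>0. \<forall>k. 0 < k \<and> k < d \<longrightarrow> norm (integral (cbox x (x + k *\<^sub>R One)) H /\<^sub>R k ^ DIM(real) - H x) < e"
    using integrable_ccontinuous_explicit[of H] Hon by blast
  have "H x = 0" if x: "x \<notin> N" "0 < x" "x < 1" for x
  proof (rule ccontr)
    assume "H x \<noteq> 0"
    then obtain d where d: "d > 0" "\<And>k. 0 < k \<Longrightarrow> k < d \<Longrightarrow> norm (integral (cbox x (x + k *\<^sub>R One)) H /\<^sub>R k ^ DIM(real) - H x) < norm (H x)"
      using N(2)[of x "norm (H x)"] x by auto
    define k where "k = min (d/2) (1 - x)"
    have k: "0 < k" "k < d" "x + k \<le> 1" using d x by (auto simp: k_def)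
    have "integral (cbox x (x + k *\<^sub>R One)) H = 0"
    proof -
      have "((\<lambda>y. h y * indicator {x<..<x+k} y) has_integral integral\<^sup>L T01 (\<lambda>y. h y * indicator {x<..<x+k} y)) {0..1}"
      proof (rule has_integral_integral_lebesgue_on)
        have [measurable]: "(indicator {x<..<x+k} :: real \<Rightarrow> complex) \<in> borel_measurable T01"
          by (intro measurable_T01 measurable_completion) auto
        show "integrable T01 (\<lambda>y. h y * indicator {x<..<x+k} y)"
        proof (rule Bochner_Integration.integrable_bound[OF hint])
          show "(\<lambda>y. h y * indicator {x<..<x+k} y) \<in> borel_measurable T01"
            using hint by measurable
        qed (auto simp: norm_mult indicator_def)
      qed simp
      then have "((\<lambda>y. h y * indicator {x<..<x+k} y) has_integral 0) {0..1}" using 1[of x "x+k"] x k by simp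
      then have "((\<lambda>y. if y \<in> {x<..<x+k} then h y else 0) has_integral 0) {0..1}"
        by (rule has_integral_eq[rotated]) (auto simp: indicator_def)
      then have "(h has_integral 0) {x<..<x+k}"
        by (subst (asm) has_integral_restrict) (use x k in auto)
      then have "(h has_integral 0) {x..x+k}" by (simp add: has_integral_Icc_iff_Ioo)
      then have "(H has_integral 0) {x..x+k}"
        by (rule has_integral_eq[rotated]) (use x k in \<open>auto simp: H_def\<close>)
      then show ?thesis by (simp add: integral_unique)
    qed
    then show False using d(2)[of k] k by simp
  qed
  then have "AE x in T01. h x = 0"
  proof -
    have "N \<union> {0,1} \<in> null_sets lebesgue"
      using N(1) by (simp add: negligible_iff_null_sets[symmetric] negligible_Un)
    then have "AE x in lebesgue. x \<notin> N \<union> {0,1}" by (rule AE_not_in)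
    then show ?thesis unfolding AE_T01_iff
    proof eventually_elim
      case (elim x)
      then show ?case using \<open>\<And>x. x \<notin> N \<Longrightarrow> 0 < x \<Longrightarrow> x < 1 \<Longrightarrow> H x = 0\<close>[of x] by (auto simp: H_def)
    qed
  qed
  then show ?thesis .
qed

text \<open>
  The completeness of the trigonometric system, in the form in which it is used below: for the
  uniqueness of weak derivatives and for Fourier inversion.
\<close>

lemma fcoef_zero_imp_AE_zero:
  assumes "integrable T01 h" "\<And>n. fcoef h n = 0"
  shows "AE x in T01. h x = 0"
proof (rule fourier_null_imp_AE_zero)
  have "integral\<^sup>L T01 (\<lambda>x. h x * fbase n x) = 0" for n
    using assms(2)[of "-n"] by (simp add: fcoef_def)
  with assms(1) show "h \<in> fourier_null" by (simp add: fourier_null_def)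
qed

section \<open>Square-integrable periodic functions\<close>

lemma torus_L2_iff:
  "w \<in> torus_L2 \<longleftrightarrow> periodic1 w \<and> w \<in> borel_measurable lebesgue \<and> integrable T01 (\<lambda>x. (norm (w x))\<^sup>2)"
  by (simp add: torus_L2_def set_integrable_T01)

lemma torus_L2_measurable: "w \<in> torus_L2 \<Longrightarrow> w \<in> borel_measurable T01"
  by (simp add: torus_L2_iff measurable_T01)

lemma torus_L2_norm_mult:
  assumes "f \<in> torus_L2" "g \<in> torus_L2"
  shows "integrable T01 (\<lambda>x. norm (f x) * norm (g x))"
proof (rule Bochner_Integration.integrable_bound)
  show "integrable T01 (\<lambda>x. (norm (f x))\<^sup>2 + (norm (g x))\<^sup>2)"
    using assms by (auto simp: torus_L2_iff)
  show "(\<lambda>x. norm (f x) * norm (g x)) \<in> borel_measurable T01"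
    using assms[THEN torus_L2_measurable] by measurable
  show "AE x in T01. norm (norm (f x) * norm (g x)) \<le> norm ((norm (f x))\<^sup>2 + (norm (g x))\<^sup>2)"
  proof (intro AE_I2)
    fix x
    have "2 * norm (f x) * norm (g x) \<le> (norm (f x))\<^sup>2 + (norm (g x))\<^sup>2" by (rule sum_squares_bound)
    moreover have "0 \<le> norm (f x) * norm (g x)" by simp
    ultimately have "norm (f x) * norm (g x) \<le> (norm (f x))\<^sup>2 + (norm (g x))\<^sup>2" by linarith
    then show "norm (norm (f x) * norm (g x)) \<le> norm ((norm (f x))\<^sup>2 + (norm (g x))\<^sup>2)"
      by simp
  qed
qed

lemma torus_L2_bounded:
  assumes "periodic1 w" "w \<in> borel_measurable lebesgue" "\<And>x. norm (w x) \<le> B"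
  shows "w \<in> torus_L2"
  unfolding torus_L2_iff
proof (intro conjI assms integrable_T01_bounded)
  show "(\<lambda>x. (norm (w x))\<^sup>2) \<in> borel_measurable T01" using measurable_T01[OF assms(2)] by measurable
  show "norm ((norm (w x))\<^sup>2) \<le> B\<^sup>2" for x using assms(3)[of x] by (simp add: power_mono)
qed

lemma periodic1_bounded:
  fixes w :: "real \<Rightarrow> 'a::real_normed_vector"
  assumes "continuous_on UNIV w" "periodic1 w"
  obtains B where "\<And>x. norm (w x) \<le> B"
proof -
  have "compact (w ` {0..1})" by (rule compact_continuous_image) (use assms continuous_on_subset in auto)
  then obtain B where B: "\<And>x. x \<in> {0..1} \<Longrightarrow> norm (w x) \<le> B" by (meson compact_imp_bounded bounded_iff image_eqI)
  have "norm (w x) \<le> B" for x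
  proof -
    \<comment> \<open>Reduce to the fundamental period.\<close>
    have "x + of_int (- floor x) \<in> {0..1}" by (simp; linarith)
    with B have "norm (w (x + of_int (- floor x))) \<le> B" by blast
    then show ?thesis by (simp only: periodic1_int[OF assms(2)])
  qed
  then show ?thesis by (rule that)
qed

lemma measurable_lebesgue_continuous:
  fixes w :: "real \<Rightarrow> 'a::euclidean_space"
  shows "continuous_on UNIV w \<Longrightarrow> w \<in> borel_measurable lebesgue"
  by (rule measurable_completion) (simp add: borel_measurable_continuous_onI)

lemma torus_L2_continuous:
  fixes w :: "real \<Rightarrow> 'a::euclidean_space"
  assumes "continuous_on UNIV w" "periodic1 w"
  shows "w \<in> torus_L2"
  using periodic1_bounded[OF assms] torus_L2_bounded measurable_lebesgue_continuous assms by metis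

lemma torus_L2_integrable:
  assumes "w \<in> torus_L2" shows "integrable T01 w"
proof (rule Bochner_Integration.integrable_bound)
  have "(\<lambda>x. 1::real) \<in> torus_L2" by (rule torus_L2_continuous) (auto simp: periodic1_def)
  from torus_L2_norm_mult[OF this assms] show "integrable T01 (\<lambda>x. norm (w x))" by simp
qed (use torus_L2_measurable[OF assms] in auto)

lemma torus_L2_linear:
  assumes "w \<in> torus_L2" "bounded_linear T"
  shows "(\<lambda>x. T (w x)) \<in> torus_L2"
  unfolding torus_L2_iff
proof (intro conjI)
  interpret bounded_linear T by fact
  show "periodic1 (\<lambda>x. T (w x))" using assms by (simp add: torus_L2_iff periodic1_def)
  have "T \<in> borel_measurable borel" by (intro borel_measurable_continuous_onI linear_continuous_on assms)
  then show m: "(\<lambda>x. T (w x)) \<in> borel_measurable lebesgue"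
    using assms(1) by (auto simp: torus_L2_iff intro: measurable_compose)
  obtain K where K: "\<And>x. norm (T x) \<le> norm x * K" using bounded by blast
  have i: "integrable T01 (\<lambda>x. K\<^sup>2 * (norm (w x))\<^sup>2)" using assms by (simp add: torus_L2_iff)
  show "integrable T01 (\<lambda>x. (norm (T (w x)))\<^sup>2)"
  proof (rule Bochner_Integration.integrable_bound[OF i])
    show "(\<lambda>x. (norm (T (w x)))\<^sup>2) \<in> borel_measurable T01" using measurable_T01[OF m] by measurable
    show "AE x in T01. norm ((norm (T (w x)))\<^sup>2) \<le> norm (K\<^sup>2 * (norm (w x))\<^sup>2)"
      using K by (auto intro!: AE_I2 power_mono simp: power_mult_distrib[symmetric] mult.commute)
  qed
qed

lemma torus_L2_add:
  assumes "f \<in> torus_L2" "g \<in> torus_L2"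
  shows "(\<lambda>x. f x + g x) \<in> torus_L2"
  unfolding torus_L2_iff
proof (intro conjI)
  show "periodic1 (\<lambda>x. f x + g x)" using assms by (simp add: torus_L2_iff periodic1_def)
  show m: "(\<lambda>x. f x + g x) \<in> borel_measurable lebesgue" using assms by (auto simp: torus_L2_iff)
  have i: "integrable T01 (\<lambda>x. 2 * (norm (f x))\<^sup>2 + 2 * (norm (g x))\<^sup>2)" using assms by (simp add: torus_L2_iff)
  show "integrable T01 (\<lambda>x. (norm (f x + g x))\<^sup>2)"
  proof (rule Bochner_Integration.integrable_bound[OF i])
    show "(\<lambda>x. (norm (f x + g x))\<^sup>2) \<in> borel_measurable T01" using measurable_T01[OF m] by measurable
    show "AE x in T01. norm ((norm (f x + g x))\<^sup>2) \<le> norm (2 * (norm (f x))\<^sup>2 + 2 * (norm (g x))\<^sup>2)"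
    proof (intro AE_I2)
      fix x
      have "(norm (f x + g x))\<^sup>2 \<le> (norm (f x) + norm (g x))\<^sup>2"
        by (intro power_mono norm_triangle_ineq) simp
      also have "\<dots> \<le> 2 * (norm (f x))\<^sup>2 + 2 * (norm (g x))\<^sup>2"
        using sum_squares_bound[of "norm (f x)" "norm (g x)"] by (simp add: power2_sum)
      finally show "norm ((norm (f x + g x))\<^sup>2) \<le> norm (2 * (norm (f x))\<^sup>2 + 2 * (norm (g x))\<^sup>2)" by simp
    qed
  qed
qed

lemma torus_L2_diff:
  fixes f g :: "real \<Rightarrow> 'a::euclidean_space"
  assumes "f \<in> torus_L2" "g \<in> torus_L2"
  shows "(\<lambda>x. f x - g x) \<in> torus_L2"
proof -
  have "(\<lambda>x. - g x) \<in> torus_L2" by (rule torus_L2_linear[OF assms(2)]) (simp add: bounded_linear_minus bounded_linear_ident)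
  from torus_L2_add[OF assms(1) this] show ?thesis by simp
qed

lemma torus_L2_mult_bounded:
  fixes f g :: "real \<Rightarrow> complex"
  assumes "f \<in> torus_L2" "g \<in> torus_L2" "AE x in lebesgue. norm (g x) \<le> B"
  shows "(\<lambda>x. g x * f x) \<in> torus_L2"
  unfolding torus_L2_iff
proof (intro conjI)
  show "periodic1 (\<lambda>x. g x * f x)" using assms by (simp add: torus_L2_iff periodic1_def)
  show m: "(\<lambda>x. g x * f x) \<in> borel_measurable lebesgue" using assms by (auto simp: torus_L2_iff)
  have i: "integrable T01 (\<lambda>x. B\<^sup>2 * (norm (f x))\<^sup>2)" using assms by (simp add: torus_L2_iff)
  show "integrable T01 (\<lambda>x. (norm (g x * f x))\<^sup>2)"
  proof (rule Bochner_Integration.integrable_bound[OF i])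
    show "(\<lambda>x. (norm (g x * f x))\<^sup>2) \<in> borel_measurable T01" using measurable_T01[OF m] by measurable
    show "AE x in T01. norm ((norm (g x * f x))\<^sup>2) \<le> norm (B\<^sup>2 * (norm (f x))\<^sup>2)"
      using AE_T01I[OF assms(3)]
      by eventually_elim (simp add: norm_mult power_mult_distrib mult_right_mono power_mono)
  qed
qed

definition l2norm :: "(real \<Rightarrow> 'a::euclidean_space) \<Rightarrow> real" where
  "l2norm w = sqrt (integral\<^sup>L T01 (\<lambda>x. (norm (w x))\<^sup>2))"

lemma l2norm_nonneg [simp]: "0 \<le> l2norm w" by (simp add: l2norm_def)

lemma l2norm_sq: "(l2norm w)\<^sup>2 = integral\<^sup>L T01 (\<lambda>x. (norm (w x))\<^sup>2)"
  by (simp add: l2norm_def)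

text \<open>
  The quadratic polynomial \<open>s \<mapsto> \<parallel>|f| - s |g|\<parallel>\<^sup>2\<close> is nonnegative.
\<close>

lemma L2_Cauchy_Schwarz:
  assumes "f \<in> torus_L2" "g \<in> torus_L2"
  shows "integral\<^sup>L T01 (\<lambda>x. norm (f x) * norm (g x)) \<le> l2norm f * l2norm g"
proof -
  define A where "A = (l2norm f)\<^sup>2"
  define B where "B = (l2norm g)\<^sup>2"
  define C where "C = integral\<^sup>L T01 (\<lambda>x. norm (f x) * norm (g x))"
  have i: "integrable T01 (\<lambda>x. (norm (f x))\<^sup>2)" "integrable T01 (\<lambda>x. (norm (g x))\<^sup>2)"
     "integrable T01 (\<lambda>x. norm (f x) * norm (g x))"
    using assms torus_L2_norm_mult[OF assms] by (auto simp: torus_L2_iff)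
  \<comment> \<open>The claim is that the discriminant of this polynomial in \<open>s\<close> is not positive.\<close>
  have q: "0 \<le> A - 2 * s * C + s\<^sup>2 * B" for s
  proof -
    have "0 \<le> integral\<^sup>L T01 (\<lambda>x. (norm (f x) - s * norm (g x))\<^sup>2)" by simp
    also have "(\<lambda>x. (norm (f x) - s * norm (g x))\<^sup>2) = (\<lambda>x. (norm (f x))\<^sup>2 - 2 * s * (norm (f x) * norm (g x)) + s\<^sup>2 * (norm (g x))\<^sup>2)"
      by (simp add: fun_eq_iff power2_eq_square algebra_simps)
    also have "integral\<^sup>L T01 \<dots> = A - 2 * s * C + s\<^sup>2 * B"
      unfolding A_def B_def C_def l2norm_sq using i by simp
    finally show ?thesis .
  qed
  have "C\<^sup>2 \<le> A * B"
  proof (cases "B = 0")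
    case True
    have "C = 0"
    proof (rule ccontr)
      assume "C \<noteq> 0"
      then show False using q[of "(A + 1) / (2 * C)"] True by (simp add: field_simps)
    qed
    then show ?thesis using True by simp
  next
    case False
    then have "B > 0" by (simp add: B_def)
    then show ?thesis using q[of "C / B"] by (simp add: field_simps power2_eq_square)
  qed
  then have "C\<^sup>2 \<le> (l2norm f * l2norm g)\<^sup>2" by (simp add: A_def B_def power_mult_distrib)
  then show ?thesis unfolding C_def[symmetric] by (rule power2_le_imp_le) simp
qed

lemma L2_integral_mult_le:
  fixes f g :: "real \<Rightarrow> complex"
  assumes "f \<in> torus_L2" "g \<in> torus_L2"
  shows "norm (integral\<^sup>L T01 (\<lambda>x. f x * g x)) \<le> l2norm f * l2norm g"
proof -
  have "norm (integral\<^sup>L T01 (\<lambda>x. f x * g x)) \<le> integral\<^sup>L T01 (\<lambda>x. norm (f x * g x))"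
    by (rule integral_norm_bound)
  then show ?thesis using L2_Cauchy_Schwarz[OF assms] by (simp add: norm_mult)
qed

lemma torus_L2_mult_integrable:
  fixes f g :: "real \<Rightarrow> complex"
  assumes "f \<in> torus_L2" "g \<in> torus_L2"
  shows "integrable T01 (\<lambda>x. f x * g x)"
  using torus_L2_norm_mult[OF assms] assms[THEN torus_L2_measurable]
  by (auto intro: Bochner_Integration.integrable_bound simp: norm_mult)

section \<open>Weak derivatives\<close>

lemma is_weak_deriv_T01:
  "is_weak_deriv j w g \<longleftrightarrow> (\<forall>\<phi>\<in>torus_test.
     integral\<^sup>L T01 (\<lambda>x. (deriv ^^ j) \<phi> x *\<^sub>R w x) = (- 1) ^ j *\<^sub>R integral\<^sup>L T01 (\<lambda>x. \<phi> x *\<^sub>R g x))"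
  by (simp add: is_weak_deriv_def lint_T01)

lemma sobolev_norm_l2norm: "sobolev_norm s w = sqrt (\<Sum>j\<le>s. (l2norm (weak_deriv j w))\<^sup>2)"
  by (simp add: sobolev_norm_def lint_T01 l2norm_sq)

text \<open>
  With a free phase, cosines are stable under differentiation up to a factor, and \<open>c = -pi/2\<close> gives
  the sines. They are the only test functions that are ever inserted explicitly.
\<close>

lemma deriv_funpow_cos:
  "(deriv ^^ j) (\<lambda>x. cos (a * x + c)) = (\<lambda>x. a ^ j * cos (a * x + c + of_nat j * (pi / 2)))"
proof (induction j)
  case (Suc j)
  have "deriv (\<lambda>x. a ^ j * cos (a * x + c + of_nat j * (pi / 2))) x =
     a ^ Suc j * cos (a * x + c + of_nat (Suc j) * (pi / 2))" for x
  proof (rule DERIV_imp_deriv)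
    have "cos (a * x + c + of_nat (Suc j) * (pi / 2)) = - sin (a * x + c + of_nat j * (pi / 2))"
      using cos_add[of "a * x + c + of_nat j * (pi / 2)" "pi / 2"] by (simp add: algebra_simps add_divide_distrib)
    then show "((\<lambda>x. a ^ j * cos (a * x + c + of_nat j * (pi / 2))) has_field_derivative
       a ^ Suc j * cos (a * x + c + of_nat (Suc j) * (pi / 2))) (at x)"
      by (auto intro!: derivative_eq_intros)
  qed
  then show ?case by (simp only: funpow.simps o_apply Suc.IH)
qed simp

lemma cos_torus_test: "(\<lambda>x. cos (2 * pi * of_int n * x + c)) \<in> torus_test"
proof -
  have "cos (2 * pi * of_int n * (x + 1) + c) = cos (2 * pi * of_int n * x + c)" for x
  proof -
    have "2 * pi * of_int n * (x + 1) + c = (2 * pi * of_int n * x + c) + 2 * pi * of_int n"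
      by (simp add: algebra_simps)
    then show ?thesis by (simp only: cos_add cos_int_2pin sin_int_2pin) simp
  qed
  moreover have "(\<lambda>x. a ^ j * cos (a * x + c + of_nat j * (pi / 2))) differentiable at x" for a x :: real and j
  proof -
    have "((\<lambda>x. a ^ j * cos (a * x + c + of_nat j * (pi / 2))) has_real_derivative
        a ^ j * (- sin (a * x + c + of_nat j * (pi / 2)) * a)) (at x)"
      by (auto intro!: derivative_eq_intros)
    then show ?thesis using real_differentiable_def by blast
  qed
  ultimately show ?thesis
    by (simp only: torus_test_def periodic1_def mem_Collect_eq deriv_funpow_cos) blast
qed

lemma torus_test_differentiable: "\<phi> \<in> torus_test \<Longrightarrow> (deriv ^^ n) \<phi> differentiable (at x)"
  by (simp add: torus_test_def)

lemma torus_test_DERIV: "\<phi> \<in> torus_test \<Longrightarrow> (\<phi> has_real_derivative deriv \<phi> x) (at x)"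
  using DERIV_deriv_iff_real_differentiable[of \<phi> x] torus_test_differentiable[of \<phi> 0 x] by simp

lemma torus_test_continuous: "\<phi> \<in> torus_test \<Longrightarrow> continuous_on UNIV \<phi>"
  by (meson DERIV_isCont continuous_at_imp_continuous_on torus_test_DERIV)

lemma torus_test_deriv:
  assumes "\<phi> \<in> torus_test" shows "deriv \<phi> \<in> torus_test"
proof -
  note d = torus_test_DERIV[OF assms]
  have "deriv \<phi> (x + 1) = deriv \<phi> x" for x
  proof -
    have "((\<lambda>x. \<phi> (x + 1)) has_real_derivative deriv \<phi> (x + 1)) (at x)"
      using d[of "x + 1"] by (subst (asm) DERIV_shift) simp
    moreover have "(\<lambda>x. \<phi> (x + 1)) = \<phi>" using assms by (auto simp: torus_test_def periodic1_def)
    ultimately have "(\<phi> has_real_derivative deriv \<phi> (x + 1)) (at x)" by simp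
    then show ?thesis using d[of x] by (rule DERIV_unique)
  qed
  moreover have "((deriv ^^ n) (deriv \<phi>)) differentiable (at x)" for n x
    using torus_test_differentiable[OF assms, of "Suc n" x] by (simp add: funpow_swap1)
  ultimately show ?thesis by (simp add: torus_test_def periodic1_def)
qed

lemma torus_test_funpow: "\<phi> \<in> torus_test \<Longrightarrow> (deriv ^^ j) \<phi> \<in> torus_test"
  by (induction j) (auto intro: torus_test_deriv)

lemma torus_test_integrable:
  fixes w :: "real \<Rightarrow> 'a::euclidean_space"
  assumes "\<phi> \<in> torus_test" "integrable T01 w"
  shows "integrable T01 (\<lambda>x. \<phi> x *\<^sub>R w x)"
proof -
  have per: "periodic1 \<phi>" using assms by (simp add: torus_test_def)
  obtain B where B: "\<And>x. norm (\<phi> x) \<le> B" using periodic1_bounded[OF torus_test_continuous[OF assms(1)] per] by metis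
  show ?thesis
  proof (rule Bochner_Integration.integrable_bound)
    show "integrable T01 (\<lambda>x. B * norm (w x))" using assms by simp
    show "(\<lambda>x. \<phi> x *\<^sub>R w x) \<in> borel_measurable T01"
      using measurable_T01[OF measurable_lebesgue_continuous[OF torus_test_continuous[OF assms(1)]]] assms(2)
      by measurable
    show "AE x in T01. norm (\<phi> x *\<^sub>R w x) \<le> norm (B * norm (w x))"
    proof (intro AE_I2)
      fix x
      have "\<bar>\<phi> x\<bar> \<le> \<bar>B\<bar>" using B[of x] by simp
      then show "norm (\<phi> x *\<^sub>R w x) \<le> norm (B * norm (w x))"
        by (simp add: abs_mult mult_right_mono)
    qed
  qed
qed

text \<open>
  Testing with cosines and sines shows that the Fourier coefficients of each component vanish.
\<close>

lemma torus_test_integral_zero_AE: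
  fixes h :: "real \<Rightarrow> 'a::euclidean_space"
  assumes h: "integrable T01 h" "\<And>\<phi>. \<phi> \<in> torus_test \<Longrightarrow> integral\<^sup>L T01 (\<lambda>x. \<phi> x *\<^sub>R h x) = 0"
  shows "AE x in T01. h x = 0"
proof -
  have "AE x in T01. h x \<bullet> b = 0" if "b \<in> Basis" for b
  proof -
    have hb: "integrable T01 (\<lambda>x. h x \<bullet> b)" using h by simp
    have z: "integral\<^sup>L T01 (\<lambda>x. \<phi> x * (h x \<bullet> b)) = 0" if "\<phi> \<in> torus_test" for \<phi>
    proof -
      have "integral\<^sup>L T01 (\<lambda>x. (\<phi> x *\<^sub>R h x) \<bullet> b) = integral\<^sup>L T01 (\<lambda>x. \<phi> x *\<^sub>R h x) \<bullet> b"
        by (rule integral_inner_left) (use torus_test_integrable[OF that h(1)] in simp)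
      with h(2)[OF that] show ?thesis by simp
    qed
    have "AE x in T01. complex_of_real (h x \<bullet> b) = 0"
    proof (rule fcoef_zero_imp_AE_zero)
      show "integrable T01 (\<lambda>x. complex_of_real (h x \<bullet> b))" using hb by simp
      fix n
      define \<phi>1 where "\<phi>1 = (\<lambda>x. cos (2 * pi * of_int n * x + 0))"
      define \<phi>2 where "\<phi>2 = (\<lambda>x. cos (2 * pi * of_int n * x + (- pi / 2)))"
      have t: "\<phi>1 \<in> torus_test" "\<phi>2 \<in> torus_test" unfolding \<phi>1_def \<phi>2_def by (rule cos_torus_test)+
      have i: "integrable T01 (\<lambda>x. complex_of_real (\<phi> x * (h x \<bullet> b)))" if "\<phi> \<in> torus_test" for \<phi>
      proof -
        have "integrable T01 (\<lambda>x. \<phi> x * (h x \<bullet> b))"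
          using torus_test_integrable[OF that hb] by simp
        then show ?thesis by (rule integrable_of_real)
      qed
      have "fbase (- n) x = \<phi>1 x - \<i> * \<phi>2 x" for x
        by (simp add: fbase_def \<phi>1_def \<phi>2_def complex_eq_iff cos_diff)
      note fb = this
      have "(\<lambda>x. complex_of_real (h x \<bullet> b) * fbase (- n) x) =
        (\<lambda>x. complex_of_real (\<phi>1 x * (h x \<bullet> b)) - \<i> * complex_of_real (\<phi>2 x * (h x \<bullet> b)))"
        unfolding fb of_real_mult by (simp add: fun_eq_iff algebra_simps)
      then have "fcoef (\<lambda>x. complex_of_real (h x \<bullet> b)) n =
        integral\<^sup>L T01 (\<lambda>x. complex_of_real (\<phi>1 x * (h x \<bullet> b)) - \<i> * complex_of_real (\<phi>2 x * (h x \<bullet> b)))"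
        unfolding fcoef_def by (rule arg_cong)
      also have "\<dots> = integral\<^sup>L T01 (\<lambda>x. complex_of_real (\<phi>1 x * (h x \<bullet> b))) - \<i> * integral\<^sup>L T01 (\<lambda>x. complex_of_real (\<phi>2 x * (h x \<bullet> b)))"
        using i[OF t(1)] i[OF t(2)] by (subst Bochner_Integration.integral_diff) simp_all
      also have "\<dots> = 0" by (simp only: integral_complex_of_real z[OF t(1)] z[OF t(2)]) simp
      finally show "fcoef (\<lambda>x. complex_of_real (h x \<bullet> b)) n = 0" .
    qed
    then show ?thesis by simp
  qed
  then have "AE x in T01. \<forall>b\<in>Basis. h x \<bullet> b = 0" by (intro AE_finite_allI) auto
  then show ?thesis by eventually_elim (simp add: euclidean_eq_iff[where 'a='a])
qed

text \<open>
  This is what makes \<open>weak_deriv\<close>, which is defined by choice, computable: it agrees almost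
  everywhere with any weak derivative that one can exhibit.
\<close>

lemma is_weak_deriv_unique:
  fixes w :: "real \<Rightarrow> 'a::euclidean_space"
  assumes "is_weak_deriv j w f" "is_weak_deriv j w g" "f \<in> torus_L2" "g \<in> torus_L2"
  shows "AE x in lebesgue. f x = g x"
proof (rule AE_T01_periodic)
  have "AE x in T01. f x - g x = 0"
  proof (rule torus_test_integral_zero_AE)
    show "integrable T01 (\<lambda>x. f x - g x)" using assms by (simp add: torus_L2_integrable)
    fix \<phi> assume \<phi>: "\<phi> \<in> torus_test"
    have "integral\<^sup>L T01 (\<lambda>x. \<phi> x *\<^sub>R f x) = integral\<^sup>L T01 (\<lambda>x. \<phi> x *\<^sub>R g x)"
      using assms(1,2) \<phi> by (simp add: is_weak_deriv_T01)
    then show "integral\<^sup>L T01 (\<lambda>x. \<phi> x *\<^sub>R (f x - g x)) = 0"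
      using assms(3,4)[THEN torus_L2_integrable, THEN torus_test_integrable[OF \<phi>]]
      by (simp add: scaleR_diff_right)
  qed
  then show "AE x in T01. f x = g x" by simp
  show "periodic1 (\<lambda>x. f x = g x)" using assms(3,4) by (simp add: torus_L2_iff periodic1_def)
qed

lemma sobolev_weak_deriv:
  assumes "w \<in> sobolev s" "j \<le> s"
  shows "weak_deriv j w \<in> torus_L2" "is_weak_deriv j w (weak_deriv j w)"
proof -
  have "\<exists>g. g \<in> torus_L2 \<and> is_weak_deriv j w g" using assms by (auto simp: sobolev_def)
  from someI_ex[OF this] show "weak_deriv j w \<in> torus_L2" "is_weak_deriv j w (weak_deriv j w)"
    by (auto simp: weak_deriv_def)
qed

lemma weak_deriv_AE:
  assumes "g \<in> torus_L2" "is_weak_deriv j w g"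
  shows "AE x in lebesgue. weak_deriv j w x = g x"
proof -
  have "\<exists>g. g \<in> torus_L2 \<and> is_weak_deriv j w g" using assms by auto
  from someI_ex[OF this] have "weak_deriv j w \<in> torus_L2" "is_weak_deriv j w (weak_deriv j w)"
    by (auto simp: weak_deriv_def)
  with assms show ?thesis by (intro is_weak_deriv_unique) auto
qed

lemma sobolev_mono: "w \<in> sobolev s \<Longrightarrow> r \<le> s \<Longrightarrow> w \<in> sobolev r"
  by (auto simp: sobolev_def)

lemma sobolev_L2: "w \<in> sobolev s \<Longrightarrow> w \<in> torus_L2"
  by (simp add: sobolev_def)

lemma is_weak_deriv_0: "is_weak_deriv 0 w w"
  by (simp add: is_weak_deriv_T01)

lemma is_weak_deriv_add:
  fixes v w :: "real \<Rightarrow> 'a::euclidean_space"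
  assumes "is_weak_deriv j w g" "is_weak_deriv j v h" "w \<in> torus_L2" "g \<in> torus_L2" "v \<in> torus_L2" "h \<in> torus_L2"
  shows "is_weak_deriv j (\<lambda>x. w x + v x) (\<lambda>x. g x + h x)"
  unfolding is_weak_deriv_T01
proof
  fix \<phi> assume \<phi>: "\<phi> \<in> torus_test"
  note i = assms(3-6)[THEN torus_L2_integrable, THEN torus_test_integrable[OF \<phi>]]
    assms(3-6)[THEN torus_L2_integrable, THEN torus_test_integrable[OF torus_test_funpow[OF \<phi>, of j]]]
  show "integral\<^sup>L T01 (\<lambda>x. (deriv ^^ j) \<phi> x *\<^sub>R (w x + v x)) = (- 1) ^ j *\<^sub>R integral\<^sup>L T01 (\<lambda>x. \<phi> x *\<^sub>R (g x + h x))"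
    using assms(1,2) \<phi> i by (simp add: is_weak_deriv_T01 scaleR_add_right)
qed

lemma is_weak_deriv_linear:
  fixes w :: "real \<Rightarrow> 'a::euclidean_space" and T :: "'a \<Rightarrow> 'b::euclidean_space"
  assumes "is_weak_deriv j w g" "w \<in> torus_L2" "g \<in> torus_L2" "bounded_linear T"
  shows "is_weak_deriv j (\<lambda>x. T (w x)) (\<lambda>x. T (g x))"
  unfolding is_weak_deriv_T01
proof
  interpret bounded_linear T by fact
  fix \<phi> assume \<phi>: "\<phi> \<in> torus_test"
  note i = assms(2-3)[THEN torus_L2_integrable, THEN torus_test_integrable[OF \<phi>]]
    assms(2-3)[THEN torus_L2_integrable, THEN torus_test_integrable[OF torus_test_funpow[OF \<phi>, of j]]]
  have "integral\<^sup>L T01 (\<lambda>x. (deriv ^^ j) \<phi> x *\<^sub>R T (w x)) = T (integral\<^sup>L T01 (\<lambda>x. (deriv ^^ j) \<phi> x *\<^sub>R w x))"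
    using integral_bounded_linear[OF assms(4) i(3)] by (simp add: scaleR)
  also have "\<dots> = (- 1) ^ j *\<^sub>R T (integral\<^sup>L T01 (\<lambda>x. \<phi> x *\<^sub>R g x))"
    using assms(1) \<phi> by (simp add: is_weak_deriv_T01 scaleR)
  also have "T (integral\<^sup>L T01 (\<lambda>x. \<phi> x *\<^sub>R g x)) = integral\<^sup>L T01 (\<lambda>x. \<phi> x *\<^sub>R T (g x))"
    using integral_bounded_linear[OF assms(4) i(2)] by (simp add: scaleR)
  finally show "integral\<^sup>L T01 (\<lambda>x. (deriv ^^ j) \<phi> x *\<^sub>R T (w x)) = (- 1) ^ j *\<^sub>R integral\<^sup>L T01 (\<lambda>x. \<phi> x *\<^sub>R T (g x))" .
qed

lemma sobolev_add:
  fixes v w :: "real \<Rightarrow> 'a::euclidean_space"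
  assumes "w \<in> sobolev s" "v \<in> sobolev s"
  shows "(\<lambda>x. w x + v x) \<in> sobolev s"
    and "j \<le> s \<Longrightarrow> AE x in lebesgue. weak_deriv j (\<lambda>x. w x + v x) x = weak_deriv j w x + weak_deriv j v x"
proof -
  have *: "(\<lambda>x. weak_deriv j w x + weak_deriv j v x) \<in> torus_L2"
    "is_weak_deriv j (\<lambda>x. w x + v x) (\<lambda>x. weak_deriv j w x + weak_deriv j v x)" if "j \<le> s" for j
    using assms[THEN sobolev_weak_deriv(1), OF that] assms[THEN sobolev_weak_deriv(2), OF that] assms[THEN sobolev_L2]
    by (auto intro: torus_L2_add is_weak_deriv_add)
  show "(\<lambda>x. w x + v x) \<in> sobolev s"
    using * assms[THEN sobolev_L2] torus_L2_add unfolding sobolev_def by blast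
  show "j \<le> s \<Longrightarrow> AE x in lebesgue. weak_deriv j (\<lambda>x. w x + v x) x = weak_deriv j w x + weak_deriv j v x"
    by (rule weak_deriv_AE) (use * in auto)
qed

lemma sobolev_linear:
  fixes w :: "real \<Rightarrow> 'a::euclidean_space" and T :: "'a \<Rightarrow> 'b::euclidean_space"
  assumes "w \<in> sobolev s" "bounded_linear T"
  shows "(\<lambda>x. T (w x)) \<in> sobolev s"
    and "j \<le> s \<Longrightarrow> AE x in lebesgue. weak_deriv j (\<lambda>x. T (w x)) x = T (weak_deriv j w x)"
proof -
  have *: "(\<lambda>x. T (weak_deriv j w x)) \<in> torus_L2"
    "is_weak_deriv j (\<lambda>x. T (w x)) (\<lambda>x. T (weak_deriv j w x))" if "j \<le> s" for j
    using sobolev_weak_deriv[OF assms(1) that] assms sobolev_L2[OF assms(1)]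
    by (auto intro: torus_L2_linear is_weak_deriv_linear)
  show "(\<lambda>x. T (w x)) \<in> sobolev s"
    using * torus_L2_linear[OF sobolev_L2[OF assms(1)] assms(2)] unfolding sobolev_def by blast
  show "j \<le> s \<Longrightarrow> AE x in lebesgue. weak_deriv j (\<lambda>x. T (w x)) x = T (weak_deriv j w x)"
    by (rule weak_deriv_AE) (use * in auto)
qed

lemma sobolev_diff:
  fixes v w :: "real \<Rightarrow> 'a::euclidean_space"
  assumes "w \<in> sobolev s" "v \<in> sobolev s"
  shows "(\<lambda>x. w x - v x) \<in> sobolev s"
    and "j \<le> s \<Longrightarrow> AE x in lebesgue. weak_deriv j (\<lambda>x. w x - v x) x = weak_deriv j w x - weak_deriv j v x"
proof -
  have l: "bounded_linear (\<lambda>x::'a. - x)" by (simp add: bounded_linear_minus bounded_linear_ident)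
  note v = sobolev_linear[OF assms(2) l]
  show "(\<lambda>x. w x - v x) \<in> sobolev s" using sobolev_add(1)[OF assms(1) v(1)] by simp
  show "AE x in lebesgue. weak_deriv j (\<lambda>x. w x - v x) x = weak_deriv j w x - weak_deriv j v x" if "j \<le> s"
    using sobolev_add(2)[OF assms(1) v(1) that] v(2)[OF that]
    by eventually_elim simp
qed

lemma l2norm_cong_AE:
  fixes f g :: "real \<Rightarrow> 'a::euclidean_space"
  assumes "AE x in lebesgue. f x = g x" "f \<in> torus_L2" "g \<in> torus_L2"
  shows "l2norm f = l2norm g"
proof -
  have "integral\<^sup>L T01 (\<lambda>x. (norm (f x))\<^sup>2) = integral\<^sup>L T01 (\<lambda>x. (norm (g x))\<^sup>2)"
  proof (rule integral_cong_AE)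
    show "AE x in T01. (norm (f x))\<^sup>2 = (norm (g x))\<^sup>2" using AE_T01I[OF assms(1)] by eventually_elim simp
  qed (use assms(2,3)[THEN torus_L2_measurable] in measurable)
  then show ?thesis by (simp add: l2norm_def)
qed

lemma l2norm_le_sobolev_norm:
  assumes "j \<le> s"
  shows "l2norm (weak_deriv j w) \<le> sobolev_norm s w"
proof -
  have "(l2norm (weak_deriv j w))\<^sup>2 \<le> (\<Sum>j\<le>s. (l2norm (weak_deriv j w))\<^sup>2)"
    by (rule member_le_sum) (use assms in auto)
  then show ?thesis unfolding sobolev_norm_l2norm by (rule real_le_rsqrt)
qed

lemma l2norm_le_sobolev_norm_0:
  fixes w :: "real \<Rightarrow> 'a::euclidean_space"
  assumes "w \<in> sobolev s"
  shows "l2norm w \<le> sobolev_norm s w"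
proof -
  have "AE x in lebesgue. weak_deriv 0 w x = w x"
    by (rule weak_deriv_AE) (use assms sobolev_L2 is_weak_deriv_0 in auto)
  then have "l2norm (weak_deriv 0 w) = l2norm w"
    by (rule l2norm_cong_AE) (use sobolev_weak_deriv(1)[OF assms] sobolev_L2[OF assms] in auto)
  then show ?thesis using l2norm_le_sobolev_norm[of 0 s w] by simp
qed

section \<open>Functions with continuous derivatives\<close>

lemma sobolev_norm_nonneg [simp]: "0 \<le> sobolev_norm s w"
  by (simp add: sobolev_norm_l2norm sum_nonneg)

text \<open>
  \<open>D i\<close> is the derivative of order \<open>i\<close> of the periodic function \<open>D 0\<close>. Carrying all derivatives as
  explicit data makes Sobolev norms of classical functions, and limits in them, a matter of suprema.
\<close>

definition cchain :: "nat \<Rightarrow> (nat \<Rightarrow> real \<Rightarrow> 'a::euclidean_space) \<Rightarrow> bool" where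
  "cchain m D \<longleftrightarrow> (\<forall>i\<le>m. continuous_on UNIV (D i) \<and> periodic1 (D i)) \<and>
     (\<forall>i<m. \<forall>x. (D i has_vector_derivative D (Suc i) x) (at x))"

lemma integrable_T01_UNIV:
  fixes f :: "real \<Rightarrow> 'a::euclidean_space"
  shows "continuous_on UNIV f \<Longrightarrow> integrable T01 f"
  by (rule integrable_T01_continuous[OF continuous_on_subset]) auto

text \<open>
  The boundary terms cancel by periodicity.
\<close>

lemma torus_integration_by_parts:
  fixes F f :: "real \<Rightarrow> 'a::euclidean_space"
  assumes "\<And>x. (F has_vector_derivative f x) (at x)" "continuous_on UNIV f" "periodic1 F" "\<phi> \<in> torus_test"
  shows "integral\<^sup>L T01 (\<lambda>x. deriv \<phi> x *\<^sub>R F x) = - integral\<^sup>L T01 (\<lambda>x. \<phi> x *\<^sub>R f x)"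
proof -
  have F: "continuous_on UNIV F"
    using assms(1) by (auto intro!: continuous_at_imp_continuous_on has_vector_derivative_continuous)
  note c = torus_test_continuous[OF assms(4)] torus_test_continuous[OF torus_test_deriv[OF assms(4)]]
  have i: "integrable T01 (\<lambda>x. deriv \<phi> x *\<^sub>R F x)" "integrable T01 (\<lambda>x. \<phi> x *\<^sub>R f x)"
    by (auto intro!: integrable_T01_UNIV continuous_on_scaleR c F assms)
  have "((\<lambda>x. \<phi> x *\<^sub>R f x + deriv \<phi> x *\<^sub>R F x) has_integral (\<phi> 1 *\<^sub>R F 1 - \<phi> 0 *\<^sub>R F 0)) {0..1}"
  proof (rule fundamental_theorem_of_calculus)
    fix x :: real
    show "((\<lambda>x. \<phi> x *\<^sub>R F x) has_vector_derivative \<phi> x *\<^sub>R f x + deriv \<phi> x *\<^sub>R F x) (at x within {0..1})"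
      using has_vector_derivative_scaleR[OF torus_test_DERIV[OF assms(4), of x] assms(1)[of x]]
      by (rule has_vector_derivative_at_within)
  qed simp
  moreover have "\<phi> 1 = \<phi> 0" "F 1 = F 0"
  proof -
    have "periodic1 \<phi>" using assms(4) by (simp add: torus_test_def)
    then show "\<phi> 1 = \<phi> 0" "F 1 = F 0" using assms(3) by (simp_all add: periodic1_def, (metis add_0)+)
  qed
  ultimately have "((\<lambda>x. \<phi> x *\<^sub>R f x + deriv \<phi> x *\<^sub>R F x) has_integral 0) {0..1}" by simp
  moreover have "((\<lambda>x. \<phi> x *\<^sub>R f x + deriv \<phi> x *\<^sub>R F x) has_integral integral\<^sup>L T01 (\<lambda>x. \<phi> x *\<^sub>R f x + deriv \<phi> x *\<^sub>R F x)) {0..1}"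
    by (rule has_integral_integral_lebesgue_on) (use i in auto)
  ultimately have "integral\<^sup>L T01 (\<lambda>x. \<phi> x *\<^sub>R f x + deriv \<phi> x *\<^sub>R F x) = 0"
    using has_integral_unique by blast
  then have "integral\<^sup>L T01 (\<lambda>x. \<phi> x *\<^sub>R f x) + integral\<^sup>L T01 (\<lambda>x. deriv \<phi> x *\<^sub>R F x) = 0"
    using i by simp
  then show ?thesis by (metis add.inverse_inverse add_eq_0_iff)
qed

lemma cchain_weak_deriv:
  assumes "cchain m D" "j \<le> m"
  shows "is_weak_deriv j (D 0) (D j)"
  using assms(2)
proof (induction j)
  case 0 then show ?case by (simp add: is_weak_deriv_0)
next
  case (Suc j)
  show ?case unfolding is_weak_deriv_T01
  proof
    fix \<phi> assume \<phi>: "\<phi> \<in> torus_test"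
    have "integral\<^sup>L T01 (\<lambda>x. (deriv ^^ Suc j) \<phi> x *\<^sub>R D 0 x) = integral\<^sup>L T01 (\<lambda>x. (deriv ^^ j) (deriv \<phi>) x *\<^sub>R D 0 x)"
      by (simp add: funpow_swap1)
    also have "\<dots> = (- 1) ^ j *\<^sub>R integral\<^sup>L T01 (\<lambda>x. deriv \<phi> x *\<^sub>R D j x)"
      using Suc torus_test_deriv[OF \<phi>] by (simp add: is_weak_deriv_T01)
    also have "integral\<^sup>L T01 (\<lambda>x. deriv \<phi> x *\<^sub>R D j x) = - integral\<^sup>L T01 (\<lambda>x. \<phi> x *\<^sub>R D (Suc j) x)"
      by (rule torus_integration_by_parts) (use assms(1) Suc.prems \<phi> in \<open>auto simp: cchain_def\<close>)
    finally show "integral\<^sup>L T01 (\<lambda>x. (deriv ^^ Suc j) \<phi> x *\<^sub>R D 0 x) = (- 1) ^ Suc j *\<^sub>R integral\<^sup>L T01 (\<lambda>x. \<phi> x *\<^sub>R D (Suc j) x)"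
      by simp
  qed
qed

lemma cchain_L2: "cchain m D \<Longrightarrow> j \<le> m \<Longrightarrow> D j \<in> torus_L2"
  by (rule torus_L2_continuous) (auto simp: cchain_def)

lemma cchain_sobolev:
  assumes "cchain m D" shows "D 0 \<in> sobolev m"
  unfolding sobolev_def
proof (intro CollectI conjI allI impI)
  show "D 0 \<in> torus_L2" using cchain_L2[OF assms] by simp
  show "\<exists>g\<in>torus_L2. is_weak_deriv j (D 0) g" if "j \<le> m" for j
    using cchain_L2[OF assms that] cchain_weak_deriv[OF assms that] by blast
qed

lemma cchain_weak_deriv_AE:
  "cchain m D \<Longrightarrow> j \<le> m \<Longrightarrow> AE x in lebesgue. weak_deriv j (D 0) x = D j x"
  by (rule weak_deriv_AE[OF cchain_L2 cchain_weak_deriv])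

text \<open>
  The period has length 1, so an \<open>L\<^sup>2\<close> norm is at most the supremum.
\<close>

lemma cchain_sobolev_norm_le:
  assumes "cchain m D" "\<And>j x. j \<le> m \<Longrightarrow> norm (D j x) \<le> B j"
  shows "sobolev_norm m (D 0) \<le> (\<Sum>j\<le>m. B j)"
proof -
  have B0: "0 \<le> B j" if "j \<le> m" for j using assms(2)[OF that, of 0] by (meson norm_ge_zero order_trans)
  have "l2norm (weak_deriv j (D 0)) \<le> B j" if "j \<le> m" for j
  proof -
    have "l2norm (weak_deriv j (D 0)) = l2norm (D j)"
      using that assms(1)
      by (intro l2norm_cong_AE cchain_weak_deriv_AE cchain_L2 sobolev_weak_deriv(1)[OF cchain_sobolev]) auto
    also have "\<dots> \<le> sqrt ((B j)\<^sup>2)" unfolding l2norm_def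
    proof (rule real_sqrt_le_mono)
      have "norm (integral\<^sup>L T01 (\<lambda>x. (norm (D j x))\<^sup>2)) \<le> (B j)\<^sup>2"
        by (rule integral_T01_norm_le) (use assms(2)[OF that] in \<open>auto intro: power_mono\<close>)
      then show "integral\<^sup>L T01 (\<lambda>x. (norm (D j x))\<^sup>2) \<le> (B j)\<^sup>2" by simp
    qed
    also have "\<dots> = B j" using B0[OF that] by simp
    finally show ?thesis .
  qed
  then have "(\<Sum>j\<le>m. l2norm (weak_deriv j (D 0))) \<le> (\<Sum>j\<le>m. B j)" by (intro sum_mono) auto
  moreover have "sobolev_norm m (D 0) \<le> (\<Sum>j\<le>m. l2norm (weak_deriv j (D 0)))"
    unfolding sobolev_norm_l2norm using L2_set_le_sum[of "{..m}" "\<lambda>j. l2norm (weak_deriv j (D 0))"]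
    by (simp add: L2_set_def)
  ultimately show ?thesis by linarith
qed

lemma cchain_diff:
  "cchain m D \<Longrightarrow> cchain m E \<Longrightarrow> cchain m (\<lambda>j x. D j x - E j x)"
  unfolding cchain_def periodic1_def
  by (auto intro!: continuous_intros has_vector_derivative_diff)

lemma cchain_linear:
  assumes "cchain m D" "bounded_linear T"
  shows "cchain m (\<lambda>j x. T (D j x))"
  unfolding cchain_def
proof (intro conjI allI impI)
  fix i x
  show "continuous_on UNIV (\<lambda>x. T (D i x))" if "i \<le> m"
    using that assms by (intro bounded_linear.continuous_on[OF assms(2)]) (auto simp: cchain_def)
  show "periodic1 (\<lambda>x. T (D i x))" if "i \<le> m"
    using that assms(1) by (auto simp: cchain_def periodic1_def)
  show "((\<lambda>x. T (D i x)) has_vector_derivative T (D (Suc i) x)) (at x)" if "i < m"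
    using that assms(1) by (intro bounded_linear.has_vector_derivative[OF assms(2)]) (auto simp: cchain_def)
qed

lemma cchain_const: "cchain m (\<lambda>j x. if j = 0 then c else 0)"
  unfolding cchain_def periodic1_def by auto

text \<open>
  Uniform convergence of all derivatives up to order \<open>m\<close> is how convergence in \<open>H\<^sup>m\<close> is verified for
  the explicit solution.
\<close>

lemma cchain_sobolev_tendsto:
  fixes D :: "'b \<Rightarrow> nat \<Rightarrow> real \<Rightarrow> 'a::euclidean_space"
  assumes "\<forall>\<^sub>F r in F. cchain m (D r)" "cchain m E"
    "\<And>j. j \<le> m \<Longrightarrow> uniform_limit UNIV (\<lambda>r. D r j) (E j) F"
  shows "sobolev_tendsto m (\<lambda>r. D r 0) (E 0) F"
  unfolding sobolev_tendsto_def
proof (intro conjI)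
  show "\<forall>\<^sub>F t in F. D t 0 \<in> sobolev m" using assms(1) by eventually_elim (rule cchain_sobolev)
  show "E 0 \<in> sobolev m" by (rule cchain_sobolev[OF assms(2)])
  show "((\<lambda>t. sobolev_norm m (\<lambda>x. D t 0 x - E 0 x)) \<longlongrightarrow> 0) F"
  proof (rule tendstoI)
    fix e :: real assume "e > 0"
    then have e': "e / (2 * (real m + 1)) > 0" by simp
    have "\<forall>\<^sub>F r in F. \<forall>j\<in>{..m}. \<forall>x\<in>UNIV. dist (D r j x) (E j x) < e / (2 * (real m + 1))"
    proof (rule eventually_ball_finite)
      show "\<forall>j\<in>{..m}. \<forall>\<^sub>F r in F. \<forall>x\<in>UNIV. dist (D r j x) (E j x) < e / (2 * (real m + 1))"
        using uniform_limitD[OF assms(3) e'] by blast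
    qed simp
    with assms(1) show "\<forall>\<^sub>F r in F. dist (sobolev_norm m (\<lambda>x. D r 0 x - E 0 x)) 0 < e"
    proof eventually_elim
      case (elim r)
      have "sobolev_norm m ((\<lambda>j x. D r j x - E j x) 0) \<le> (\<Sum>j\<le>m. e / (2 * (real m + 1)))"
        by (rule cchain_sobolev_norm_le) (use elim assms(2) in \<open>auto intro: cchain_diff less_imp_le simp: dist_norm\<close>)
      also have "\<dots> = e / 2" by (simp add: field_simps)
      also have "\<dots> < e" using \<open>e > 0\<close> by simp
      finally show ?case by simp
    qed
  qed
qed

section \<open>Fourier coefficients of weak derivatives and Bessel's inequality\<close>

text \<open>
  The exponential \<open>fbase (-n)\<close> is a combination of two real test functions with derivative of order
  \<open>j\<close> equal to \<open>(-2 pi \<i> n)\<^sup>j fbase (-n)\<close>.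
\<close>

lemma fcoef_weak_deriv:
  fixes w g :: "real \<Rightarrow> complex"
  assumes "is_weak_deriv j w g" "w \<in> torus_L2" "g \<in> torus_L2"
  shows "fcoef g n = (2 * pi * \<i> * of_int n) ^ j * fcoef w n"
proof -
  define a where "a = 2 * pi * of_int n"
  define \<phi>1 where "\<phi>1 = (\<lambda>x. cos (a * x + 0))"
  define \<phi>2 where "\<phi>2 = (\<lambda>x. cos (a * x + (- pi / 2)))"
  have t: "\<phi>1 \<in> torus_test" "\<phi>2 \<in> torus_test" unfolding \<phi>1_def \<phi>2_def a_def by (rule cos_torus_test)+
  have 0: "fbase (- n) x = \<phi>1 x - \<i> * \<phi>2 x" for x
    by (simp add: fbase_def \<phi>1_def \<phi>2_def a_def complex_eq_iff cos_diff)
  have 1: "(- \<i> * a) ^ j * fbase (- n) x = (deriv ^^ j) \<phi>1 x - \<i> * (deriv ^^ j) \<phi>2 x" for x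
  proof -
    have "(- \<i>) ^ j = cis (- (of_nat j * (pi / 2)))"
    proof -
      have "cis (- (pi / 2)) = - \<i>" by (simp add: complex_eq_iff)
      then have "(- \<i>) ^ j = cis (- (pi / 2)) ^ j" by simp
      also have "\<dots> = cis (of_nat j * (- (pi / 2)))" by (simp only: Complex.DeMoivre)
      finally show ?thesis by simp
    qed
    then have "(- \<i>) ^ j * fbase (- n) x = cis (- (of_nat j * (pi / 2)) + - (a * x))"
      by (simp add: fbase_def a_def cis_mult)
    moreover have "(- \<i> * a) ^ j * fbase (- n) x = of_real (a ^ j) * ((- \<i>) ^ j * fbase (- n) x)"
      by (simp only: power_mult_distrib of_real_power mult_ac)
    ultimately have "(- \<i> * a) ^ j * fbase (- n) x = of_real (a ^ j) * cis (- (of_nat j * (pi / 2)) + - (a * x))"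
      by simp
    also have "\<dots> = (deriv ^^ j) \<phi>1 x - \<i> * (deriv ^^ j) \<phi>2 x"
    proof -
      have *: "cos (a * x + - pi / 2 + of_nat j * (pi / 2)) = sin (a * x + of_nat j * (pi / 2))"
        using cos_diff[of "a * x + of_nat j * (pi / 2)" "pi / 2"] by (simp add: algebra_simps)
      have **: "- (of_nat j * (pi / 2)) + - (a * x) = - (a * x + of_nat j * (pi / 2))" by simp
      show ?thesis
        unfolding \<phi>1_def \<phi>2_def deriv_funpow_cos * ** by (simp add: complex_eq_iff algebra_simps del: minus_add_distrib)
    qed
    finally show ?thesis .
  qed
  have int: "integrable T01 (\<lambda>x. \<phi> x *\<^sub>R w x)" "integrable T01 (\<lambda>x. \<phi> x *\<^sub>R g x)" if "\<phi> \<in> torus_test" for \<phi>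
    using that assms(2,3) by (auto intro: torus_test_integrable torus_L2_integrable)
  have "(- \<i> * a) ^ j * fcoef w n = integral\<^sup>L T01 (\<lambda>x. (- \<i> * a) ^ j * (w x * fbase (- n) x))"
    by (simp add: fcoef_def)
  also have "(\<lambda>x. (- \<i> * a) ^ j * (w x * fbase (- n) x)) = (\<lambda>x. (deriv ^^ j) \<phi>1 x *\<^sub>R w x - \<i> * ((deriv ^^ j) \<phi>2 x *\<^sub>R w x))"
  proof
    fix x
    have "(- \<i> * a) ^ j * (w x * fbase (- n) x) = ((- \<i> * a) ^ j * fbase (- n) x) * w x" by (simp only: mult_ac)
    also have "\<dots> = (deriv ^^ j) \<phi>1 x *\<^sub>R w x - \<i> * ((deriv ^^ j) \<phi>2 x *\<^sub>R w x)"
      unfolding 1 by (simp add: scaleR_conv_of_real algebra_simps)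
    finally show "(- \<i> * a) ^ j * (w x * fbase (- n) x) = (deriv ^^ j) \<phi>1 x *\<^sub>R w x - \<i> * ((deriv ^^ j) \<phi>2 x *\<^sub>R w x)" .
  qed
  also have "integral\<^sup>L T01 \<dots> = integral\<^sup>L T01 (\<lambda>x. (deriv ^^ j) \<phi>1 x *\<^sub>R w x) - \<i> * integral\<^sup>L T01 (\<lambda>x. (deriv ^^ j) \<phi>2 x *\<^sub>R w x)"
    by (simp only: Bochner_Integration.integral_diff[OF int(1)[OF torus_test_funpow[OF t(1)]]
          integrable_mult_right[OF int(1)[OF torus_test_funpow[OF t(2)]]]] integral_mult_right_zero)
  also have "\<dots> = (- 1) ^ j * (integral\<^sup>L T01 (\<lambda>x. \<phi>1 x *\<^sub>R g x) - \<i> * integral\<^sup>L T01 (\<lambda>x. \<phi>2 x *\<^sub>R g x))"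
    using assms(1) t unfolding is_weak_deriv_T01 by (simp add: scaleR_conv_of_real algebra_simps)
  also have "integral\<^sup>L T01 (\<lambda>x. \<phi>1 x *\<^sub>R g x) - \<i> * integral\<^sup>L T01 (\<lambda>x. \<phi>2 x *\<^sub>R g x) =
     integral\<^sup>L T01 (\<lambda>x. \<phi>1 x *\<^sub>R g x - \<i> * (\<phi>2 x *\<^sub>R g x))"
    by (simp only: Bochner_Integration.integral_diff[OF int(2)[OF t(1)]
          integrable_mult_right[OF int(2)[OF t(2)]]] integral_mult_right_zero)
  also have "(\<lambda>x. \<phi>1 x *\<^sub>R g x - \<i> * (\<phi>2 x *\<^sub>R g x)) = (\<lambda>x. g x * fbase (- n) x)"
    unfolding 0 by (simp add: fun_eq_iff scaleR_conv_of_real algebra_simps)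
  also have "integral\<^sup>L T01 \<dots> = fcoef g n" by (simp add: fcoef_def)
  finally have "(- 1) ^ j * ((- \<i> * a) ^ j * fcoef w n) = (- 1) ^ j * ((- 1) ^ j * fcoef g n)" by simp
  then have "fcoef g n = (- 1) ^ j * (- \<i> * a) ^ j * fcoef w n"
    by (simp add: power_mult_distrib[symmetric] mult.assoc[symmetric])
  also have "(- 1) ^ j * (- \<i> * a) ^ j = (2 * pi * \<i> * of_int n) ^ j"
    by (simp add: power_mult_distrib[symmetric] a_def mult_ac)
  finally show ?thesis .
qed

lemma integral_fbase: "integral\<^sup>L T01 (fbase n) = (if n = 0 then 1 else 0)"
proof (cases "n = 0")
  case True
  then have "fbase n = (\<lambda>x. 1)" by (simp add: fun_eq_iff)
  then show ?thesis using True by simp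
next
  case False
  define \<alpha> where "\<alpha> = 2 * pi * \<i> * of_int n"
  have \<alpha>: "\<alpha> \<noteq> 0" using False by (simp add: \<alpha>_def)
  have e: "fbase n x = exp (\<alpha> * of_real x)" for x
    by (simp add: fbase_def cis_conv_exp \<alpha>_def mult_ac)
  have "(fbase n has_integral (fbase n 1 / \<alpha> - fbase n 0 / \<alpha>)) {0..1}"
  proof (rule fundamental_theorem_of_calculus)
    fix x :: real
    have "((\<lambda>z. exp (\<alpha> * z) / \<alpha>) has_field_derivative exp (\<alpha> * of_real x)) (at (of_real x))"
      using \<alpha> by (auto intro!: derivative_eq_intros)
    from has_vector_derivative_real_field[OF this]
    show "((\<lambda>x. fbase n x / \<alpha>) has_vector_derivative fbase n x) (at x within {0..1})"
      unfolding e by (simp add: has_vector_derivative_at_within)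
  qed simp
  moreover have "fbase n 1 = fbase n 0" using periodic_fbase[of n 0] by simp
  ultimately have "(fbase n has_integral 0) {0..1}" by simp
  moreover have "(fbase n has_integral integral\<^sup>L T01 (fbase n)) {0..1}"
    by (rule has_integral_integral_lebesgue_on) (auto intro: integrable_T01_continuous continuous_fbase)
  ultimately show ?thesis using False has_integral_unique by auto
qed

text \<open>
  Expand \<open>0 \<le> \<parallel>g - S\<parallel>\<^sup>2\<close>, where \<open>S\<close> is the orthogonal projection of \<open>g\<close> onto the span of the
  exponentials with frequencies in \<open>F\<close>.
\<close>

lemma bessel_inequality:
  assumes g: "g \<in> torus_L2" and F: "finite F"
  shows "(\<Sum>n\<in>F. (norm (fcoef g n))\<^sup>2) \<le> (l2norm g)\<^sup>2"
proof -
  define c where "c = fcoef g"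
  define S where "S = (\<lambda>x. \<Sum>n\<in>F. c n * fbase n x)"
  define A where "A = (\<Sum>n\<in>F. (norm (c n))\<^sup>2)"
  have gi: "integrable T01 g" using g by (rule torus_L2_integrable)
  have cS: "cnj (S x) = (\<Sum>n\<in>F. cnj (c n) * fbase (- n) x)" for x by (simp add: S_def)
  have fb: "integrable T01 (fbase n)" for n by (intro integrable_T01_continuous continuous_fbase)
  have gcS: "integrable T01 (\<lambda>x. g x * cnj (S x))" "integral\<^sup>L T01 (\<lambda>x. g x * cnj (S x)) = of_real A"
  proof -
    have e: "(\<lambda>x. g x * cnj (S x)) = (\<lambda>x. \<Sum>n\<in>F. cnj (c n) * (g x * fbase (- n) x))"
      unfolding cS by (simp add: sum_distrib_left mult_ac)
    show "integrable T01 (\<lambda>x. g x * cnj (S x))" unfolding e using integrable_mult_fbase[OF gi] by auto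
    have "integral\<^sup>L T01 (\<lambda>x. g x * cnj (S x)) = (\<Sum>n\<in>F. cnj (c n) * c n)"
      unfolding e using integrable_mult_fbase[OF gi] by (subst Bochner_Integration.integral_sum) (auto simp: c_def fcoef_def)
    also have "\<dots> = of_real A" by (simp only: A_def of_real_sum complex_norm_square mult.commute)
    finally show "integral\<^sup>L T01 (\<lambda>x. g x * cnj (S x)) = of_real A" .
  qed
  have ScS: "integrable T01 (\<lambda>x. S x * cnj (S x))" "integral\<^sup>L T01 (\<lambda>x. S x * cnj (S x)) = of_real A"
  proof -
    have e: "(\<lambda>x. S x * cnj (S x)) = (\<lambda>x. \<Sum>n\<in>F. \<Sum>m\<in>F. c n * cnj (c m) * fbase (n - m) x)"
    proof
      fix x
      have "c n * fbase n x * (cnj (c m) * fbase (- m) x) = c n * cnj (c m) * fbase (n - m) x" for n m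
        using arg_cong[OF fbase_mult[of n x "- m"], of "\<lambda>z. c n * cnj (c m) * z"] by (simp add: mult_ac)
      then show "S x * cnj (S x) = (\<Sum>n\<in>F. \<Sum>m\<in>F. c n * cnj (c m) * fbase (n - m) x)"
        by (simp only: cS) (simp only: S_def sum_product)
    qed
    show "integrable T01 (\<lambda>x. S x * cnj (S x))" unfolding e using fb by auto
    have "integral\<^sup>L T01 (\<lambda>x. S x * cnj (S x)) = (\<Sum>n\<in>F. \<Sum>m\<in>F. c n * cnj (c m) * (if n - m = 0 then 1 else 0))"
      unfolding e using fb by (subst Bochner_Integration.integral_sum) (auto simp: integral_fbase)
    also have "\<dots> = (\<Sum>n\<in>F. c n * cnj (c n))"
      using F by (intro sum.cong refl) (simp add: sum.delta if_distrib[of "(*) _"] cong: if_cong)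
    also have "\<dots> = of_real A" by (simp only: A_def of_real_sum complex_norm_square)
    finally show "integral\<^sup>L T01 (\<lambda>x. S x * cnj (S x)) = of_real A" .
  qed
  have "0 \<le> integral\<^sup>L T01 (\<lambda>x. (norm (g x - S x))\<^sup>2)" by simp
  also have "(\<lambda>x. (norm (g x - S x))\<^sup>2) = (\<lambda>x. (norm (g x))\<^sup>2 - 2 * Re (g x * cnj (S x)) + Re (S x * cnj (S x)))"
    by (simp only: fun_eq_iff cmod_power2) (simp add: power2_eq_square algebra_simps)
  also have "integral\<^sup>L T01 \<dots> = integral\<^sup>L T01 (\<lambda>x. (norm (g x))\<^sup>2) -
      2 * integral\<^sup>L T01 (\<lambda>x. Re (g x * cnj (S x))) + integral\<^sup>L T01 (\<lambda>x. Re (S x * cnj (S x)))"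
  proof -
    define p where "p = (\<lambda>x. Re (g x * cnj (S x)))"
    define q where "q = (\<lambda>x. Re (S x * cnj (S x)))"
    have "integrable T01 p" "integrable T01 q" "integrable T01 (\<lambda>x. (norm (g x))\<^sup>2)"
      using integrable_Re[OF gcS(1)] integrable_Re[OF ScS(1)] g unfolding p_def q_def torus_L2_iff by auto
    then have "integral\<^sup>L T01 (\<lambda>x. (norm (g x))\<^sup>2 - 2 * p x + q x) =
      integral\<^sup>L T01 (\<lambda>x. (norm (g x))\<^sup>2) - 2 * integral\<^sup>L T01 p + integral\<^sup>L T01 q" by simp
    then show ?thesis unfolding p_def q_def .
  qed
  also have "\<dots> = (l2norm g)\<^sup>2 - 2 * A + A"
    unfolding integral_Re[OF gcS(1)] integral_Re[OF ScS(1)] gcS(2) ScS(2) by (simp add: l2norm_sq)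
  finally show ?thesis by (simp add: A_def c_def)
qed

section \<open>Absolutely convergent Fourier series\<close>

text \<open>
  Dominated convergence for sums: a finite set carries the dominating sum up to \<open>e/2\<close>, and on it the
  limit may be taken termwise. All limits of Fourier series below, in time and in space, come from it.
\<close>

lemma infsum_dominated_null:
  fixes f :: "'b \<Rightarrow> 'i \<Rightarrow> real"
  assumes b: "b summable_on UNIV" "\<And>n. 0 \<le> b n"
    and f: "\<forall>\<^sub>F r in F. \<forall>n. 0 \<le> f r n \<and> f r n \<le> b n"
    and lim: "\<And>n. ((\<lambda>r. f r n) \<longlongrightarrow> 0) F"
  shows "((\<lambda>r. \<Sum>\<^sub>\<infinity>n. f r n) \<longlongrightarrow> 0) F"
proof (rule tendstoI)
  fix e :: real assume e: "e > 0"
  obtain A where A: "finite A" "dist (sum b A) (infsum b UNIV) < e / 2"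
    using infsum_finite_approximation[OF b(1), of "e / 4"] e by force
  have bs: "b summable_on B" for B using b(1) by (rule summable_on_subset) auto
  have "infsum b UNIV = sum b A + infsum b (- A)"
    using infsum_Un_disjoint[OF bs bs, of A "- A"] A by simp
  then have tail: "infsum b (- A) < e / 2" using A(2) by (simp add: dist_real_def)
  have "((\<lambda>r. \<Sum>n\<in>A. f r n) \<longlongrightarrow> (\<Sum>n\<in>A. 0)) F" by (intro tendsto_sum lim)
  then have "((\<lambda>r. \<Sum>n\<in>A. f r n) \<longlongrightarrow> 0) F" by simp
  then have "\<forall>\<^sub>F r in F. dist (\<Sum>n\<in>A. f r n) 0 < e / 2" by (rule tendstoD) (use e in simp)
  with f show "\<forall>\<^sub>F r in F. dist (\<Sum>\<^sub>\<infinity>n. f r n) 0 < e"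
  proof eventually_elim
    case (elim r)
    have fs: "f r summable_on B" for B
      by (rule summable_on_comparison_test[OF bs]) (use elim in auto)
    have "infsum (f r) UNIV = sum (f r) A + infsum (f r) (- A)"
      using infsum_Un_disjoint[OF fs fs, of A "- A"] A by simp
    moreover have "infsum (f r) (- A) \<le> infsum b (- A)" by (rule infsum_mono[OF fs bs]) (use elim in auto)
    moreover have "0 \<le> infsum (f r) UNIV" by (rule infsum_nonneg) (use elim in auto)
    ultimately show ?case using elim tail by (simp add: dist_real_def)
  qed
qed

definition l1 :: "(int \<Rightarrow> complex) \<Rightarrow> bool" where
  "l1 \<alpha> \<longleftrightarrow> (\<lambda>n. norm (\<alpha> n)) summable_on UNIV"

definition fser :: "(int \<Rightarrow> complex) \<Rightarrow> real \<Rightarrow> complex" where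
  "fser \<alpha> x = (\<Sum>\<^sub>\<infinity>n. \<alpha> n * fbase n x)"

lemma l1_mono:
  assumes "b summable_on UNIV" "\<And>n. norm (\<alpha> n) \<le> b n"
  shows "l1 \<alpha>"
  unfolding l1_def by (rule summable_on_comparison_test[OF assms(1)]) (use assms in auto)

lemma l1_mono': "l1 \<beta> \<Longrightarrow> (\<And>n. norm (\<alpha> n) \<le> norm (\<beta> n)) \<Longrightarrow> l1 \<alpha>"
  unfolding l1_def[of \<beta>] by (rule l1_mono)

lemma l1_add: "l1 \<alpha> \<Longrightarrow> l1 \<beta> \<Longrightarrow> l1 (\<lambda>n. \<alpha> n + \<beta> n)"
  unfolding l1_def[of \<alpha>] l1_def[of \<beta>]
  by (rule l1_mono[of "\<lambda>n. norm (\<alpha> n) + norm (\<beta> n)"]) (auto intro: summable_on_add norm_triangle_ineq)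

lemma l1_cmult: "l1 \<alpha> \<Longrightarrow> l1 (\<lambda>n. c * \<alpha> n)"
  unfolding l1_def by (simp add: norm_mult summable_on_cmult_right)

lemma l1_diff: "l1 \<alpha> \<Longrightarrow> l1 \<beta> \<Longrightarrow> l1 (\<lambda>n. \<alpha> n - \<beta> n)"
  using l1_add[of \<alpha> "\<lambda>n. (-1) * \<beta> n"] l1_cmult[of \<beta> "-1"] by simp

lemma fser_summable: "l1 \<alpha> \<Longrightarrow> (\<lambda>n. \<alpha> n * fbase n x) summable_on UNIV"
  by (rule abs_summable_summable) (simp add: norm_mult l1_def)

lemma norm_fser_le: "l1 \<alpha> \<Longrightarrow> norm (fser \<alpha> x) \<le> (\<Sum>\<^sub>\<infinity>n. norm (\<alpha> n))"
  unfolding fser_def using norm_infsum_bound[of "\<lambda>n. \<alpha> n * fbase n x" UNIV]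
  by (simp add: norm_mult l1_def)

lemma fser_add: "l1 \<alpha> \<Longrightarrow> l1 \<beta> \<Longrightarrow> fser (\<lambda>n. \<alpha> n + \<beta> n) x = fser \<alpha> x + fser \<beta> x"
  unfolding fser_def by (simp add: distrib_right infsum_add fser_summable)

lemma fser_cmult: "fser (\<lambda>n. c * \<alpha> n) x = c * fser \<alpha> x"
  unfolding fser_def by (simp add: mult.assoc infsum_cmult_right')

lemma fser_diff: "l1 \<alpha> \<Longrightarrow> l1 \<beta> \<Longrightarrow> fser (\<lambda>n. \<alpha> n - \<beta> n) x = fser \<alpha> x - fser \<beta> x"
  using fser_add[of \<alpha> "\<lambda>n. (-1) * \<beta> n"] l1_cmult[of \<beta> "-1"] fser_cmult[of "-1" \<beta>] by simp

lemma fser_periodic: "periodic1 (fser \<alpha>)"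
  by (simp add: periodic1_def fser_def periodic_fbase)

lemma fser_cnj: "cnj (fser \<alpha> x) = fser (\<lambda>n. cnj (\<alpha> (- n))) x"
proof -
  have "cnj (fser \<alpha> x) = (\<Sum>\<^sub>\<infinity>n. cnj (\<alpha> n) * fbase (- n) x)"
    unfolding fser_def by (simp flip: infsum_cnj)
  also have "\<dots> = (\<Sum>\<^sub>\<infinity>n. cnj (\<alpha> (- n)) * fbase n x)"
    by (rule infsum_reindex_bij_witness[of _ uminus uminus]) auto
  finally show ?thesis by (simp add: fser_def)
qed

lemma fser_delta: "fser (\<lambda>n. if n = 0 then c else 0) x = c"
proof -
  have "fser (\<lambda>n. if n = 0 then c else 0) x = infsum (\<lambda>n. (if n = 0 then c else 0) * fbase n x) {0}"
    unfolding fser_def by (rule infsum_cong_neutral) auto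
  then show ?thesis by simp
qed

lemma l1_delta: "l1 (\<lambda>n. if n = 0 then c else 0)"
  unfolding l1_def by (rule finite_nonzero_values_imp_summable_on) (rule finite_subset[of _ "{0}"], auto)

text \<open>
  The exponentials have modulus 1, so the distance of two series is at most the sum of the
  distances of their coefficients, uniformly in \<open>x\<close>.
\<close>

lemma fser_uniform_limit:
  assumes a: "l1 \<alpha>" and b: "b summable_on UNIV" "\<And>n. 0 \<le> b n"
    and ev: "\<forall>\<^sub>F r in F. \<forall>n. norm (\<beta> r n - \<alpha> n) \<le> b n"
    and lim: "\<And>n. ((\<lambda>r. \<beta> r n) \<longlongrightarrow> \<alpha> n) F"
  shows "uniform_limit UNIV (\<lambda>r. fser (\<beta> r)) (fser \<alpha>) F"
proof (rule uniform_limitI)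
  fix e :: real assume e: "e > 0"
  have "((\<lambda>r. \<Sum>\<^sub>\<infinity>n. norm (\<beta> r n - \<alpha> n)) \<longlongrightarrow> 0) F"
  proof (rule infsum_dominated_null[OF b])
    show "((\<lambda>r. norm (\<beta> r n - \<alpha> n)) \<longlongrightarrow> 0) F" for n
      using lim[of n] by (simp add: LIM_zero tendsto_norm_zero)
  qed (use ev in simp)
  then have "\<forall>\<^sub>F r in F. dist (\<Sum>\<^sub>\<infinity>n. norm (\<beta> r n - \<alpha> n)) 0 < e" using e by (rule tendstoD)
  with ev show "\<forall>\<^sub>F r in F. \<forall>x\<in>UNIV. dist (fser (\<beta> r) x) (fser \<alpha> x) < e"
  proof eventually_elim
    case (elim r)
    have d: "l1 (\<lambda>n. \<beta> r n - \<alpha> n)" by (rule l1_mono[OF b(1)]) (use elim in simp)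
    then have "l1 (\<beta> r)" using l1_add[OF d a] by simp
    then have "dist (fser (\<beta> r) x) (fser \<alpha> x) \<le> (\<Sum>\<^sub>\<infinity>n. norm (\<beta> r n - \<alpha> n))" for x
      using norm_fser_le[OF d, of x] a by (simp add: fser_diff dist_norm)
    moreover have "(\<Sum>\<^sub>\<infinity>n. norm (\<beta> r n - \<alpha> n)) < e" using elim(2) by (simp add: dist_real_def)
    ultimately show ?case by (meson le_less_trans)
  qed
qed

lemma abs_sin_le_abs: "\<bar>sin x\<bar> \<le> \<bar>x :: real\<bar>"
  using sin_x_le_x[of x] sin_x_ge_neg_x[of x] sin_x_le_x[of "- x"] sin_x_ge_neg_x[of "- x"] by (cases "x \<ge> 0") auto

lemma norm_fbase_diff_le: "norm (fbase n y - fbase n x) \<le> 2 * pi * \<bar>of_int n\<bar> * \<bar>y - x\<bar>"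
proof -
  have "norm (fbase n y - fbase n x) = norm (fbase n x * (cis (2 * pi * of_int n * (y - x)) - 1))"
    by (simp add: right_diff_distrib fbase_def cis_mult algebra_simps)
  also have "\<dots> = norm (exp (\<i> * of_real (2 * pi * of_int n * (y - x))) - 1)"
    by (simp add: norm_mult cis_conv_exp)
  also have "\<dots> = 2 * \<bar>sin (2 * pi * of_int n * (y - x) / 2)\<bar>" by (rule dist_exp_i_1)
  also have "\<dots> \<le> 2 * \<bar>2 * pi * of_int n * (y - x) / 2\<bar>" by (intro mult_left_mono abs_sin_le_abs) auto
  finally show ?thesis by (simp add: abs_mult)
qed

text \<open>
  Moving the point into the coefficients turns limits in \<open>x\<close> into limits of coefficients.
\<close>

lemma fser_eval: "fser \<alpha> x = fser (\<lambda>n. \<alpha> n * fbase n x) 0"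
  by (simp add: fser_def fbase_def)

lemma l1_modulate: "l1 \<alpha> \<Longrightarrow> l1 (\<lambda>n. \<alpha> n * fbase n x)"
  by (simp add: l1_def norm_mult)

lemma fser_continuous:
  assumes "l1 \<alpha>" shows "continuous_on UNIV (fser \<alpha>)"
proof -
  have "(fser \<alpha> \<longlongrightarrow> fser \<alpha> x) (at x)" for x
  proof -
    have "uniform_limit UNIV (\<lambda>y. fser (\<lambda>n. \<alpha> n * fbase n y)) (fser (\<lambda>n. \<alpha> n * fbase n x)) (at x)"
    proof (rule fser_uniform_limit[OF l1_modulate[OF assms], where b = "\<lambda>n. 2 * norm (\<alpha> n)"])
      show "(\<lambda>n. 2 * norm (\<alpha> n)) summable_on UNIV"
        using assms by (simp add: l1_def summable_on_cmult_right)
      show "\<forall>\<^sub>F y in at x. \<forall>n. norm (\<alpha> n * fbase n y - \<alpha> n * fbase n x) \<le> 2 * norm (\<alpha> n)"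
      proof (intro always_eventually allI)
        fix y n
        show "norm (\<alpha> n * fbase n y - \<alpha> n * fbase n x) \<le> 2 * norm (\<alpha> n)"
          using norm_triangle_ineq4[of "\<alpha> n * fbase n y" "\<alpha> n * fbase n x"] by (simp add: norm_mult)
      qed
      fix n
      have "(fbase n \<longlongrightarrow> fbase n x) (at x)" using continuous_fbase[of UNIV n] by (simp add: continuous_on_def)
      then show "((\<lambda>y. \<alpha> n * fbase n y) \<longlongrightarrow> \<alpha> n * fbase n x) (at x)" by (intro tendsto_intros)
    qed simp
    then have "((\<lambda>y. fser (\<lambda>n. \<alpha> n * fbase n y) 0) \<longlongrightarrow> fser (\<lambda>n. \<alpha> n * fbase n x) 0) (at x)"
      by (rule tendsto_uniform_limitI) simp
    then show ?thesis by (simp only: fser_eval[of \<alpha>, symmetric])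
  qed
  then show ?thesis by (simp add: continuous_on_def)
qed

lemma has_vector_derivative_quotient:
  "(f has_vector_derivative D) (at x within S) \<longleftrightarrow>
     ((\<lambda>y. (f y - f x) /\<^sub>R (y - x)) \<longlongrightarrow> D) (at x within S)"
proof -
  have e: "norm ((f y - f x) - (y - x) *\<^sub>R D) / norm (y - x) = norm ((f y - f x) /\<^sub>R (y - x) - D)" if "y \<noteq> x" for y
  proof -
    have "(f y - f x) /\<^sub>R (y - x) - D = inverse (y - x) *\<^sub>R ((f y - f x) - (y - x) *\<^sub>R D)"
      using that by (simp add: scaleR_diff_right)
    then show ?thesis by (simp add: divide_inverse mult.commute)
  qed
  have "(f has_vector_derivative D) (at x within S) \<longleftrightarrow>
     ((\<lambda>y. norm ((f y - f x) - (y - x) *\<^sub>R D) / norm (y - x)) \<longlongrightarrow> 0) (at x within S)"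
    unfolding has_vector_derivative_def has_derivative_iff_norm
    by (simp add: bounded_linear_scaleR_left)
  also have "\<dots> \<longleftrightarrow> ((\<lambda>y. norm ((f y - f x) /\<^sub>R (y - x) - D)) \<longlongrightarrow> 0) (at x within S)"
    by (rule Lim_cong_within) (use e in auto)
  finally show ?thesis by (simp add: tendsto_norm_zero_iff LIM_zero_iff)
qed

definition dcoef :: "(int \<Rightarrow> complex) \<Rightarrow> int \<Rightarrow> complex" where
  "dcoef \<alpha> n = 2 * pi * \<i> * of_int n * \<alpha> n"

lemma fser_has_vector_derivative:
  assumes "l1 \<alpha>" "l1 (dcoef \<alpha>)"
  shows "(fser \<alpha> has_vector_derivative fser (dcoef \<alpha>) x) (at x)"
proof -
  define q where "q = (\<lambda>y n. of_real (inverse (y - x)) * (\<alpha> n * fbase n y - \<alpha> n * fbase n x))"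
  have ev: "\<forall>\<^sub>F y in at x. y \<noteq> x" by (rule eventually_neq_at_within)
  have q: "norm (q y n) \<le> norm (dcoef \<alpha> n)" if "y \<noteq> x" for y n
  proof -
    have "norm (q y n) = inverse \<bar>y - x\<bar> * (norm (\<alpha> n) * norm (fbase n y - fbase n x))"
      unfolding q_def right_diff_distrib[symmetric] norm_mult norm_of_real by simp
    also have "\<dots> \<le> inverse \<bar>y - x\<bar> * (norm (\<alpha> n) * (2 * pi * \<bar>of_int n\<bar> * \<bar>y - x\<bar>))"
      by (intro mult_left_mono norm_fbase_diff_le) auto
    also have "\<dots> = norm (dcoef \<alpha> n)" using that by (simp add: dcoef_def norm_mult)
    finally show ?thesis .
  qed
  have "uniform_limit UNIV (\<lambda>y. fser (q y)) (fser (\<lambda>n. dcoef \<alpha> n * fbase n x)) (at x)"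
  proof (rule fser_uniform_limit[OF l1_modulate[OF assms(2)], where b = "\<lambda>n. 2 * norm (dcoef \<alpha> n)"])
    show "(\<lambda>n. 2 * norm (dcoef \<alpha> n)) summable_on UNIV"
      using assms by (simp add: l1_def summable_on_cmult_right)
    show "\<forall>\<^sub>F y in at x. \<forall>n. norm (q y n - dcoef \<alpha> n * fbase n x) \<le> 2 * norm (dcoef \<alpha> n)"
      using ev
    proof eventually_elim
      case (elim y)
      show ?case
      proof
        fix n
        show "norm (q y n - dcoef \<alpha> n * fbase n x) \<le> 2 * norm (dcoef \<alpha> n)"
          using norm_triangle_ineq4[of "q y n" "dcoef \<alpha> n * fbase n x"] q[OF elim, of n] by (simp add: norm_mult)
      qed
    qed
    fix n
    \<comment> \<open>Termwise, the difference quotient of the exponential.\<close>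
    define c where "c = 2 * pi * \<i> * of_int n"
    have e: "fbase n = (\<lambda>y. exp (c * of_real y))"
      by (simp add: fun_eq_iff fbase_def cis_conv_exp c_def mult_ac)
    have "((\<lambda>z. exp (c * z)) has_field_derivative c * exp (c * of_real x)) (at (of_real x))"
      by (auto intro!: derivative_eq_intros)
    from has_vector_derivative_real_field[OF this]
    have "(fbase n has_vector_derivative c * fbase n x) (at x)" unfolding e .
    then have "((\<lambda>y. \<alpha> n * ((fbase n y - fbase n x) /\<^sub>R (y - x))) \<longlongrightarrow> \<alpha> n * (c * fbase n x)) (at x)"
      unfolding has_vector_derivative_quotient by (rule tendsto_mult_left)
    then show "((\<lambda>y. q y n) \<longlongrightarrow> dcoef \<alpha> n * fbase n x) (at x)"
      by (simp add: q_def dcoef_def c_def scaleR_conv_of_real algebra_simps)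
  qed simp
  then have "((\<lambda>y. fser (q y) 0) \<longlongrightarrow> fser (\<lambda>n. dcoef \<alpha> n * fbase n x) 0) (at x)"
    by (rule tendsto_uniform_limitI) simp
  moreover have "fser (q y) 0 = (fser \<alpha> y - fser \<alpha> x) /\<^sub>R (y - x)" for y
    unfolding q_def fser_cmult fser_eval[of \<alpha> y] fser_eval[of \<alpha> x]
    by (simp add: fser_diff l1_modulate assms scaleR_conv_of_real)
  ultimately show ?thesis by (simp add: has_vector_derivative_quotient fser_eval[of "dcoef \<alpha>" x])
qed

text \<open>
  The partial sum over \<open>A\<close> differs from the series by at most the tail \<open>\<Sum>\<parallel>\<alpha> n\<parallel> - \<Sum>\<^bsub>A\<^esub>\<parallel>\<alpha> n\<parallel>\<close>,
  uniformly in \<open>x\<close>, and \<open>g\<close> is integrable. This gives the coefficients of a series and, for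
  \<open>g \<in> L\<^sup>2\<close>, a form of Parseval's identity.
\<close>

lemma integral_fser_mult:
  assumes "l1 \<alpha>" "integrable T01 g"
  shows "((\<lambda>n. \<alpha> n * integral\<^sup>L T01 (\<lambda>x. fbase n x * g x)) has_sum integral\<^sup>L T01 (\<lambda>x. fser \<alpha> x * g x)) UNIV"
proof -
  define S where "S = (\<lambda>A x. \<Sum>n\<in>A. \<alpha> n * fbase n x)"
  define K where "K = integral\<^sup>L T01 (\<lambda>x. norm (g x))"
  have fg: "integrable T01 (\<lambda>x. fbase n x * g x)" for n
    using integrable_mult_fbase[OF assms(2)] by (simp add: mult.commute)
  have serg: "integrable T01 (\<lambda>x. fser \<alpha> x * g x)"
  proof (rule Bochner_Integration.integrable_bound)
    show "integrable T01 (\<lambda>x. (\<Sum>\<^sub>\<infinity>n. norm (\<alpha> n)) * norm (g x))" using assms by simp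
    show "(\<lambda>x. fser \<alpha> x * g x) \<in> borel_measurable T01"
      using measurable_T01[OF measurable_lebesgue_continuous[OF fser_continuous[OF assms(1)]]] assms(2) by measurable
    show "AE x in T01. norm (fser \<alpha> x * g x) \<le> norm ((\<Sum>\<^sub>\<infinity>n. norm (\<alpha> n)) * norm (g x))"
    proof (intro AE_I2)
      fix x
      have "norm (fser \<alpha> x) \<le> \<bar>\<Sum>\<^sub>\<infinity>n. norm (\<alpha> n)\<bar>" using norm_fser_le[OF assms(1), of x] by linarith
      then show "norm (fser \<alpha> x * g x) \<le> norm ((\<Sum>\<^sub>\<infinity>n. norm (\<alpha> n)) * norm (g x))"
        by (simp add: norm_mult abs_mult mult_right_mono)
    qed
  qed
  have bound: "norm (integral\<^sup>L T01 (\<lambda>x. fser \<alpha> x * g x) - (\<Sum>n\<in>A. \<alpha> n * integral\<^sup>L T01 (\<lambda>x. fbase n x * g x)))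
     \<le> ((\<Sum>\<^sub>\<infinity>n. norm (\<alpha> n)) - (\<Sum>n\<in>A. norm (\<alpha> n))) * K" if A: "finite A" for A
  proof -
    have Sg: "(\<lambda>x. S A x * g x) = (\<lambda>x. \<Sum>n\<in>A. \<alpha> n * (fbase n x * g x))"
      by (simp add: S_def sum_distrib_right mult.assoc)
    have Sgi: "integrable T01 (\<lambda>x. S A x * g x)" unfolding Sg using fg by auto
    have "(\<Sum>n\<in>A. \<alpha> n * integral\<^sup>L T01 (\<lambda>x. fbase n x * g x)) = integral\<^sup>L T01 (\<lambda>x. S A x * g x)"
      unfolding Sg using fg by (subst Bochner_Integration.integral_sum) auto
    then have "norm (integral\<^sup>L T01 (\<lambda>x. fser \<alpha> x * g x) - (\<Sum>n\<in>A. \<alpha> n * integral\<^sup>L T01 (\<lambda>x. fbase n x * g x)))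
      = norm (integral\<^sup>L T01 (\<lambda>x. fser \<alpha> x * g x - S A x * g x))"
      using serg Sgi by simp
    also have "\<dots> \<le> integral\<^sup>L T01 (\<lambda>x. norm (fser \<alpha> x * g x - S A x * g x))" by (rule integral_norm_bound)
    also have "\<dots> \<le> integral\<^sup>L T01 (\<lambda>x. ((\<Sum>\<^sub>\<infinity>n. norm (\<alpha> n)) - (\<Sum>n\<in>A. norm (\<alpha> n))) * norm (g x))"
    proof (rule integral_mono)
      fix x
      have s1: "(\<lambda>n. norm (\<alpha> n)) summable_on B" for B
        using assms(1) unfolding l1_def by (rule summable_on_subset) auto
      have s2: "(\<lambda>n. \<alpha> n * fbase n x) summable_on B" for B
        using fser_summable[OF assms(1)] by (rule summable_on_subset) auto
      have "fser \<alpha> x = S A x + infsum (\<lambda>n. \<alpha> n * fbase n x) (- A)"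
        unfolding fser_def S_def using infsum_Un_disjoint[OF s2 s2, of A "- A"] A by simp
      moreover have "norm (infsum (\<lambda>n. \<alpha> n * fbase n x) (- A)) \<le> infsum (\<lambda>n. norm (\<alpha> n)) (- A)"
        using norm_infsum_bound[of "\<lambda>n. \<alpha> n * fbase n x" "- A"] s1 by (simp add: norm_mult)
      moreover have "(\<Sum>\<^sub>\<infinity>n. norm (\<alpha> n)) = (\<Sum>n\<in>A. norm (\<alpha> n)) + infsum (\<lambda>n. norm (\<alpha> n)) (- A)"
        using infsum_Un_disjoint[OF s1 s1, of A "- A"] A by simp
      ultimately have "norm (fser \<alpha> x - S A x) \<le> (\<Sum>\<^sub>\<infinity>n. norm (\<alpha> n)) - (\<Sum>n\<in>A. norm (\<alpha> n))" by simp
      then show "norm (fser \<alpha> x * g x - S A x * g x) \<le> ((\<Sum>\<^sub>\<infinity>n. norm (\<alpha> n)) - (\<Sum>n\<in>A. norm (\<alpha> n))) * norm (g x)"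
        unfolding left_diff_distrib[symmetric] norm_mult by (rule mult_right_mono) simp
    qed (use serg Sgi assms(2) in auto)
    also have "\<dots> = ((\<Sum>\<^sub>\<infinity>n. norm (\<alpha> n)) - (\<Sum>n\<in>A. norm (\<alpha> n))) * K" by (simp add: K_def)
    finally show ?thesis .
  qed
  have "((\<lambda>n. norm (\<alpha> n)) has_sum (\<Sum>\<^sub>\<infinity>n. norm (\<alpha> n))) UNIV" using assms(1) unfolding l1_def by simp
  then have "((\<lambda>A. ((\<Sum>\<^sub>\<infinity>n. norm (\<alpha> n)) - (\<Sum>n\<in>A. norm (\<alpha> n))) * K) \<longlongrightarrow>
     ((\<Sum>\<^sub>\<infinity>n. norm (\<alpha> n)) - (\<Sum>\<^sub>\<infinity>n. norm (\<alpha> n))) * K) (finite_subsets_at_top UNIV)"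
    unfolding has_sum_def by (intro tendsto_intros)
  then have z: "((\<lambda>A. ((\<Sum>\<^sub>\<infinity>n. norm (\<alpha> n)) - (\<Sum>n\<in>A. norm (\<alpha> n))) * K) \<longlongrightarrow> 0) (finite_subsets_at_top UNIV)" by simp
  have "((\<lambda>A. integral\<^sup>L T01 (\<lambda>x. fser \<alpha> x * g x) - (\<Sum>n\<in>A. \<alpha> n * integral\<^sup>L T01 (\<lambda>x. fbase n x * g x))) \<longlongrightarrow> 0) (finite_subsets_at_top UNIV)"
    by (rule Lim_null_comparison[OF _ z])
       (use bound in \<open>auto intro!: eventually_finite_subsets_at_top_weakI\<close>)
  from tendsto_diff[OF tendsto_const[of "integral\<^sup>L T01 (\<lambda>x. fser \<alpha> x * g x)"] this]
  show ?thesis by (simp add: has_sum_def)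
qed

lemma fcoef_fser:
  assumes "l1 \<alpha>" shows "fcoef (fser \<alpha>) n = \<alpha> n"
proof -
  have "integrable T01 (fbase (- n))" by (intro integrable_T01_continuous continuous_fbase)
  from integral_fser_mult[OF assms this]
  have "((\<lambda>m. \<alpha> m * (if m = n then 1 else 0)) has_sum fcoef (fser \<alpha>) n) UNIV"
    by (simp add: fbase_mult fcoef_def integral_fbase)
  moreover have "((\<lambda>m. \<alpha> m * (if m = n then 1 else 0)) has_sum \<alpha> n) UNIV"
    by (rule has_sum_finite_neutralI[of "{n}"]) auto
  ultimately show ?thesis by (rule has_sum_unique)
qed

text \<open>
  The function and the sum of its Fourier series have the same Fourier coefficients.
\<close>

lemma fourier_inversion:
  assumes "w \<in> torus_L2" "l1 (fcoef w)"
  shows "AE x in lebesgue. w x = fser (fcoef w) x"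
proof (rule AE_T01_periodic)
  have fs: "integrable T01 (fser (fcoef w))"
    by (rule torus_L2_integrable[OF torus_L2_continuous[OF fser_continuous[OF assms(2)] fser_periodic]])
  note wi = torus_L2_integrable[OF assms(1)]
  have "AE x in T01. w x - fser (fcoef w) x = 0"
  proof (rule fcoef_zero_imp_AE_zero)
    show "integrable T01 (\<lambda>x. w x - fser (fcoef w) x)" using fs wi by simp
    fix n
    have "fcoef (\<lambda>x. w x - fser (fcoef w) x) n = fcoef w n - fcoef (fser (fcoef w)) n"
      using integrable_mult_fbase[OF fs] integrable_mult_fbase[OF wi] by (simp add: fcoef_def left_diff_distrib)
    then show "fcoef (\<lambda>x. w x - fser (fcoef w) x) n = 0" by (simp add: fcoef_fser[OF assms(2)])
  qed
  then show "AE x in T01. w x = fser (fcoef w) x" by simp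
  show "periodic1 (\<lambda>x. w x = fser (fcoef w) x)"
    using assms(1) fser_periodic by (simp add: torus_L2_iff periodic1_def)
qed

text \<open>
  Telescoping: \<open>1/(M+1)\<^sup>2 \<le> 1/M - 1/(M+1)\<close>.
\<close>

lemma sum_inverse_squares_le:
  fixes F :: "int set"
  assumes "finite F" "0 \<notin> F"
  shows "(\<Sum>n\<in>F. 1 / (of_int n)\<^sup>2 :: real) \<le> 4"
proof -
  have *: "(\<Sum>n\<in>{- int M..int M} - {0}. 1 / (of_int n)\<^sup>2 :: real) \<le> 4 - 2 / real M" if "M \<ge> 1" for M
    using that
  proof (induction M rule: nat_induct_at_least)
    case base
    have "{- int 1..int 1} - {0} = {-1, 1 :: int}" by auto
    then show ?case by simp
  next
    case (Suc M)
    have "{- int (Suc M)..int (Suc M)} - {0} = insert (- int (Suc M)) (insert (int (Suc M)) ({- int M..int M} - {0}))"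
      by auto
    then have "(\<Sum>n\<in>{- int (Suc M)..int (Suc M)} - {0}. 1 / (of_int n)\<^sup>2 :: real) =
      2 / (real (Suc M))\<^sup>2 + (\<Sum>n\<in>{- int M..int M} - {0}. 1 / (of_int n)\<^sup>2)"
      by (simp add: power2_eq_square algebra_simps)
    also have "\<dots> \<le> 2 / (real (Suc M))\<^sup>2 + (4 - 2 / real M)" using Suc by simp
    also have "\<dots> \<le> 4 - 2 / real (Suc M)"
    proof -
      have "1 / (real (Suc M) * real (Suc M)) \<le> 1 / (real M * real (Suc M))"
        using Suc(1) by (intro frac_le mult_right_mono) auto
      also have "\<dots> = 1 / real M - 1 / real (Suc M)" using Suc(1) by (simp add: field_simps)
      finally show ?thesis by (simp add: power2_eq_square)
    qed
    finally show ?case .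
  qed
  \<comment> \<open>Enclose \<open>F\<close> in a symmetric interval.\<close>
  define M where "M = Suc (nat (Max (abs ` (insert 0 F))))"
  have "F \<subseteq> {- int M..int M} - {0}"
  proof
    fix n assume n: "n \<in> F"
    then have "\<bar>n\<bar> \<le> Max (abs ` (insert 0 F))" using assms by (intro Max_ge) auto
    moreover have "0 \<le> Max (abs ` (insert 0 F))" by (rule Max_ge) (use assms in auto)
    ultimately have "\<bar>n\<bar> \<le> int M" unfolding M_def by linarith
    then show "n \<in> {- int M..int M} - {0}" using n assms by auto
  qed
  then have "(\<Sum>n\<in>F. 1 / (of_int n)\<^sup>2 :: real) \<le> (\<Sum>n\<in>{- int M..int M} - {0}. 1 / (of_int n)\<^sup>2)"
    by (intro sum_mono2) auto
  also have "\<dots> \<le> 4 - 2 / real M" by (rule *) (simp add: M_def)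
  also have "\<dots> \<le> 4" by simp
  finally show ?thesis .
qed

text \<open>
  One derivative buys absolute summability: by Cauchy-Schwarz, \<open>|n|\<^sup>m |w\<^sub>n| = |n|\<^sup>-\<^sup>1 (|n|\<^sup>m\<^sup>+\<^sup>1 |w\<^sub>n|)\<close>
  is summable, and Bessel's inequality bounds the second factor. This is where the index \<open>s + 1\<close> on
  the right-hand side of the main estimate originates.
\<close>

lemma sobolev_fcoef_sum_le:
  fixes w :: "real \<Rightarrow> complex"
  assumes w: "w \<in> sobolev (Suc m)" and F: "finite F" "0 \<notin> F"
  shows "(\<Sum>n\<in>F. \<bar>of_int n\<bar> ^ m * norm (fcoef w n)) \<le> 2 * l2norm (weak_deriv (Suc m) w)"
proof -
  let ?g = "weak_deriv (Suc m) w"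
  note g = sobolev_weak_deriv[OF w order_refl]
  have ge: "\<bar>of_int n\<bar> ^ Suc m * norm (fcoef w n) \<le> norm (fcoef ?g n)" for n
  proof -
    have "norm (fcoef ?g n) = (2 * pi * \<bar>of_int n\<bar>) ^ Suc m * norm (fcoef w n)"
      using fcoef_weak_deriv[OF g(2) sobolev_L2[OF w] g(1), of n] by (simp add: norm_mult norm_power)
    moreover have "\<bar>of_int n\<bar> ^ Suc m \<le> (2 * pi * \<bar>of_int n\<bar>) ^ Suc m"
    proof (rule power_mono)
      have "1 \<le> 2 * pi" using pi_ge_two by linarith
      then show "\<bar>of_int n\<bar> \<le> 2 * pi * \<bar>of_int n\<bar>" using mult_right_mono[of 1 "2*pi" "\<bar>of_int n\<bar>"] by simp
    qed simp
    ultimately show ?thesis by (simp add: mult_right_mono)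
  qed
  have "(\<Sum>n\<in>F. \<bar>of_int n\<bar> ^ m * norm (fcoef w n)) \<le> (\<Sum>n\<in>F. \<bar>1 / of_int n\<bar> * \<bar>norm (fcoef ?g n)\<bar>)"
  proof (rule sum_mono)
    fix n assume "n \<in> F"
    then have "n \<noteq> 0" using F by auto
    then have "\<bar>of_int n\<bar> ^ m * norm (fcoef w n) = \<bar>1 / of_int n\<bar> * (\<bar>of_int n\<bar> ^ Suc m * norm (fcoef w n))"
      by simp
    also have "\<dots> \<le> \<bar>1 / of_int n\<bar> * norm (fcoef ?g n)" by (intro mult_left_mono ge) simp
    finally show "\<bar>of_int n\<bar> ^ m * norm (fcoef w n) \<le> \<bar>1 / of_int n\<bar> * \<bar>norm (fcoef ?g n)\<bar>" by simp
  qed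
  also have "\<dots> \<le> L2_set (\<lambda>n. 1 / of_int n) F * L2_set (\<lambda>n. norm (fcoef ?g n)) F" by (rule L2_set_mult_ineq)
  also have "\<dots> \<le> 2 * l2norm ?g"
  proof (rule mult_mono)
    have "L2_set (\<lambda>n. 1 / of_int n) F \<le> sqrt 4" unfolding L2_set_def
      using sum_inverse_squares_le[OF F] by (intro real_sqrt_le_mono) (simp add: power_divide)
    then show "L2_set (\<lambda>n. 1 / real_of_int n) F \<le> 2" by simp
    show "L2_set (\<lambda>n. norm (fcoef ?g n)) F \<le> l2norm ?g" unfolding L2_set_def
      by (rule real_le_lsqrt) (use bessel_inequality[OF g(1) F(1)] in \<open>auto intro: sum_nonneg\<close>)
  qed (auto simp: L2_set_nonneg)
  finally show ?thesis .
qed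

lemma sobolev_fcoef_summable:
  fixes w :: "real \<Rightarrow> complex"
  assumes w: "w \<in> sobolev (Suc m)"
  shows "(\<lambda>n. \<bar>of_int n\<bar> ^ m * norm (fcoef w n)) summable_on (- {0})"
    and "(\<Sum>\<^sub>\<infinity>n\<in>- {0}. \<bar>of_int n\<bar> ^ m * norm (fcoef w n)) \<le> 2 * l2norm (weak_deriv (Suc m) w)"
proof -
  show s: "(\<lambda>n. \<bar>of_int n\<bar> ^ m * norm (fcoef w n)) summable_on (- {0})"
    by (rule nonneg_bdd_above_summable_on)
       (use sobolev_fcoef_sum_le[OF w] in \<open>auto intro!: bdd_aboveI2[where M = "2 * l2norm (weak_deriv (Suc m) w)"]\<close>)
  show "(\<Sum>\<^sub>\<infinity>n\<in>- {0}. \<bar>of_int n\<bar> ^ m * norm (fcoef w n)) \<le> 2 * l2norm (weak_deriv (Suc m) w)"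
    by (rule infsum_le_finite_sums[OF s]) (use sobolev_fcoef_sum_le[OF w] in auto)
qed

lemma summable_on_int_punctured:
  fixes f :: "int \<Rightarrow> real"
  shows "f summable_on (- {0}) \<Longrightarrow> f summable_on UNIV"
  using summable_on_insert_iff[of f 0 "- {0}"] by (metis Compl_UNIV_eq Un_Diff_cancel insert_is_Un sup_compl_top)

lemma infsum_int_punctured:
  fixes f :: "int \<Rightarrow> real"
  assumes "f summable_on (- {0})"
  shows "infsum f UNIV = f 0 + infsum f (- {0})"
proof -
  have "infsum f ({0} \<union> - {0}) = infsum f {0} + infsum f (- {0})"
    by (rule infsum_Un_disjoint) (use assms in auto)
  then show ?thesis by simp
qed

lemma sobolev_l1_fcoef:
  fixes w :: "real \<Rightarrow> complex"
  assumes "w \<in> sobolev 1"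
  shows "l1 (fcoef w)"
  using sobolev_fcoef_summable(1)[of w 0] assms unfolding l1_def by (intro summable_on_int_punctured) simp

lemma norm_fcoef_le_l2norm:
  assumes "w \<in> torus_L2" shows "norm (fcoef w n) \<le> l2norm w"
  using bessel_inequality[OF assms, of "{n}"] by (auto intro: power2_le_imp_le)

text \<open>
  The embedding of \<open>H\<^sup>1\<close> into the bounded functions.
\<close>

lemma sobolev_sup_bound:
  fixes w :: "real \<Rightarrow> complex"
  assumes "w \<in> sobolev 1"
  shows "AE x in lebesgue. norm (w x) \<le> 3 * sobolev_norm 1 w"
proof -
  have l1: "l1 (fcoef w)" by (rule sobolev_l1_fcoef[OF assms])
  have s: "(\<lambda>n. norm (fcoef w n)) summable_on - {0}" using sobolev_fcoef_summable(1)[of w 0] assms by simp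
  have "(\<Sum>\<^sub>\<infinity>n. norm (fcoef w n)) = norm (fcoef w 0) + (\<Sum>\<^sub>\<infinity>n\<in>- {0}. norm (fcoef w n))"
    by (rule infsum_int_punctured[OF s])
  also have "\<dots> \<le> l2norm w + 2 * l2norm (weak_deriv 1 w)"
    using sobolev_fcoef_summable(2)[of w 0] assms norm_fcoef_le_l2norm[OF sobolev_L2[OF assms], of 0] by simp
  also have "\<dots> \<le> 3 * sobolev_norm 1 w"
    using l2norm_le_sobolev_norm[of 1 1 w] l2norm_le_sobolev_norm_0[OF assms] by simp
  finally have b: "(\<Sum>\<^sub>\<infinity>n. norm (fcoef w n)) \<le> 3 * sobolev_norm 1 w" .
  show ?thesis using fourier_inversion[OF sobolev_L2[OF assms] l1]
    by eventually_elim (use norm_fser_le[OF l1] b in \<open>auto intro: order_trans\<close>)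
qed

section \<open>Rescaling by an integer\<close>

text \<open>
  On each of the \<open>k\<close> intervals of length \<open>1/k\<close> substitute \<open>z = k y - i\<close>, which leaves \<open>f\<close> unchanged.
\<close>

lemma has_integral_rescale_periodic:
  fixes f :: "real \<Rightarrow> 'a::euclidean_space"
  assumes f: "periodic1 f" and k: "k \<ge> (1::nat)"
    and I: "\<And>i. i < k \<Longrightarrow> ((\<lambda>z. \<phi> ((z + real i) / real k) *\<^sub>R f z) has_integral I i) {0..1}"
  shows "((\<lambda>y. \<phi> y *\<^sub>R f (real k * y)) has_integral (\<Sum>i<k. I i /\<^sub>R real k)) {0..1}"
proof -
  have piece: "((\<lambda>y. \<phi> y *\<^sub>R f (real k * y)) has_integral (I i /\<^sub>R real k)) {real i / real k..real (Suc i) / real k}" if "i < k" for i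
  proof -
    have A: "((\<lambda>y. \<phi> ((real k *\<^sub>R y + (- real i) + real i) / real k) *\<^sub>R f (real k *\<^sub>R y + (- real i))) has_integral (I i /\<^sub>R real k ^ DIM(real)))
       (cbox ((0 - (- real i)) /\<^sub>R real k) ((1 - (- real i)) /\<^sub>R real k))"
      using has_integral_affinity'[of "\<lambda>z. \<phi> ((z + real i) / real k) *\<^sub>R f z" "I i" 0 1 "real k" "- real i"] I[OF that] k by simp
    have "f (real k *\<^sub>R y + (- real i)) = f (real k * y)" for y
      using periodic1_int[OF f, of "real k * y" "- int i"] by simp
    moreover have "(real k *\<^sub>R y + (- real i) + real i) / real k = y" for y using k by simp
    moreover have "cbox ((0 - (- real i)) /\<^sub>R real k) ((1 - (- real i)) /\<^sub>R real k) = {real i / real k..real (Suc i) / real k}"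
      by (simp add: divide_inverse mult.commute add.commute)
    ultimately show ?thesis using A by (simp only:) simp
  qed
  have "((\<lambda>y. \<phi> y *\<^sub>R f (real k * y)) has_integral (\<Sum>i<j. I i /\<^sub>R real k)) {0..real j / real k}" if "j \<le> k" for j
    using that
  proof (induction j)
    case (Suc j)
    show ?case unfolding sum.lessThan_Suc
      by (rule has_integral_combine[of 0 "real j / real k"])
         (use Suc piece[of j] k in \<open>auto simp: divide_right_mono\<close>)
  qed (simp add: has_integral_refl)
  from this[of k] show ?thesis using k by simp
qed

lemma T01_integrable_iff:
  fixes f :: "real \<Rightarrow> 'a::euclidean_space"
  shows "integrable T01 f \<longleftrightarrow> f integrable_on {0..1} \<and> (\<lambda>x. norm (f x)) integrable_on {0..1}"
  using set_integrable_T01[of f] by (simp add: absolutely_integrable_on_def)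

lemma has_integral_T01:
  fixes f :: "real \<Rightarrow> 'a::euclidean_space"
  shows "integrable T01 f \<Longrightarrow> (f has_integral integral\<^sup>L T01 f) {0..1}"
  by (rule has_integral_integral_lebesgue_on) auto

lemma integrable_T01_rescale:
  fixes f :: "real \<Rightarrow> 'a::euclidean_space"
  assumes f: "periodic1 f" "integrable T01 f" and k: "k \<ge> (1::nat)"
  shows "integrable T01 (\<lambda>y. f (real k * y))"
    and "integral\<^sup>L T01 (\<lambda>y. f (real k * y)) = integral\<^sup>L T01 f"
proof -
  have 1: "((\<lambda>y. f (real k * y)) has_integral integral\<^sup>L T01 f) {0..1}"
    using has_integral_rescale_periodic[OF f(1) k, of "\<lambda>_. 1" "\<lambda>_. integral\<^sup>L T01 f"] has_integral_T01[OF f(2)] k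
    by (simp add: sum_constant_scaleR)
  have n: "periodic1 (\<lambda>x. norm (f x))" using f(1) by (simp add: periodic1_def)
  have 2: "((\<lambda>y. norm (f (real k * y))) has_integral integral\<^sup>L T01 (\<lambda>x. norm (f x))) {0..1}"
    using has_integral_rescale_periodic[OF n k, of "\<lambda>_. 1" "\<lambda>_. integral\<^sup>L T01 (\<lambda>x. norm (f x))"]
      has_integral_T01[OF integrable_norm[OF f(2)]] k
    by (simp add: mult.assoc[symmetric])
  show i: "integrable T01 (\<lambda>y. f (real k * y))"
    unfolding T01_integrable_iff using 1 2 by blast
  show "integral\<^sup>L T01 (\<lambda>y. f (real k * y)) = integral\<^sup>L T01 f"
    using has_integral_T01[OF i] 1 by (rule has_integral_unique)
qed

lemma torus_L2_rescale:
  fixes w :: "real \<Rightarrow> 'a::euclidean_space"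
  assumes w: "w \<in> torus_L2" and k: "k \<ge> (1::nat)"
  shows "(\<lambda>y. w (real k * y)) \<in> torus_L2"
  unfolding torus_L2_iff
proof (intro conjI)
  have p: "periodic1 w" using w by (simp add: torus_L2_iff)
  show "periodic1 (\<lambda>y. w (real k * y))"
    unfolding periodic1_def
  proof
    fix y
    show "w (real k * (y + 1)) = w (real k * y)"
      using periodic1_int[OF p, of "real k * y" "int k"] by (simp add: algebra_simps)
  qed
  have "(\<lambda>y::real. 0 + (\<Sum>j\<in>Basis. (real k * (y \<bullet> j)) *\<^sub>R j)) \<in> lebesgue \<rightarrow>\<^sub>M lebesgue"
    using lebesgue_affine_measurable[of "\<lambda>_. real k" "0::real"] k by simp
  then have "(\<lambda>y::real. real k * y) \<in> lebesgue \<rightarrow>\<^sub>M lebesgue" by simp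
  from measurable_compose[OF this, of w borel]
  show "(\<lambda>y. w (real k * y)) \<in> borel_measurable lebesgue" using w by (simp add: torus_L2_iff)
  have "periodic1 (\<lambda>x. (norm (w x))\<^sup>2)" using p by (simp add: periodic1_def)
  then show "integrable T01 (\<lambda>y. (norm (w (real k * y)))\<^sup>2)"
    by (rule integrable_T01_rescale) (use w k in \<open>auto simp: torus_L2_iff\<close>)
qed

text \<open>
  The adjoint of the rescaling \<open>f \<mapsto> f (k \<cdot>)\<close>. It sends test functions to test functions, so that weak
  derivatives of \<open>f (k \<cdot>)\<close> can be tested on \<open>f\<close>.
\<close>

definition periodize :: "nat \<Rightarrow> (real \<Rightarrow> real) \<Rightarrow> real \<Rightarrow> real" where
  "periodize k \<phi> z = (\<Sum>i<k. \<phi> ((z + real i) / real k) / real k)"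

lemma periodize_deriv:
  assumes "\<phi> \<in> torus_test" "k \<ge> 1"
  shows "(deriv ^^ j) (periodize k \<phi>) = (\<lambda>z. periodize k ((deriv ^^ j) \<phi>) z / real k ^ j)"
proof (induction j)
  case (Suc j)
  let ?\<psi> = "(deriv ^^ j) \<phi>"
  have "((\<lambda>z. periodize k ?\<psi> z / real k ^ j) has_real_derivative periodize k (deriv ?\<psi>) z / real k ^ Suc j) (at z)" for z
  proof -
    have d: "((\<lambda>z. ?\<psi> ((z + real i) / real k) / real k) has_real_derivative deriv ?\<psi> ((z + real i) / real k) / real k / real k) (at z)" for i
    proof -
      have "((\<lambda>z. (z + real i) / real k) has_real_derivative 1 / real k) (at z)"
        using assms(2) by (auto intro!: derivative_eq_intros)
      from DERIV_chain2[OF torus_test_DERIV[OF torus_test_funpow[OF assms(1), of j]] this]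
      have "((\<lambda>z. ?\<psi> ((z + real i) / real k)) has_real_derivative deriv ?\<psi> ((z + real i) / real k) * (1 / real k)) (at z)" .
      from DERIV_cdivide[OF this, of "real k"] show ?thesis by simp
    qed
    have "((\<lambda>z. periodize k ?\<psi> z) has_real_derivative (\<Sum>i<k. deriv ?\<psi> ((z + real i) / real k) / real k / real k)) (at z)"
      unfolding periodize_def by (rule DERIV_sum) (rule d)
    from DERIV_cdivide[OF this, of "real k ^ j"] show ?thesis
      unfolding periodize_def by (simp add: sum_divide_distrib mult_ac)
  qed
  then have "deriv (\<lambda>z. periodize k ?\<psi> z / real k ^ j) z = periodize k (deriv ?\<psi>) z / real k ^ Suc j" for z
    by (rule DERIV_imp_deriv)
  then show ?case by (simp only: funpow.simps o_apply Suc.IH)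
qed simp

lemma periodize_torus_test:
  assumes "\<phi> \<in> torus_test" and k: "k \<ge> 1"
  shows "periodize k \<phi> \<in> torus_test"
proof -
  have per: "periodic1 \<phi>" using assms(1) by (simp add: torus_test_def)
  have "periodize k \<phi> (z + 1) = periodize k \<phi> z" for z
  proof -
    define h where "h = (\<lambda>i. \<phi> ((z + real i) / real k) / real k)"
    have "h k = h 0"
    proof -
      have "(z + real k) / real k = z / real k + 1" using k by (simp add: field_simps)
      then have "\<phi> ((z + real k) / real k) = \<phi> (z / real k)" using per by (simp only: periodic1_def)
      then show ?thesis by (simp add: h_def)
    qed
    moreover have "periodize k \<phi> (z + 1) = (\<Sum>i<k. h (Suc i))" "periodize k \<phi> z = (\<Sum>i<k. h i)"
      by (simp_all add: periodize_def h_def add_ac)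
    moreover have "(\<Sum>i<Suc k. h i) = h 0 + (\<Sum>i<k. h (Suc i))" by (rule sum.lessThan_Suc_shift)
    moreover have "(\<Sum>i<Suc k. h i) = (\<Sum>i<k. h i) + h k" by simp
    ultimately show ?thesis by linarith
  qed
  moreover have "(deriv ^^ n) (periodize k \<phi>) differentiable (at x)" for n x
  proof -
    have "(\<lambda>z. periodize k ((deriv ^^ n) \<phi>) z / real k ^ n) differentiable (at x)"
    proof -
      have d: "((\<lambda>z. ((deriv ^^ n) \<phi>) ((z + real i) / real k)) has_real_derivative
         deriv ((deriv ^^ n) \<phi>) ((x + real i) / real k) * (1 / real k)) (at x)" for i
      proof -
        have "((\<lambda>z. (z + real i) / real k) has_real_derivative 1 / real k) (at x)"
          using assms(2) by (auto intro!: derivative_eq_intros)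
        from DERIV_chain2[OF torus_test_DERIV[OF torus_test_funpow[OF assms(1), of n]] this] show ?thesis .
      qed
      show ?thesis unfolding periodize_def real_differentiable_def
        by (rule exI, rule DERIV_cdivide, rule DERIV_sum, rule DERIV_cdivide, rule d)
    qed
    then show ?thesis by (simp add: periodize_deriv[OF assms])
  qed
  ultimately show ?thesis by (simp add: torus_test_def periodic1_def)
qed

lemma torus_test_rescale_integral:
  fixes f :: "real \<Rightarrow> 'a::euclidean_space"
  assumes f: "f \<in> torus_L2" and k: "k \<ge> 1" and \<phi>: "\<phi> \<in> torus_test"
  shows "integral\<^sup>L T01 (\<lambda>y. \<phi> y *\<^sub>R f (real k * y)) = integral\<^sup>L T01 (\<lambda>z. periodize k \<phi> z *\<^sub>R f z)"
proof -
  have p: "periodic1 f" using f by (simp add: torus_L2_iff)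
  obtain B where B: "\<And>x. norm (\<phi> x) \<le> B"
    using periodic1_bounded[OF torus_test_continuous[OF \<phi>]] \<phi> by (auto simp: torus_test_def)
  have i: "integrable T01 (\<lambda>z. \<phi> ((z + real i) / real k) *\<^sub>R f z)" for i
  proof (rule Bochner_Integration.integrable_bound)
    show "integrable T01 (\<lambda>x. B * norm (f x))" using torus_L2_integrable[OF f] by simp
    have "continuous_on UNIV (\<lambda>z. \<phi> ((z + real i) / real k))"
      by (rule continuous_on_compose2[OF torus_test_continuous[OF \<phi>]]) (use k in \<open>auto intro!: continuous_intros\<close>)
    then show "(\<lambda>z. \<phi> ((z + real i) / real k) *\<^sub>R f z) \<in> borel_measurable T01"
      using measurable_T01[OF measurable_lebesgue_continuous] torus_L2_measurable[OF f] by measurable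
    show "AE x in T01. norm (\<phi> ((x + real i) / real k) *\<^sub>R f x) \<le> norm (B * norm (f x))"
    proof (intro AE_I2)
      fix x
      have "\<bar>\<phi> ((x + real i) / real k)\<bar> \<le> \<bar>B\<bar>" using B[of "(x + real i) / real k"] by simp
      then show "norm (\<phi> ((x + real i) / real k) *\<^sub>R f x) \<le> norm (B * norm (f x))"
        by (simp add: abs_mult mult_right_mono)
    qed
  qed
  have "((\<lambda>y. \<phi> y *\<^sub>R f (real k * y)) has_integral (\<Sum>i<k. integral\<^sup>L T01 (\<lambda>z. \<phi> ((z + real i) / real k) *\<^sub>R f z) /\<^sub>R real k)) {0..1}"
    by (rule has_integral_rescale_periodic[OF p k]) (rule has_integral_T01[OF i])
  moreover have "((\<lambda>y. \<phi> y *\<^sub>R f (real k * y)) has_integral integral\<^sup>L T01 (\<lambda>y. \<phi> y *\<^sub>R f (real k * y))) {0..1}"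
    by (rule has_integral_T01[OF torus_test_integrable[OF \<phi> torus_L2_integrable[OF torus_L2_rescale[OF f k]]]])
  ultimately have "integral\<^sup>L T01 (\<lambda>y. \<phi> y *\<^sub>R f (real k * y)) = (\<Sum>i<k. integral\<^sup>L T01 (\<lambda>z. \<phi> ((z + real i) / real k) *\<^sub>R f z) /\<^sub>R real k)"
    by (rule has_integral_unique[rotated])
  also have "\<dots> = integral\<^sup>L T01 (\<lambda>z. \<Sum>i<k. (\<phi> ((z + real i) / real k) *\<^sub>R f z) /\<^sub>R real k)"
  proof -
    have "integrable T01 (\<lambda>z. (\<phi> ((z + real i) / real k) *\<^sub>R f z) /\<^sub>R real k)" for i
      by (rule integrable_scaleR_right[OF i])
    then show ?thesis by (subst Bochner_Integration.integral_sum) (simp_all only: integral_scaleR_right)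
  qed
  also have "(\<lambda>z. \<Sum>i<k. (\<phi> ((z + real i) / real k) *\<^sub>R f z) /\<^sub>R real k) = (\<lambda>z. periodize k \<phi> z *\<^sub>R f z)"
    by (simp add: periodize_def scaleR_sum_left divide_inverse mult.commute)
  finally show ?thesis .
qed

lemma is_weak_deriv_rescale:
  fixes w g :: "real \<Rightarrow> 'a::euclidean_space"
  assumes w: "w \<in> torus_L2" "g \<in> torus_L2" "is_weak_deriv j w g" and k: "k \<ge> 1"
  shows "is_weak_deriv j (\<lambda>y. w (real k * y)) (\<lambda>y. real k ^ j *\<^sub>R g (real k * y))"
  unfolding is_weak_deriv_T01
proof
  fix \<phi> assume \<phi>: "\<phi> \<in> torus_test"
  let ?\<psi> = "periodize k \<phi>"
  have "integral\<^sup>L T01 (\<lambda>y. (deriv ^^ j) \<phi> y *\<^sub>R w (real k * y)) = integral\<^sup>L T01 (\<lambda>z. periodize k ((deriv ^^ j) \<phi>) z *\<^sub>R w z)"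
    by (rule torus_test_rescale_integral[OF w(1) k torus_test_funpow[OF \<phi>]])
  also have "\<dots> = integral\<^sup>L T01 (\<lambda>z. real k ^ j *\<^sub>R ((deriv ^^ j) ?\<psi> z *\<^sub>R w z))"
    using k by (simp add: periodize_deriv[OF \<phi> k])
  also have "\<dots> = real k ^ j *\<^sub>R ((- 1) ^ j *\<^sub>R integral\<^sup>L T01 (\<lambda>z. ?\<psi> z *\<^sub>R g z))"
    using w(3) periodize_torus_test[OF \<phi> k] by (simp only: is_weak_deriv_T01 integral_scaleR_right)
  also have "integral\<^sup>L T01 (\<lambda>z. ?\<psi> z *\<^sub>R g z) = integral\<^sup>L T01 (\<lambda>y. \<phi> y *\<^sub>R g (real k * y))"
    by (rule torus_test_rescale_integral[OF w(2) k \<phi>, symmetric])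
  also have "real k ^ j *\<^sub>R ((- 1) ^ j *\<^sub>R integral\<^sup>L T01 (\<lambda>y. \<phi> y *\<^sub>R g (real k * y))) =
     (- 1) ^ j *\<^sub>R integral\<^sup>L T01 (\<lambda>y. real k ^ j *\<^sub>R (\<phi> y *\<^sub>R g (real k * y)))"
    by (subst integral_scaleR_right) (simp only: scaleR_scaleR mult.commute)
  finally show "integral\<^sup>L T01 (\<lambda>y. (deriv ^^ j) \<phi> y *\<^sub>R w (real k * y)) =
     (- 1) ^ j *\<^sub>R integral\<^sup>L T01 (\<lambda>y. \<phi> y *\<^sub>R (real k ^ j *\<^sub>R g (real k * y)))"
    by (simp add: mult.commute mult.left_commute)
qed

lemma sobolev_rescale:
  fixes w :: "real \<Rightarrow> 'a::euclidean_space"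
  assumes w: "w \<in> sobolev m" and k: "k \<ge> (1::nat)"
  shows "(\<lambda>y. w (real k * y)) \<in> sobolev m"
  unfolding sobolev_def
proof (intro CollectI conjI allI impI)
  show "(\<lambda>y. w (real k * y)) \<in> torus_L2" by (rule torus_L2_rescale[OF sobolev_L2[OF w] k])
  fix j assume j: "j \<le> m"
  note g = sobolev_weak_deriv[OF w j]
  have "(\<lambda>y. real k ^ j *\<^sub>R weak_deriv j w (real k * y)) \<in> torus_L2"
    by (rule torus_L2_linear[OF torus_L2_rescale[OF g(1) k]]) (rule bounded_linear_scaleR_right)
  moreover have "is_weak_deriv j (\<lambda>y. w (real k * y)) (\<lambda>y. real k ^ j *\<^sub>R weak_deriv j w (real k * y))"
    by (rule is_weak_deriv_rescale[OF sobolev_L2[OF w] g k])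
  ultimately show "\<exists>g\<in>torus_L2. is_weak_deriv j (\<lambda>y. w (real k * y)) g" by blast
qed

text \<open>
  Hence the norm of \<open>a (k0 \<cdot>)\<close> controls the Fourier coefficients of \<open>a\<close> itself.
\<close>

lemma fcoef_rescale:
  assumes w: "w \<in> torus_L2" and k: "k \<ge> (1::nat)"
  shows "fcoef (\<lambda>y. w (real k * y)) (int k * n) = fcoef w n"
proof -
  have "periodic1 (\<lambda>z. w z * fbase (- n) z)"
    using w periodic_fbase by (simp add: torus_L2_iff periodic1_def)
  moreover have "integrable T01 (\<lambda>z. w z * fbase (- n) z)"
    by (rule integrable_mult_fbase[OF torus_L2_integrable[OF w]])
  ultimately have "integral\<^sup>L T01 (\<lambda>y. w (real k * y) * fbase (- n) (real k * y)) = fcoef w n"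
    unfolding fcoef_def using k by (rule integrable_T01_rescale(2))
  moreover have "fbase (- n) (real k * y) = fbase (- (int k * n)) y" for y
    by (simp add: fbase_def mult_ac)
  ultimately show ?thesis by (simp add: fcoef_def)
qed

section \<open>Uniqueness for the Burgers equation\<close>

lemma l2norm_triangle:
  fixes f g :: "real \<Rightarrow> 'a::euclidean_space"
  assumes "f \<in> torus_L2" "g \<in> torus_L2"
  shows "l2norm (\<lambda>x. f x + g x) \<le> l2norm f + l2norm g"
proof -
  have i: "integrable T01 (\<lambda>x. (norm (f x))\<^sup>2)" "integrable T01 (\<lambda>x. (norm (g x))\<^sup>2)"
     "integrable T01 (\<lambda>x. norm (f x) * norm (g x))" "integrable T01 (\<lambda>x. (norm (f x + g x))\<^sup>2)"
    using assms torus_L2_norm_mult[OF assms] torus_L2_add[OF assms] by (auto simp: torus_L2_iff)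
  have "(l2norm (\<lambda>x. f x + g x))\<^sup>2 \<le> integral\<^sup>L T01 (\<lambda>x. (norm (f x))\<^sup>2 + 2 * (norm (f x) * norm (g x)) + (norm (g x))\<^sup>2)"
    unfolding l2norm_sq
  proof (rule integral_mono)
    fix x
    have "(norm (f x + g x))\<^sup>2 \<le> (norm (f x) + norm (g x))\<^sup>2" by (intro power_mono norm_triangle_ineq) simp
    then show "(norm (f x + g x))\<^sup>2 \<le> (norm (f x))\<^sup>2 + 2 * (norm (f x) * norm (g x)) + (norm (g x))\<^sup>2"
      by (simp add: power2_sum)
  qed (use i in auto)
  also have "\<dots> = (l2norm f)\<^sup>2 + 2 * integral\<^sup>L T01 (\<lambda>x. norm (f x) * norm (g x)) + (l2norm g)\<^sup>2"
    unfolding l2norm_sq using i by simp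
  also have "\<dots> \<le> (l2norm f)\<^sup>2 + 2 * (l2norm f * l2norm g) + (l2norm g)\<^sup>2"
    using L2_Cauchy_Schwarz[OF assms] by simp
  also have "\<dots> = (l2norm f + l2norm g)\<^sup>2" by (simp add: power2_sum)
  finally show ?thesis by (rule power2_le_imp_le) simp
qed

lemma l2norm_minus: "l2norm (\<lambda>x. - f x) = l2norm f"
  by (simp add: l2norm_def)

lemma torus_L2_minus: "f \<in> torus_L2 \<Longrightarrow> (\<lambda>x. - f x) \<in> torus_L2"
  by (simp add: torus_L2_iff periodic1_def)

lemma l2norm_triangle_diff:
  fixes f g :: "real \<Rightarrow> 'a::euclidean_space"
  assumes "f \<in> torus_L2" "g \<in> torus_L2"
  shows "l2norm (\<lambda>x. f x - g x) \<le> l2norm f + l2norm g"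
  using l2norm_triangle[OF assms(1) torus_L2_minus[OF assms(2)]] by (simp add: l2norm_minus)

lemma l2norm_zero_AE:
  assumes "f \<in> torus_L2" "l2norm f = 0"
  shows "AE x in lebesgue. f x = 0"
proof (rule AE_T01_periodic)
  have "integral\<^sup>L T01 (\<lambda>x. (norm (f x))\<^sup>2) = 0" using assms(2) by (simp add: l2norm_def)
  then have "AE x in T01. (norm (f x))\<^sup>2 = 0"
    using assms(1) by (subst (asm) integral_nonneg_eq_0_iff_AE) (auto simp: torus_L2_iff)
  then show "AE x in T01. f x = 0" by simp
  show "periodic1 (\<lambda>x. f x = 0)" using assms(1) by (simp add: torus_L2_iff periodic1_def)
qed

lemma sobolev_norm_mono: "r \<le> s \<Longrightarrow> sobolev_norm r w \<le> sobolev_norm s w"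
  unfolding sobolev_norm_l2norm by (intro real_sqrt_le_mono sum_mono2) auto

lemma sobolev_norm_le_sum: "sobolev_norm s w \<le> (\<Sum>j\<le>s. l2norm (weak_deriv j w))"
  unfolding sobolev_norm_l2norm using L2_set_le_sum[of "{..s}" "\<lambda>j. l2norm (weak_deriv j w)"]
  by (simp add: L2_set_def)

text \<open>
  The factor \<open>s + 1\<close> comes from replacing the Euclidean sum over the derivatives by a plain sum. It
  does no harm, as only boundedness is derived from this.
\<close>

lemma sobolev_norm_add_le:
  fixes f g :: "real \<Rightarrow> 'a::euclidean_space"
  assumes "f \<in> sobolev s" "g \<in> sobolev s"
  shows "sobolev_norm s (\<lambda>x. f x + g x) \<le> (real s + 1) * (sobolev_norm s f + sobolev_norm s g)"
proof -
  have "l2norm (weak_deriv j (\<lambda>x. f x + g x)) \<le> sobolev_norm s f + sobolev_norm s g" if "j \<le> s" for j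
  proof -
    note L = sobolev_weak_deriv(1)[OF assms(1) that] sobolev_weak_deriv(1)[OF assms(2) that]
    have "l2norm (weak_deriv j (\<lambda>x. f x + g x)) = l2norm (\<lambda>x. weak_deriv j f x + weak_deriv j g x)"
      by (intro l2norm_cong_AE sobolev_add(2)[OF assms that] torus_L2_add L sobolev_weak_deriv(1)[OF sobolev_add(1)[OF assms] that])
    also have "\<dots> \<le> l2norm (weak_deriv j f) + l2norm (weak_deriv j g)" by (rule l2norm_triangle[OF L])
    also have "\<dots> \<le> sobolev_norm s f + sobolev_norm s g" by (intro add_mono l2norm_le_sobolev_norm that)
    finally show ?thesis .
  qed
  then have "(\<Sum>j\<le>s. l2norm (weak_deriv j (\<lambda>x. f x + g x))) \<le> (\<Sum>j\<le>s. sobolev_norm s f + sobolev_norm s g)"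
    by (intro sum_mono) auto
  then show ?thesis using sobolev_norm_le_sum[of s "\<lambda>x. f x + g x"] by (simp add: algebra_simps)
qed

text \<open>
  The norm is locally bounded along a continuous curve, and finitely many neighbourhoods cover \<open>S\<close>.
\<close>

lemma sobolev_continuous_on_bounded:
  assumes u: "sobolev_continuous_on s S u" and S: "compact S"
  obtains B where "\<And>t. t \<in> S \<Longrightarrow> sobolev_norm s (u t) \<le> B" "B \<ge> 0"
proof -
  have "\<exists>d>0. \<forall>r\<in>S. dist r t < d \<longrightarrow> sobolev_norm s (u r) \<le> (real s + 1) * (1 + sobolev_norm s (u t))" if t: "t \<in> S" for t
  proof -
    have ut: "u t \<in> sobolev s" "((\<lambda>r. sobolev_norm s (\<lambda>x. u r x - u t x)) \<longlongrightarrow> 0) (at t within S)"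
      using u t by (auto simp: sobolev_continuous_on_def sobolev_tendsto_def)
    have "\<forall>\<^sub>F r in at t within S. dist (sobolev_norm s (\<lambda>x. u r x - u t x)) 0 < 1"
      by (rule tendstoD[OF ut(2)]) simp
    then obtain d where d: "d > 0" "\<And>r. r \<in> S \<Longrightarrow> r \<noteq> t \<Longrightarrow> dist r t < d \<Longrightarrow> sobolev_norm s (\<lambda>x. u r x - u t x) < 1"
      unfolding eventually_at by auto
    have "sobolev_norm s (u r) \<le> (real s + 1) * (1 + sobolev_norm s (u t))" if r: "r \<in> S" "dist r t < d" for r
    proof (cases "r = t")
      case True
      have "1 * sobolev_norm s (u t) \<le> (real s + 1) * (1 + sobolev_norm s (u t))" by (intro mult_mono) auto
      then show ?thesis using True by simp
    next
      case False
      have ur: "u r \<in> sobolev s" using u r by (simp add: sobolev_continuous_on_def)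
      have "sobolev_norm s (\<lambda>x. (u r x - u t x) + u t x) \<le> (real s + 1) * (sobolev_norm s (\<lambda>x. u r x - u t x) + sobolev_norm s (u t))"
        by (rule sobolev_norm_add_le[OF sobolev_diff(1)[OF ur ut(1)] ut(1)])
      also have "\<dots> \<le> (real s + 1) * (1 + sobolev_norm s (u t))"
        using d(2)[OF r(1) False r(2)] by (intro mult_left_mono add_right_mono) auto
      finally show ?thesis by simp
    qed
    then show ?thesis using d(1) by blast
  qed
  then obtain d where d: "\<And>t. t \<in> S \<Longrightarrow> d t > 0"
     "\<And>t r. t \<in> S \<Longrightarrow> r \<in> S \<Longrightarrow> dist r t < d t \<Longrightarrow> sobolev_norm s (u r) \<le> (real s + 1) * (1 + sobolev_norm s (u t))"
    by metis
  have "S \<subseteq> (\<Union>t\<in>S. ball t (d t))" using d(1) by force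
  then obtain C where C: "C \<subseteq> S" "finite C" "S \<subseteq> (\<Union>t\<in>C. ball t (d t))"
    by (rule compactE_image[OF S, rotated]) auto
  define B where "B = (\<Sum>t\<in>C. (real s + 1) * (1 + sobolev_norm s (u t)))"
  show ?thesis
  proof
    show "B \<ge> 0" unfolding B_def by (intro sum_nonneg) simp
    fix r assume r: "r \<in> S"
    then obtain t where t: "t \<in> C" "dist t r < d t" using C(3) by auto
    then have "sobolev_norm s (u r) \<le> (real s + 1) * (1 + sobolev_norm s (u t))"
      using C(1) d(2)[of t r] r by (auto simp: dist_commute)
    also have "\<dots> \<le> B" unfolding B_def by (rule member_le_sum) (use t C in auto)
    finally show "sobolev_norm s (u r) \<le> B" .
  qed
qed

text \<open>
  Test the first derivative with \<open>\<phi>'\<close>: both sides are integrals of \<open>\<phi>'' w\<close>.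
\<close>

lemma weak_deriv_twice:
  fixes w :: "real \<Rightarrow> 'a::euclidean_space"
  assumes w: "w \<in> sobolev 2"
  shows "weak_deriv 1 w \<in> sobolev 1" "AE x in lebesgue. weak_deriv 1 (weak_deriv 1 w) x = weak_deriv 2 w x"
proof -
  note g1 = sobolev_weak_deriv[OF w one_le_numeral]
  note g2 = sobolev_weak_deriv[OF w order_refl]
  have d: "is_weak_deriv 1 (weak_deriv 1 w) (weak_deriv 2 w)"
    unfolding is_weak_deriv_T01
  proof
    fix \<phi> assume \<phi>: "\<phi> \<in> torus_test"
    have 1: "integral\<^sup>L T01 (\<lambda>x. deriv (deriv \<phi>) x *\<^sub>R w x) = - integral\<^sup>L T01 (\<lambda>x. deriv \<phi> x *\<^sub>R weak_deriv 1 w x)"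
      using g1(2) torus_test_deriv[OF \<phi>] by (simp add: is_weak_deriv_T01)
    have 2: "integral\<^sup>L T01 (\<lambda>x. deriv (deriv \<phi>) x *\<^sub>R w x) = integral\<^sup>L T01 (\<lambda>x. \<phi> x *\<^sub>R weak_deriv 2 w x)"
      using g2(2) \<phi> by (simp add: is_weak_deriv_T01 numeral_2_eq_2)
    show "integral\<^sup>L T01 (\<lambda>x. (deriv ^^ 1) \<phi> x *\<^sub>R weak_deriv 1 w x) = (- 1) ^ 1 *\<^sub>R integral\<^sup>L T01 (\<lambda>x. \<phi> x *\<^sub>R weak_deriv 2 w x)"
      using 1 2 by (simp add: equation_minus_iff)
  qed
  show "weak_deriv 1 w \<in> sobolev 1" unfolding sobolev_def
  proof (intro CollectI conjI allI impI)
    show "weak_deriv 1 w \<in> torus_L2" by (rule g1)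
    fix j :: nat assume "j \<le> 1"
    then have "j = 0 \<or> j = 1" by auto
    then show "\<exists>g\<in>torus_L2. is_weak_deriv j (weak_deriv 1 w) g"
      using d g1(1) g2(1) is_weak_deriv_0 by blast
  qed
  show "AE x in lebesgue. weak_deriv 1 (weak_deriv 1 w) x = weak_deriv 2 w x"
    by (rule weak_deriv_AE[OF g2(1) d])
qed

lemma sobolev_norm_weak_deriv_1:
  fixes w :: "real \<Rightarrow> 'a::euclidean_space"
  assumes w: "w \<in> sobolev 2"
  shows "sobolev_norm 1 (weak_deriv 1 w) \<le> 2 * sobolev_norm 2 w"
proof -
  note W = weak_deriv_twice[OF w]
  have "l2norm (weak_deriv 1 (weak_deriv 1 w)) = l2norm (weak_deriv 2 w)"
    by (intro l2norm_cong_AE W sobolev_weak_deriv(1)[OF W(1)] sobolev_weak_deriv(1)[OF w]) auto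
  moreover have "l2norm (weak_deriv 0 (weak_deriv 1 w)) = l2norm (weak_deriv 1 w)"
    by (intro l2norm_cong_AE weak_deriv_AE is_weak_deriv_0 sobolev_weak_deriv(1)[OF W(1)] sobolev_weak_deriv(1)[OF w]) auto
  ultimately have "sobolev_norm 1 (weak_deriv 1 w) \<le> l2norm (weak_deriv 1 w) + l2norm (weak_deriv 2 w)"
    using sobolev_norm_le_sum[of 1 "weak_deriv 1 w"] by simp
  then show ?thesis using l2norm_le_sobolev_norm[of 1 2 w] l2norm_le_sobolev_norm[of 2 2 w] by simp
qed

text \<open>
  Functions in \<open>H\<^sup>1\<close> have absolutely convergent Fourier series, which can be integrated termwise
  against \<open>g\<close>. The index \<open>-n\<close> appears because conjugation reverses the frequencies.
\<close>

lemma parseval_sobolev: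
  fixes f g :: "real \<Rightarrow> complex"
  assumes f: "f \<in> sobolev 1" and g: "g \<in> torus_L2"
  shows "((\<lambda>n. cnj (fcoef f (- n)) * fcoef g (- n)) has_sum integral\<^sup>L T01 (\<lambda>x. cnj (f x) * g x)) UNIV"
proof -
  define \<alpha> where "\<alpha> = (\<lambda>n. cnj (fcoef f (- n)))"
  have l: "l1 (fcoef f)" by (rule sobolev_l1_fcoef[OF f])
  have bij: "bij_betw uminus (UNIV :: int set) UNIV" by (rule bij_betwI[where g = uminus]) auto
  have a: "l1 \<alpha>" unfolding l1_def \<alpha>_def
    using summable_on_reindex_bij_betw[OF bij, of "\<lambda>n. norm (fcoef f n)"] l by (simp add: l1_def)
  have "AE x in T01. cnj (f x) = fser \<alpha> x"
    using AE_T01I[OF fourier_inversion[OF sobolev_L2[OF f] l]]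
    by eventually_elim (simp add: fser_cnj \<alpha>_def)
  then have "integral\<^sup>L T01 (\<lambda>x. cnj (f x) * g x) = integral\<^sup>L T01 (\<lambda>x. fser \<alpha> x * g x)"
    using torus_L2_measurable[OF torus_L2_linear[OF sobolev_L2[OF f] bounded_linear_cnj]] torus_L2_measurable[OF g]
      measurable_T01[OF measurable_lebesgue_continuous[OF fser_continuous[OF a]]]
    by (intro integral_cong_AE) (auto intro!: borel_measurable_times)
  moreover have "integral\<^sup>L T01 (\<lambda>x. fbase n x * g x) = fcoef g (- n)" for n
    by (simp add: fcoef_def mult.commute)
  ultimately show ?thesis
    using integral_fser_mult[OF a torus_L2_integrable[OF g]] by (simp add: \<alpha>_def)
qed

text \<open>
  Both sides are computed from Fourier coefficients, so that the weak derivatives are only used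
  through \<open>fcoef_weak_deriv\<close>.
\<close>

lemma energy_integration_by_parts:
  fixes d :: "real \<Rightarrow> complex"
  assumes d: "d \<in> sobolev 2"
  shows "integral\<^sup>L T01 (\<lambda>x. cnj (d x) * weak_deriv 2 d x) = - of_real ((l2norm (weak_deriv 1 d))\<^sup>2)"
proof -
  note g1 = sobolev_weak_deriv[OF d one_le_numeral]
  note g2 = sobolev_weak_deriv[OF d order_refl]
  have L: "d \<in> torus_L2" by (rule sobolev_L2[OF d])
  have f1: "fcoef (weak_deriv 1 d) n = (2 * pi * \<i> * of_int n) * fcoef d n" for n
    using fcoef_weak_deriv[OF g1(2) L g1(1), of n] by simp
  have f2: "fcoef (weak_deriv 2 d) n = (2 * pi * \<i> * of_int n)\<^sup>2 * fcoef d n" for n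
    using fcoef_weak_deriv[OF g2(2) L g2(1), of n] by simp
  have 1: "((\<lambda>n. cnj (fcoef d (- n)) * fcoef (weak_deriv 2 d) (- n)) has_sum integral\<^sup>L T01 (\<lambda>x. cnj (d x) * weak_deriv 2 d x)) UNIV"
    by (rule parseval_sobolev[OF sobolev_mono[OF d] g2(1)]) simp
  have 2: "((\<lambda>n. cnj (fcoef (weak_deriv 1 d) (- n)) * fcoef (weak_deriv 1 d) (- n)) has_sum integral\<^sup>L T01 (\<lambda>x. cnj (weak_deriv 1 d x) * weak_deriv 1 d x)) UNIV"
    by (rule parseval_sobolev[OF weak_deriv_twice(1)[OF d] g1(1)])
  have "cnj (fcoef d (- n)) * fcoef (weak_deriv 2 d) (- n) = - (cnj (fcoef (weak_deriv 1 d) (- n)) * fcoef (weak_deriv 1 d) (- n))" for n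
    unfolding f1 f2 by (simp add: power2_eq_square algebra_simps)
  with 1 have "((\<lambda>n. (- 1) * (cnj (fcoef (weak_deriv 1 d) (- n)) * fcoef (weak_deriv 1 d) (- n))) has_sum integral\<^sup>L T01 (\<lambda>x. cnj (d x) * weak_deriv 2 d x)) UNIV"
    by simp
  from has_sum_unique[OF this has_sum_cmult_right[OF 2]]
  have "integral\<^sup>L T01 (\<lambda>x. cnj (d x) * weak_deriv 2 d x) = - integral\<^sup>L T01 (\<lambda>x. cnj (weak_deriv 1 d x) * weak_deriv 1 d x)"
    by simp
  also have "integral\<^sup>L T01 (\<lambda>x. cnj (weak_deriv 1 d x) * weak_deriv 1 d x) = integral\<^sup>L T01 (\<lambda>x. of_real ((norm (weak_deriv 1 d x))\<^sup>2))"
    by (simp only: complex_norm_square mult.commute)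
  also have "\<dots> = of_real ((l2norm (weak_deriv 1 d))\<^sup>2)" unfolding l2norm_sq by (rule integral_complex_of_real)
  finally show ?thesis .
qed

text \<open>
  Write \<open>d\<^sub>r = d\<^sub>t + (r - t) q\<^sub>r\<close> with difference quotients \<open>q\<^sub>r\<close> that converge in \<open>L\<^sup>2\<close>. The derivative is
  one-sided at the end points of \<open>S\<close>.
\<close>

lemma energy_derivative:
  fixes d :: "real \<Rightarrow> real \<Rightarrow> complex"
  assumes d: "\<And>r. r \<in> S \<Longrightarrow> d r \<in> torus_L2" and t: "t \<in> S" and D: "D \<in> torus_L2"
    and lim: "((\<lambda>r. l2norm (\<lambda>x. (d r x - d t x) /\<^sub>R (r - t) - D x)) \<longlongrightarrow> 0) (at t within S)"
  shows "((\<lambda>r. (l2norm (d r))\<^sup>2) has_real_derivative 2 * Re (integral\<^sup>L T01 (\<lambda>x. cnj (d t x) * D x))) (at t within S)"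
proof -
  define q where "q = (\<lambda>r x. (d r x - d t x) /\<^sub>R (r - t))"
  define N where "N = (\<lambda>r. l2norm (\<lambda>x. q r x - D x))"
  define I where "I = integral\<^sup>L T01 (\<lambda>x. cnj (d t x) * D x)"
  have N: "(N \<longlongrightarrow> 0) (at t within S)" using lim by (simp add: N_def q_def)
  have qL: "q r \<in> torus_L2" if "r \<in> S" for r
    unfolding q_def by (rule torus_L2_linear[OF torus_L2_diff[OF d[OF that] d[OF t]]]) (rule bounded_linear_scaleR_right)
  have cL: "(\<lambda>x. cnj (d t x)) \<in> torus_L2" by (rule torus_L2_linear[OF d[OF t]]) (rule bounded_linear_cnj)
  have cn: "l2norm (\<lambda>x. cnj (d t x)) = l2norm (d t)" by (simp add: l2norm_def)
  have eq: "((l2norm (d r))\<^sup>2 - (l2norm (d t))\<^sup>2) / (r - t) = 2 * Re (integral\<^sup>L T01 (\<lambda>x. cnj (d t x) * q r x)) + (r - t) * (l2norm (q r))\<^sup>2"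
    if r: "r \<in> S" "r \<noteq> t" for r
  proof -
    \<comment> \<open>The integrand of the energy is a quadratic polynomial in \<open>r - t\<close>.\<close>
    have pw: "(norm (d r x))\<^sup>2 = (norm (d t x))\<^sup>2 + 2 * (r - t) * Re (cnj (d t x) * q r x) + (r - t)\<^sup>2 * (norm (q r x))\<^sup>2" for x
    proof -
      have "d r x = d t x + (r - t) *\<^sub>R q r x" using r by (simp add: q_def)
      then show ?thesis by (simp only: cmod_power2) (simp add: power2_eq_square algebra_simps)
    qed
    have i1: "integrable T01 (\<lambda>x. (norm (d t x))\<^sup>2)" using d[OF t] by (simp add: torus_L2_iff)
    have i2: "integrable T01 (\<lambda>x. Re (cnj (d t x) * q r x))"
      by (rule integrable_Re[OF torus_L2_mult_integrable[OF cL qL[OF r(1)]]])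
    have i3: "integrable T01 (\<lambda>x. (norm (q r x))\<^sup>2)" using qL[OF r(1)] by (simp add: torus_L2_iff)
    have "(l2norm (d r))\<^sup>2 = integral\<^sup>L T01 (\<lambda>x. (norm (d t x))\<^sup>2 + 2 * (r - t) * Re (cnj (d t x) * q r x) + (r - t)\<^sup>2 * (norm (q r x))\<^sup>2)"
      unfolding l2norm_sq pw ..
    also have "\<dots> = integral\<^sup>L T01 (\<lambda>x. (norm (d t x))\<^sup>2) + 2 * (r - t) * integral\<^sup>L T01 (\<lambda>x. Re (cnj (d t x) * q r x)) + (r - t)\<^sup>2 * integral\<^sup>L T01 (\<lambda>x. (norm (q r x))\<^sup>2)"
    proof -
      define p where "p = (\<lambda>x. Re (cnj (d t x) * q r x))"
      have "integral\<^sup>L T01 (\<lambda>x. (norm (d t x))\<^sup>2 + 2 * (r - t) * p x + (r - t)\<^sup>2 * (norm (q r x))\<^sup>2) =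
        integral\<^sup>L T01 (\<lambda>x. (norm (d t x))\<^sup>2) + 2 * (r - t) * integral\<^sup>L T01 p + (r - t)\<^sup>2 * integral\<^sup>L T01 (\<lambda>x. (norm (q r x))\<^sup>2)"
        using i1 i2[folded p_def] i3 by simp
      then show ?thesis unfolding p_def .
    qed
    also have "integral\<^sup>L T01 (\<lambda>x. Re (cnj (d t x) * q r x)) = Re (integral\<^sup>L T01 (\<lambda>x. cnj (d t x) * q r x))"
      by (rule integral_Re[OF torus_L2_mult_integrable[OF cL qL[OF r(1)]]])
    finally have "(l2norm (d r))\<^sup>2 = (l2norm (d t))\<^sup>2 + 2 * (r - t) * Re (integral\<^sup>L T01 (\<lambda>x. cnj (d t x) * q r x)) + (r - t)\<^sup>2 * (l2norm (q r))\<^sup>2"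
      by (simp only: l2norm_sq)
    then have "(l2norm (d r))\<^sup>2 - (l2norm (d t))\<^sup>2 = (r - t) * (2 * Re (integral\<^sup>L T01 (\<lambda>x. cnj (d t x) * q r x)) + (r - t) * (l2norm (q r))\<^sup>2)"
      by (simp add: power2_eq_square algebra_simps)
    then show ?thesis using r by simp
  qed
  have b1: "norm (integral\<^sup>L T01 (\<lambda>x. cnj (d t x) * q r x) - I) \<le> l2norm (d t) * N r" if "r \<in> S" for r
  proof -
    have "integral\<^sup>L T01 (\<lambda>x. cnj (d t x) * q r x) - I = integral\<^sup>L T01 (\<lambda>x. cnj (d t x) * (q r x - D x))"
      unfolding I_def using torus_L2_mult_integrable[OF cL qL[OF that]] torus_L2_mult_integrable[OF cL D]
      by (simp add: right_diff_distrib)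
    then show ?thesis using L2_integral_mult_le[OF cL torus_L2_diff[OF qL[OF that] D]] by (simp add: cn N_def)
  qed
  have b2: "l2norm (q r) \<le> N r + l2norm D" if "r \<in> S" for r
    using l2norm_triangle[OF torus_L2_diff[OF qL[OF that] D] D] by (simp add: N_def)
  have evS: "\<forall>\<^sub>F r in at t within S. r \<in> S \<and> r \<noteq> t"
    by (simp add: eventually_at_filter)
  have l1: "((\<lambda>r. integral\<^sup>L T01 (\<lambda>x. cnj (d t x) * q r x)) \<longlongrightarrow> I) (at t within S)"
  proof -
    have "((\<lambda>r. integral\<^sup>L T01 (\<lambda>x. cnj (d t x) * q r x) - I) \<longlongrightarrow> 0) (at t within S)"
    proof (rule Lim_null_comparison)
      show "\<forall>\<^sub>F r in at t within S. norm (integral\<^sup>L T01 (\<lambda>x. cnj (d t x) * q r x) - I) \<le> l2norm (d t) * N r"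
        using evS by eventually_elim (use b1 in auto)
      show "((\<lambda>r. l2norm (d t) * N r) \<longlongrightarrow> 0) (at t within S)" using tendsto_mult_right_zero[OF N] .
    qed
    then show ?thesis by (simp add: LIM_zero_iff)
  qed
  have l2: "((\<lambda>r. (r - t) * (l2norm (q r))\<^sup>2) \<longlongrightarrow> 0) (at t within S)"
  proof (rule Lim_null_comparison)
    show "\<forall>\<^sub>F r in at t within S. norm ((r - t) * (l2norm (q r))\<^sup>2) \<le> \<bar>r - t\<bar> * (N r + l2norm D)\<^sup>2"
      using evS
    proof eventually_elim
      case (elim r)
      have "(l2norm (q r))\<^sup>2 \<le> (N r + l2norm D)\<^sup>2" by (intro power_mono b2) (use elim in auto)
      then show ?case by (simp add: abs_mult mult_left_mono)
    qed
    have "((\<lambda>r. \<bar>r - t\<bar> * (N r + l2norm D)\<^sup>2) \<longlongrightarrow> \<bar>t - t\<bar> * (0 + l2norm D)\<^sup>2) (at t within S)"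
      by (intro tendsto_intros N)
    then show "((\<lambda>r. \<bar>r - t\<bar> * (N r + l2norm D)\<^sup>2) \<longlongrightarrow> 0) (at t within S)" by simp
  qed
  have "((\<lambda>r. 2 * Re (integral\<^sup>L T01 (\<lambda>x. cnj (d t x) * q r x)) + (r - t) * (l2norm (q r))\<^sup>2) \<longlongrightarrow> 2 * Re I + 0) (at t within S)"
    by (intro tendsto_intros l1 l2)
  moreover have "\<forall>\<^sub>F r in at t within S. 2 * Re (integral\<^sup>L T01 (\<lambda>x. cnj (d t x) * q r x)) + (r - t) * (l2norm (q r))\<^sup>2
      = ((l2norm (d r))\<^sup>2 - (l2norm (d t))\<^sup>2) / (r - t)"
    using evS by eventually_elim (use eq in auto)
  ultimately have "((\<lambda>r. ((l2norm (d r))\<^sup>2 - (l2norm (d t))\<^sup>2) / (r - t)) \<longlongrightarrow> 2 * Re I + 0) (at t within S)"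
    by (rule Lim_transform_eventually)
  then show ?thesis by (simp add: has_field_derivative_iff I_def)
qed

text \<open>
  \<open>E t exp (-K t)\<close> is nonincreasing and vanishes at \<open>t = 0\<close>.
\<close>

lemma gronwall_zero:
  fixes E E' :: "real \<Rightarrow> real"
  assumes "\<And>t. t \<in> {0..T} \<Longrightarrow> (E has_real_derivative E' t) (at t within {0..T})"
    and "\<And>t. t \<in> {0..T} \<Longrightarrow> E' t \<le> K * E t" and "E 0 = 0" and t: "t \<in> {0..T}"
  shows "E t \<le> 0"
proof -
  define F where "F = (\<lambda>t. E t * exp (- K * t))"
  have d: "(F has_real_derivative (E' r - K * E r) * exp (- K * r)) (at r within {0..T})" if "r \<in> {0..T}" for r
    unfolding F_def by (auto intro!: derivative_eq_intros assms(1)[OF that] simp: algebra_simps)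
  have "\<exists>r\<in>{0..t}. F t - F 0 = ((E' r - K * E r) * exp (- K * r)) * (t - 0)"
  proof (rule mvt_very_simple)
    show "0 \<le> t" using t by simp
    fix r assume "0 \<le> r" "r \<le> t"
    then have "(F has_real_derivative (E' r - K * E r) * exp (- K * r)) (at r within {0..t})"
      using t by (intro DERIV_subset[OF d]) auto
    then show "(F has_derivative (\<lambda>h. ((E' r - K * E r) * exp (- K * r)) * h)) (at r within {0..t})"
      by (simp add: has_field_derivative_def)
  qed
  then obtain r where r: "r \<in> {0..t}" "F t - F 0 = ((E' r - K * E r) * exp (- K * r)) * t" by auto
  have "E' r - K * E r \<le> 0" using assms(2)[of r] r t by auto
  then have "((E' r - K * E r) * exp (- K * r)) * t \<le> 0"
    using t by (intro mult_nonpos_nonneg) auto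
  then have "F t \<le> 0" using r assms(3) by (simp add: F_def)
  then show ?thesis by (simp add: F_def mult_le_0_iff)
qed

lemma time_deriv_L2:
  fixes u :: "real \<Rightarrow> real \<Rightarrow> complex"
  assumes "sobolev_has_time_deriv m u ut t S"
  shows "ut \<in> torus_L2" "((\<lambda>r. l2norm (\<lambda>x. (u r x - u t x) /\<^sub>R (r - t) - ut x)) \<longlongrightarrow> 0) (at t within S)"
proof -
  have ev: "\<forall>\<^sub>F r in at t within S. (\<lambda>x. (u r x - u t x) /\<^sub>R (r - t)) \<in> sobolev m" and ut: "ut \<in> sobolev m"
    and lim: "((\<lambda>r. sobolev_norm m (\<lambda>x. (u r x - u t x) /\<^sub>R (r - t) - ut x)) \<longlongrightarrow> 0) (at t within S)"
    using assms by (auto simp: sobolev_has_time_deriv_def sobolev_tendsto_def)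
  show "ut \<in> torus_L2" by (rule sobolev_L2[OF ut])
  show "((\<lambda>r. l2norm (\<lambda>x. (u r x - u t x) /\<^sub>R (r - t) - ut x)) \<longlongrightarrow> 0) (at t within S)"
  proof (rule Lim_null_comparison[OF _ lim])
    show "\<forall>\<^sub>F r in at t within S. norm (l2norm (\<lambda>x. (u r x - u t x) /\<^sub>R (r - t) - ut x)) \<le> sobolev_norm m (\<lambda>x. (u r x - u t x) /\<^sub>R (r - t) - ut x)"
      using ev by eventually_elim (use l2norm_le_sobolev_norm_0[OF sobolev_diff(1)[OF _ ut]] in simp)
  qed
qed

text \<open>
  Here \<open>D\<close> is the time derivative of the difference \<open>d = w - u\<close> of two solutions. The nonlinearity is
  split as \<open>w w\<^sub>x - u u\<^sub>x = w d\<^sub>x + d u\<^sub>x\<close>, and the viscous term \<open>-\<epsilon> \<parallel>d\<^sub>x\<parallel>\<^sup>2\<close> absorbs the factor \<open>d\<^sub>x\<close>. As the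
  solutions are complex-valued, \<open>w d\<^sub>x\<close> cannot be integrated by parts against \<open>d\<close> instead.
\<close>

lemma burgers_energy_estimate:
  fixes w u D :: "real \<Rightarrow> complex"
  assumes w: "w \<in> sobolev 2" and u: "u \<in> sobolev 2" and \<epsilon>: "\<epsilon> > 0" and D: "D \<in> torus_L2"
    and Mw: "AE x in lebesgue. norm (w x) \<le> M" and Mu: "AE x in lebesgue. norm (weak_deriv 1 u x) \<le> M"
    and eq: "AE x in lebesgue. D x = of_real \<epsilon> * (weak_deriv 2 w x - weak_deriv 2 u x) - (w x * weak_deriv 1 w x - u x * weak_deriv 1 u x)"
    and M: "M \<ge> 0"
  shows "2 * Re (integral\<^sup>L T01 (\<lambda>x. cnj (w x - u x) * D x)) \<le> (M\<^sup>2 / (2 * \<epsilon>) + 2 * M) * (l2norm (\<lambda>x. w x - u x))\<^sup>2"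
proof -
  define d where "d = (\<lambda>x. w x - u x)"
  have d: "d \<in> sobolev 2" unfolding d_def by (rule sobolev_diff(1)[OF w u])
  have d1: "AE x in lebesgue. weak_deriv 1 d x = weak_deriv 1 w x - weak_deriv 1 u x"
    unfolding d_def by (rule sobolev_diff(2)[OF w u]) simp
  have d2: "AE x in lebesgue. weak_deriv 2 d x = weak_deriv 2 w x - weak_deriv 2 u x"
    unfolding d_def by (rule sobolev_diff(2)[OF w u]) simp
  note L = sobolev_L2[OF d] sobolev_weak_deriv(1)[OF d one_le_numeral] sobolev_weak_deriv(1)[OF d order_refl]
  have cL: "(\<lambda>x. cnj (d x)) \<in> torus_L2" by (rule torus_L2_linear[OF L(1)]) (rule bounded_linear_cnj)
  have cn: "l2norm (\<lambda>x. cnj (d x)) = l2norm d" by (simp add: l2norm_def)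
  have wd: "(\<lambda>x. w x * weak_deriv 1 d x) \<in> torus_L2" by (rule torus_L2_mult_bounded[OF L(2) sobolev_L2[OF w] Mw])
  have ud: "(\<lambda>x. weak_deriv 1 u x * d x) \<in> torus_L2"
    by (rule torus_L2_mult_bounded[OF L(1) sobolev_weak_deriv(1)[OF u] Mu]) simp
  have AE: "AE x in T01. cnj (d x) * D x = of_real \<epsilon> * (cnj (d x) * weak_deriv 2 d x) - cnj (d x) * (w x * weak_deriv 1 d x) - cnj (d x) * (weak_deriv 1 u x * d x)"
    using AE_T01I[OF eq] AE_T01I[OF d1] AE_T01I[OF d2]
  proof eventually_elim
    case (elim x)
    have "w x = d x + u x" by (simp add: d_def)
    then show ?case unfolding elim by (simp add: algebra_simps)
  qed
  note i = torus_L2_mult_integrable[OF cL L(3)] torus_L2_mult_integrable[OF cL wd] torus_L2_mult_integrable[OF cL ud]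
  have "integral\<^sup>L T01 (\<lambda>x. cnj (d x) * D x) = integral\<^sup>L T01 (\<lambda>x. of_real \<epsilon> * (cnj (d x) * weak_deriv 2 d x) - cnj (d x) * (w x * weak_deriv 1 d x) - cnj (d x) * (weak_deriv 1 u x * d x))"
    using AE i torus_L2_mult_integrable[OF cL D] by (intro integral_cong_AE) auto
  also have "\<dots> = of_real \<epsilon> * integral\<^sup>L T01 (\<lambda>x. cnj (d x) * weak_deriv 2 d x) - integral\<^sup>L T01 (\<lambda>x. cnj (d x) * (w x * weak_deriv 1 d x)) - integral\<^sup>L T01 (\<lambda>x. cnj (d x) * (weak_deriv 1 u x * d x))"
    using i by simp
  finally have e: "Re (integral\<^sup>L T01 (\<lambda>x. cnj (d x) * D x)) = - \<epsilon> * (l2norm (weak_deriv 1 d))\<^sup>2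
     - Re (integral\<^sup>L T01 (\<lambda>x. cnj (d x) * (w x * weak_deriv 1 d x))) - Re (integral\<^sup>L T01 (\<lambda>x. cnj (d x) * (weak_deriv 1 u x * d x)))"
    unfolding energy_integration_by_parts[OF d] by simp
  have bnd: "l2norm (\<lambda>x. g x * f x) \<le> M * l2norm f" if "AE x in lebesgue. norm (g x) \<le> M" "f \<in> torus_L2" "(\<lambda>x. g x * f x) \<in> torus_L2" for f g :: "real \<Rightarrow> complex"
  proof -
    have "(l2norm (\<lambda>x. g x * f x))\<^sup>2 \<le> integral\<^sup>L T01 (\<lambda>x. M\<^sup>2 * (norm (f x))\<^sup>2)"
      unfolding l2norm_sq
    proof (rule integral_mono_AE)
      show "AE x in T01. (norm (g x * f x))\<^sup>2 \<le> M\<^sup>2 * (norm (f x))\<^sup>2"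
        using AE_T01I[OF that(1)] by eventually_elim (simp add: norm_mult power_mult_distrib mult_right_mono power_mono)
    qed (use that in \<open>auto simp: torus_L2_iff\<close>)
    also have "\<dots> = (M * l2norm f)\<^sup>2" by (simp add: power_mult_distrib l2norm_sq)
    finally show ?thesis by (rule power2_le_imp_le) (use M in simp)
  qed
  have "- Re (integral\<^sup>L T01 (\<lambda>x. cnj (d x) * (w x * weak_deriv 1 d x))) \<le> norm (integral\<^sup>L T01 (\<lambda>x. cnj (d x) * (w x * weak_deriv 1 d x)))"
    using abs_Re_le_cmod[of "integral\<^sup>L T01 (\<lambda>x. cnj (d x) * (w x * weak_deriv 1 d x))"] by linarith
  also have "\<dots> \<le> l2norm d * l2norm (\<lambda>x. w x * weak_deriv 1 d x)" using L2_integral_mult_le[OF cL wd] by (simp add: cn)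
  also have "\<dots> \<le> l2norm d * (M * l2norm (weak_deriv 1 d))" by (intro mult_left_mono bnd Mw L wd) simp
  finally have b1: "- Re (integral\<^sup>L T01 (\<lambda>x. cnj (d x) * (w x * weak_deriv 1 d x))) \<le> l2norm d * (M * l2norm (weak_deriv 1 d))" .
  have "- Re (integral\<^sup>L T01 (\<lambda>x. cnj (d x) * (weak_deriv 1 u x * d x))) \<le> norm (integral\<^sup>L T01 (\<lambda>x. cnj (d x) * (weak_deriv 1 u x * d x)))"
    using abs_Re_le_cmod[of "integral\<^sup>L T01 (\<lambda>x. cnj (d x) * (weak_deriv 1 u x * d x))"] by linarith
  also have "\<dots> \<le> l2norm d * l2norm (\<lambda>x. weak_deriv 1 u x * d x)" using L2_integral_mult_le[OF cL ud] by (simp add: cn)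
  also have "\<dots> \<le> l2norm d * (M * l2norm d)" by (intro mult_left_mono bnd Mu L ud) simp
  finally have b2: "- Re (integral\<^sup>L T01 (\<lambda>x. cnj (d x) * (weak_deriv 1 u x * d x))) \<le> l2norm d * (M * l2norm d)" .
  define a where "a = l2norm d"
  define b where "b = l2norm (weak_deriv 1 d)"
  have "2 * Re (integral\<^sup>L T01 (\<lambda>x. cnj (d x) * D x)) \<le> 2 * (- \<epsilon> * b\<^sup>2 + a * (M * b) + a * (M * a))"
  proof -
    have *: "2 * R \<le> 2 * (- \<epsilon> * B + P + Q)" if "R = - \<epsilon> * B - X - Y" "- X \<le> P" "- Y \<le> Q" for R B X Y P Q :: real
      using that by simp
    show ?thesis unfolding a_def b_def by (rule *[OF e b1 b2])
  qed
  also have "\<dots> \<le> (M\<^sup>2 / (2 * \<epsilon>) + 2 * M) * a\<^sup>2"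
  proof -
    \<comment> \<open>Young's inequality for \<open>2 M a b\<close>, with the weight that cancels \<open>2 \<epsilon> b\<^sup>2\<close>.\<close>
    have "0 \<le> (2 * \<epsilon> * b - M * a)\<^sup>2" by simp
    then have "0 \<le> (2 * \<epsilon> * b - M * a)\<^sup>2 / (2 * \<epsilon>)" using \<epsilon> by simp
    also have "(2 * \<epsilon> * b - M * a)\<^sup>2 / (2 * \<epsilon>) = M\<^sup>2 / (2 * \<epsilon>) * a\<^sup>2 + 2 * \<epsilon> * b\<^sup>2 - 2 * (a * (M * b))"
      using \<epsilon> by (simp add: field_simps power2_eq_square)
    finally show ?thesis by (simp add: algebra_simps power2_eq_square)
  qed
  finally show ?thesis by (simp add: a_def d_def)
qed

text \<open>
  Two solutions are continuous in time with values in \<open>H\<^sup>2\<close>, so the functions and their first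
  derivatives are bounded on the whole time interval, and the energy of the difference obeys a linear
  differential inequality.
\<close>

theorem burgers_solution_unique:
  assumes s: "s \<ge> 2" and \<epsilon>: "\<epsilon> > 0"
    and u: "burgers_solution s \<epsilon> T u0 u" and w: "burgers_solution s \<epsilon> T u0 w" and t: "t \<in> {0..T}"
  shows "AE x in lebesgue. w t x = u t x"
proof -
  have uc: "sobolev_continuous_on s {0..T} u" and wc: "sobolev_continuous_on s {0..T} w"
    using u w by (auto simp: burgers_solution_def)
  have us: "u r \<in> sobolev 2" "w r \<in> sobolev 2" if "r \<in> {0..T}" for r
    using uc wc that s by (auto simp: sobolev_continuous_on_def intro: sobolev_mono)
  obtain B1 where B1: "\<And>r. r \<in> {0..T} \<Longrightarrow> sobolev_norm s (u r) \<le> B1" "B1 \<ge> 0"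
    using sobolev_continuous_on_bounded[OF uc] by auto
  obtain B2 where B2: "\<And>r. r \<in> {0..T} \<Longrightarrow> sobolev_norm s (w r) \<le> B2" "B2 \<ge> 0"
    using sobolev_continuous_on_bounded[OF wc] by auto
  \<comment> \<open>The embedding constant is 3, and \<open>sobolev_norm_weak_deriv_1\<close> contributes a factor 2.\<close>
  define M where "M = 6 * (B1 + B2)"
  have M0: "M \<ge> 0" using B1 B2 by (simp add: M_def)
  have Mw: "AE x in lebesgue. norm (w r x) \<le> M" if r: "r \<in> {0..T}" for r
  proof -
    have "sobolev_norm 1 (w r) \<le> B2" using sobolev_norm_mono[of 1 s "w r"] B2(1)[OF r] s by linarith
    then have "3 * sobolev_norm 1 (w r) \<le> M" using B1 B2 by (simp add: M_def)
    moreover have "w r \<in> sobolev 1" using us(2)[OF r] by (rule sobolev_mono) simp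
    ultimately show ?thesis using sobolev_sup_bound[of "w r"] by (auto elim!: eventually_mono)
  qed
  have Mu: "AE x in lebesgue. norm (weak_deriv 1 (u r) x) \<le> M" if r: "r \<in> {0..T}" for r
  proof -
    have "sobolev_norm 2 (u r) \<le> B1" using sobolev_norm_mono[of 2 s "u r"] B1(1)[OF r] s by linarith
    then have "3 * sobolev_norm 1 (weak_deriv 1 (u r)) \<le> M"
      using sobolev_norm_weak_deriv_1[OF us(1)[OF r]] B1 B2 by (simp add: M_def)
    then show ?thesis using sobolev_sup_bound[OF weak_deriv_twice(1)[OF us(1)[OF r]]] by (auto elim!: eventually_mono)
  qed
  define E where "E = (\<lambda>r. (l2norm (\<lambda>x. w r x - u r x))\<^sup>2)"
  have "\<exists>e. (E has_real_derivative e) (at r within {0..T}) \<and> e \<le> (M\<^sup>2 / (2 * \<epsilon>) + 2 * M) * E r" if r: "r \<in> {0..T}" for r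
  proof -
    obtain ut where ut: "sobolev_has_time_deriv (s - 2) u ut r {0..T}"
        "AE x in lebesgue. ut x + u r x * weak_deriv 1 (u r) x - of_real \<epsilon> * weak_deriv 2 (u r) x = \<i>"
      using u r unfolding burgers_solution_def by blast
    obtain wt where wt: "sobolev_has_time_deriv (s - 2) w wt r {0..T}"
        "AE x in lebesgue. wt x + w r x * weak_deriv 1 (w r) x - of_real \<epsilon> * weak_deriv 2 (w r) x = \<i>"
      using w r unfolding burgers_solution_def by blast
    note U = time_deriv_L2[OF ut(1)] and W = time_deriv_L2[OF wt(1)]
    define D where "D = (\<lambda>x. wt x - ut x)"
    have D: "D \<in> torus_L2" unfolding D_def by (rule torus_L2_diff[OF W(1) U(1)])
    have L: "u q \<in> torus_L2" "w q \<in> torus_L2" if "q \<in> {0..T}" for q using us[OF that] by (auto intro: sobolev_L2)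
    have lim: "((\<lambda>q. l2norm (\<lambda>x. ((w q x - u q x) - (w r x - u r x)) /\<^sub>R (q - r) - D x)) \<longlongrightarrow> 0) (at r within {0..T})"
    proof (rule Lim_null_comparison[OF _ tendsto_add_zero[OF W(2) U(2)]])
      have "\<forall>\<^sub>F q in at r within {0..T}. q \<in> {0..T}" by (simp add: eventually_at_filter)
      then show "\<forall>\<^sub>F q in at r within {0..T}. norm (l2norm (\<lambda>x. ((w q x - u q x) - (w r x - u r x)) /\<^sub>R (q - r) - D x))
        \<le> l2norm (\<lambda>x. (w q x - w r x) /\<^sub>R (q - r) - wt x) + l2norm (\<lambda>x. (u q x - u r x) /\<^sub>R (q - r) - ut x)"
      proof eventually_elim
        case (elim q)
        have q: "(\<lambda>x. (w q x - w r x) /\<^sub>R (q - r) - wt x) \<in> torus_L2" "(\<lambda>x. (u q x - u r x) /\<^sub>R (q - r) - ut x) \<in> torus_L2"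
          by (intro torus_L2_diff torus_L2_linear[OF torus_L2_diff bounded_linear_scaleR_right] L elim r U(1) W(1))+
        have "(\<lambda>x. ((w q x - u q x) - (w r x - u r x)) /\<^sub>R (q - r) - D x) =
          (\<lambda>x. ((w q x - w r x) /\<^sub>R (q - r) - wt x) - ((u q x - u r x) /\<^sub>R (q - r) - ut x))"
          by (simp add: D_def fun_eq_iff algebra_simps)
        then show ?case using l2norm_triangle_diff[OF q] by simp
      qed
    qed
    have der: "(E has_real_derivative 2 * Re (integral\<^sup>L T01 (\<lambda>x. cnj (w r x - u r x) * D x))) (at r within {0..T})"
      unfolding E_def
      by (rule energy_derivative[where d = "\<lambda>r x. w r x - u r x", OF _ r D lim]) (use L torus_L2_diff in blast)
    have "AE x in lebesgue. D x = of_real \<epsilon> * (weak_deriv 2 (w r) x - weak_deriv 2 (u r) x) - (w r x * weak_deriv 1 (w r) x - u r x * weak_deriv 1 (u r) x)"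
      using ut(2) wt(2) unfolding D_def
    proof eventually_elim
      case (elim x)
      have "wt x = \<i> - w r x * weak_deriv 1 (w r) x + of_real \<epsilon> * weak_deriv 2 (w r) x"
        unfolding elim(2)[symmetric] by simp
      moreover have "ut x = \<i> - u r x * weak_deriv 1 (u r) x + of_real \<epsilon> * weak_deriv 2 (u r) x"
        unfolding elim(1)[symmetric] by simp
      ultimately show ?case by (simp only:) (simp add: algebra_simps)
    qed
    from burgers_energy_estimate[OF us(2)[OF r] us(1)[OF r] \<epsilon> D Mw[OF r] Mu[OF r] this M0] der
    show ?thesis unfolding E_def by blast
  qed
  then obtain E' where E': "\<And>r. r \<in> {0..T} \<Longrightarrow> (E has_real_derivative E' r) (at r within {0..T})"
    "\<And>r. r \<in> {0..T} \<Longrightarrow> E' r \<le> (M\<^sup>2 / (2 * \<epsilon>) + 2 * M) * E r" by metis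
  have dL: "(\<lambda>x. w r x - u r x) \<in> torus_L2" if "r \<in> {0..T}" for r
    using us[OF that] by (auto intro: sobolev_L2 torus_L2_diff)
  have "E 0 = 0"
  proof -
    have "AE x in lebesgue. u 0 x = u0 x" "AE x in lebesgue. w 0 x = u0 x" using u w by (auto simp: burgers_solution_def)
    then have "AE x in lebesgue. w 0 x - u 0 x = 0" by eventually_elim simp
    then have "l2norm (\<lambda>x. w 0 x - u 0 x) = l2norm (\<lambda>x. 0 :: complex)"
      by (rule l2norm_cong_AE) (use dL[of 0] t in \<open>auto simp: torus_L2_iff periodic1_def\<close>)
    then show ?thesis by (simp add: E_def l2norm_def)
  qed
  from gronwall_zero[OF E' this t] have "l2norm (\<lambda>x. w t x - u t x) = 0" by (simp add: E_def)
  from l2norm_zero_AE[OF dL[OF t] this] show ?thesis by simp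
qed

section \<open>The weighted Wiener algebra\<close>

text \<open>
  The weight of the Wiener algebra of order \<open>k\<close>. The summand 1 makes it submultiplicative, with
  constant 1, so that the weighted \<open>l\<^sup>1\<close> norm is an algebra norm.
\<close>

definition wt :: "nat \<Rightarrow> int \<Rightarrow> real" where "wt k n = (1 + \<bar>of_int n\<bar>) ^ k"

lemma wt_ge_1: "1 \<le> wt k n" by (simp add: wt_def)

lemma wt_nonneg [simp]: "0 \<le> wt k n" by (simp add: wt_def)

lemma wt_add: "wt k (m + l) \<le> wt k m * wt k l"
proof -
  have "1 + \<bar>of_int (m + l)\<bar> \<le> (1 + \<bar>of_int m\<bar>) * (1 + \<bar>real_of_int l\<bar>)"
    by (simp add: algebra_simps abs_mult[symmetric])
  then show ?thesis unfolding wt_def power_mult_distrib[symmetric] by (rule power_mono) simp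
qed

definition wl1 :: "nat \<Rightarrow> (int \<Rightarrow> complex) \<Rightarrow> bool" where
  "wl1 k \<alpha> \<longleftrightarrow> (\<lambda>n. wt k n * norm (\<alpha> n)) summable_on UNIV"

definition wn :: "nat \<Rightarrow> (int \<Rightarrow> complex) \<Rightarrow> real" where
  "wn k \<alpha> = (\<Sum>\<^sub>\<infinity>n. wt k n * norm (\<alpha> n))"

lemma wn_nonneg [simp]: "0 \<le> wn k \<alpha>"
  unfolding wn_def by (rule infsum_nonneg) simp

lemma wl1_l1: "wl1 k \<alpha> \<Longrightarrow> l1 \<alpha>"
  unfolding wl1_def by (rule l1_mono) (use mult_right_mono[OF wt_ge_1] in auto)

text \<open>
  Superposition: a norm-summable family of coefficient sequences may be summed coefficientwise, and
  its Fourier series is the sum of the Fourier series. It gives products (superpositions of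
  translates) and the exponential.
\<close>

lemma wl1_infsum:
  fixes T :: "'i \<Rightarrow> int \<Rightarrow> complex"
  assumes T: "\<And>i. wl1 k (T i)" "\<And>i. wn k (T i) \<le> M i" and M: "M summable_on UNIV"
  defines "d \<equiv> \<lambda>n. \<Sum>\<^sub>\<infinity>i. T i n"
  shows "wl1 k d" "wn k d \<le> (\<Sum>\<^sub>\<infinity>i. M i)" "((\<lambda>i. fser (T i) x) has_sum fser d x) UNIV"
proof -
  have M0: "0 \<le> M i" for i using wn_nonneg[of k "T i"] T(2)[of i] by linarith
  have wnM: "(\<lambda>i. wn k (T i)) summable_on UNIV"
    by (rule summable_on_comparison_test[OF M]) (use T(2) in auto)
  have s: "(\<lambda>(i, n). wt k n * norm (T i n)) summable_on UNIV \<times> UNIV"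
  proof -
    have "(\<lambda>p. norm ((\<lambda>(i, n). wt k n * norm (T i n)) p)) summable_on UNIV \<times> UNIV"
      unfolding Infinite_Sum.abs_summable_on_Sigma_iff
    proof (intro conjI ballI)
      show "(\<lambda>n. norm (case (i, n) of (i, n) \<Rightarrow> wt k n * norm (T i n))) summable_on UNIV" for i
        using T(1)[of i] by (simp add: wl1_def abs_mult)
      show "(\<lambda>i. norm (\<Sum>\<^sub>\<infinity>n. norm (case (i, n) of (i, n) \<Rightarrow> wt k n * norm (T i n)))) summable_on UNIV"
        using wnM by (simp add: wn_def[symmetric] abs_mult)
    qed
    then show ?thesis by (rule abs_summable_summable)
  qed
  have s': "(\<lambda>(n, i). wt k n * norm (T i n)) summable_on UNIV \<times> UNIV"
    using s summable_on_swap[of "\<lambda>(i, n). wt k n * norm (T i n)" UNIV UNIV] by simp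
  have si: "(\<lambda>i. wt k n * norm (T i n)) summable_on UNIV" for n
    using summable_on_SigmaD1[of "\<lambda>n i. wt k n * norm (T i n)" UNIV "\<lambda>_. UNIV" n] s' by simp
  have Ti: "(\<lambda>i. norm (T i n)) summable_on UNIV" for n
    by (rule summable_on_comparison_test[OF si[of n]]) (use mult_right_mono[OF wt_ge_1] in auto)
  have b: "wt k n * norm (d n) \<le> (\<Sum>\<^sub>\<infinity>i. wt k n * norm (T i n))" for n
  proof -
    have "norm (d n) \<le> (\<Sum>\<^sub>\<infinity>i. norm (T i n))" unfolding d_def by (rule norm_infsum_bound[OF Ti])
    then have "wt k n * norm (d n) \<le> wt k n * (\<Sum>\<^sub>\<infinity>i. norm (T i n))" by (rule mult_left_mono) simp
    also have "\<dots> = (\<Sum>\<^sub>\<infinity>i. wt k n * norm (T i n))" by (rule infsum_cmult_right'[symmetric])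
    finally show ?thesis .
  qed
  have sn: "(\<lambda>n. \<Sum>\<^sub>\<infinity>i. wt k n * norm (T i n)) summable_on UNIV"
    using summable_on_Sigma_banach[of "\<lambda>n i. wt k n * norm (T i n)" UNIV "\<lambda>_. UNIV"] s' by simp
  show wl: "wl1 k d" unfolding wl1_def
    by (rule summable_on_comparison_test[OF sn]) (use b in auto)
  have "wn k d \<le> (\<Sum>\<^sub>\<infinity>n. \<Sum>\<^sub>\<infinity>i. wt k n * norm (T i n))" unfolding wn_def
    by (rule infsum_mono) (use wl sn b in \<open>auto simp: wl1_def\<close>)
  also have "\<dots> = (\<Sum>\<^sub>\<infinity>i. \<Sum>\<^sub>\<infinity>n. wt k n * norm (T i n))" by (rule infsum_swap_banach[OF s'])
  also have "\<dots> = (\<Sum>\<^sub>\<infinity>i. wn k (T i))" by (simp add: wn_def)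
  also have "\<dots> \<le> (\<Sum>\<^sub>\<infinity>i. M i)" by (rule infsum_mono[OF wnM M T(2)])
  finally show "wn k d \<le> (\<Sum>\<^sub>\<infinity>i. M i)" .
  have se: "(\<lambda>(n, i). T i n * fbase n x) summable_on UNIV \<times> UNIV"
    by (rule abs_summable_summable, rule summable_on_comparison_test[OF s'])
       (use mult_right_mono[OF wt_ge_1] in \<open>auto simp: norm_mult\<close>)
  then have se': "(\<lambda>(i, n). T i n * fbase n x) summable_on UNIV \<times> UNIV"
    using summable_on_swap[of "\<lambda>(n, i). T i n * fbase n x" UNIV UNIV] by simp
  have "(\<lambda>i. fser (T i) x) summable_on UNIV"
    using summable_on_Sigma_banach[of "\<lambda>i n. T i n * fbase n x" UNIV "\<lambda>_. UNIV"] se' by (simp add: fser_def)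
  moreover have "(\<Sum>\<^sub>\<infinity>i. fser (T i) x) = fser d x"
  proof -
    have "(\<Sum>\<^sub>\<infinity>i. fser (T i) x) = (\<Sum>\<^sub>\<infinity>n. \<Sum>\<^sub>\<infinity>i. T i n * fbase n x)"
      unfolding fser_def by (rule infsum_swap_banach[OF se'])
    also have "\<dots> = fser d x" unfolding fser_def d_def by (simp add: infsum_cmult_left')
    finally show ?thesis .
  qed
  ultimately show "((\<lambda>i. fser (T i) x) has_sum fser d x) UNIV"
    by (simp add: has_sum_iff)
qed

definition conv :: "(int \<Rightarrow> complex) \<Rightarrow> (int \<Rightarrow> complex) \<Rightarrow> int \<Rightarrow> complex" where
  "conv \<alpha> \<beta> n = (\<Sum>\<^sub>\<infinity>m. \<alpha> m * \<beta> (n - m))"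

text \<open>
  The product \<open>\<alpha> \<cdot> \<beta>\<close> is the superposition over \<open>m\<close> of the translates of \<open>\<beta>\<close> by \<open>m\<close>, with factors \<open>\<alpha> m\<close>.
\<close>

lemma wl1_conv:
  assumes a: "wl1 k \<alpha>" and b: "wl1 k \<beta>"
  shows "wl1 k (conv \<alpha> \<beta>)" "wn k (conv \<alpha> \<beta>) \<le> wn k \<alpha> * wn k \<beta>"
    "fser (conv \<alpha> \<beta>) x = fser \<alpha> x * fser \<beta> x"
proof -
  \<comment> \<open>The translate of \<open>\<beta>\<close> by \<open>m\<close>, with its factor.\<close>
  define T where "T = (\<lambda>m n. \<alpha> m * \<beta> (n - m))"
  have shift: "(\<lambda>n. wt k (n - m) * norm (\<beta> (n - m))) summable_on UNIV"
    "(\<Sum>\<^sub>\<infinity>n. wt k (n - m) * norm (\<beta> (n - m))) = wn k \<beta>" for m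
  proof -
    have bij: "bij_betw (\<lambda>n. n - m) UNIV UNIV" by (rule bij_betwI[where g = "\<lambda>n. n + m"]) auto
    show "(\<lambda>n. wt k (n - m) * norm (\<beta> (n - m))) summable_on UNIV"
      using summable_on_reindex_bij_betw[OF bij, of "\<lambda>n. wt k n * norm (\<beta> n)"] b by (simp add: wl1_def)
    show "(\<Sum>\<^sub>\<infinity>n. wt k (n - m) * norm (\<beta> (n - m))) = wn k \<beta>"
      using infsum_reindex_bij_betw[OF bij, of "\<lambda>n. wt k n * norm (\<beta> n)"] by (simp add: wn_def)
  qed
  have le: "wt k n * norm (T m n) \<le> (wt k m * norm (\<alpha> m)) * (wt k (n - m) * norm (\<beta> (n - m)))" for m n
  proof -
    have "wt k n \<le> wt k m * wt k (n - m)" using wt_add[of k m "n - m"] by simp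
    then have "wt k n * (norm (\<alpha> m) * norm (\<beta> (n - m))) \<le> (wt k m * wt k (n - m)) * (norm (\<alpha> m) * norm (\<beta> (n - m)))"
      by (rule mult_right_mono) simp
    then show ?thesis by (simp add: T_def norm_mult mult_ac)
  qed
  have wlT: "wl1 k (T m)" for m unfolding wl1_def
    by (rule summable_on_comparison_test[OF summable_on_cmult_right[OF shift(1)[of m]]]) (use le in auto)
  have wnT: "wn k (T m) \<le> (wt k m * norm (\<alpha> m)) * wn k \<beta>" for m
  proof -
    have "wn k (T m) \<le> (\<Sum>\<^sub>\<infinity>n. (wt k m * norm (\<alpha> m)) * (wt k (n - m) * norm (\<beta> (n - m))))"
      unfolding wn_def
      by (rule infsum_mono[OF _ summable_on_cmult_right[OF shift(1)[of m]] le]) (use wlT in \<open>simp add: wl1_def\<close>)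
    then show ?thesis by (simp add: infsum_cmult_right' shift(2))
  qed
  have M: "(\<lambda>m. (wt k m * norm (\<alpha> m)) * wn k \<beta>) summable_on UNIV"
    by (rule summable_on_cmult_left) (use a in \<open>simp add: wl1_def\<close>)
  note W = wl1_infsum[of k T, OF wlT wnT M]
  have c: "conv \<alpha> \<beta> = (\<lambda>n. \<Sum>\<^sub>\<infinity>m. T m n)" by (simp add: conv_def T_def fun_eq_iff)
  show "wl1 k (conv \<alpha> \<beta>)" unfolding c by (rule W(1))
  show "wn k (conv \<alpha> \<beta>) \<le> wn k \<alpha> * wn k \<beta>" unfolding c
    using W(2) by (simp add: infsum_cmult_left' wn_def[of k \<alpha>, symmetric])
  have "fser (T m) x = \<alpha> m * fbase m x * fser \<beta> x" for m
  proof -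
    have "fser (T m) x = (\<Sum>\<^sub>\<infinity>n. \<alpha> m * fbase m x * (\<beta> (n - m) * fbase (n - m) x))"
      unfolding fser_def T_def
    proof (intro infsum_cong)
      fix n
      have "fbase n x = fbase m x * fbase (n - m) x" by (simp add: fbase_mult)
      then show "\<alpha> m * \<beta> (n - m) * fbase n x = \<alpha> m * fbase m x * (\<beta> (n - m) * fbase (n - m) x)"
        by (simp only: mult_ac)
    qed
    also have "\<dots> = \<alpha> m * fbase m x * (\<Sum>\<^sub>\<infinity>n. \<beta> (n - m) * fbase (n - m) x)" by (rule infsum_cmult_right')
    also have "(\<Sum>\<^sub>\<infinity>n. \<beta> (n - m) * fbase (n - m) x) = fser \<beta> x"
      unfolding fser_def
      by (rule infsum_reindex_bij_betw[of "\<lambda>n. n - m" UNIV UNIV "\<lambda>n. \<beta> n * fbase n x"])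
         (rule bij_betwI[where g = "\<lambda>n. n + m"], auto)
    finally show ?thesis .
  qed
  then have "((\<lambda>m. \<alpha> m * fbase m x * fser \<beta> x) has_sum fser (conv \<alpha> \<beta>) x) UNIV"
    using W(3)[of x] unfolding c by simp
  moreover have "((\<lambda>m. \<alpha> m * fbase m x * fser \<beta> x) has_sum fser \<alpha> x * fser \<beta> x) UNIV"
    by (rule has_sum_cmult_left) (use fser_summable[OF wl1_l1[OF a]] in \<open>simp add: fser_def\<close>)
  ultimately show "fser (conv \<alpha> \<beta>) x = fser \<alpha> x * fser \<beta> x" by (rule has_sum_unique)
qed

text \<open>
  The coefficients of the power \<open>j + 1\<close>; starting at the first power avoids the unit sequence.
\<close>

primrec cpow :: "(int \<Rightarrow> complex) \<Rightarrow> nat \<Rightarrow> int \<Rightarrow> complex" where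
  "cpow \<alpha> 0 = \<alpha>"
| "cpow \<alpha> (Suc j) = conv \<alpha> (cpow \<alpha> j)"

lemma wl1_cpow:
  assumes "wl1 k \<alpha>"
  shows "wl1 k (cpow \<alpha> j) \<and> wn k (cpow \<alpha> j) \<le> wn k \<alpha> ^ Suc j \<and> fser (cpow \<alpha> j) x = fser \<alpha> x ^ Suc j"
proof (induction j)
  case (Suc j)
  then have IH: "wl1 k (cpow \<alpha> j)" "wn k (cpow \<alpha> j) \<le> wn k \<alpha> ^ Suc j" "fser (cpow \<alpha> j) x = fser \<alpha> x ^ Suc j" by auto
  have "wn k (cpow \<alpha> (Suc j)) \<le> wn k \<alpha> * wn k (cpow \<alpha> j)" using wl1_conv(2)[OF assms IH(1)] by simp
  also have "\<dots> \<le> wn k \<alpha> * wn k \<alpha> ^ Suc j" by (intro mult_left_mono IH) simp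
  finally show ?case using wl1_conv(1,3)[OF assms IH(1)] IH(3) by simp
qed (use assms in simp)

lemma has_sum_exp_Suc:
  fixes z :: "'a::{real_normed_field,banach}"
  shows "((\<lambda>j. z ^ Suc j / fact (Suc j)) has_sum (exp z - 1)) UNIV"
proof (rule norm_summable_imp_has_sum)
  have "summable (\<lambda>j. norm (z ^ j /\<^sub>R fact j))" by (rule summable_norm_exp)
  then have "summable (\<lambda>j. norm (z ^ Suc j /\<^sub>R fact (Suc j)))" by (subst summable_Suc_iff)
  then show "summable (\<lambda>j. norm (z ^ Suc j / fact (Suc j)))"
    by (simp add: norm_divide divide_inverse mult.commute norm_mult norm_inverse del: fact_Suc)
  have "(\<lambda>j. z ^ j /\<^sub>R fact j) sums exp z" by (rule exp_converges)
  then have "(\<lambda>j. z ^ Suc j /\<^sub>R fact (Suc j)) sums (exp z - z ^ 0 /\<^sub>R fact 0)" by (subst sums_Suc_iff) simp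
  then show "(\<lambda>j. z ^ Suc j / fact (Suc j)) sums (exp z - 1)"
    by (simp add: scaleR_conv_of_real divide_inverse mult.commute del: fact_Suc)
qed

text \<open>
  The exponential series. The constant term 1 is kept apart because the rest is small
  when \<open>\<alpha>\<close> is small.
\<close>

lemma wiener_exp:
  assumes a: "wl1 k \<alpha>"
  obtains d where "wl1 k d" "wn k d \<le> exp (wn k \<alpha>) - 1" "\<And>x. 1 + fser d x = exp (fser \<alpha> x)"
proof -
  define T where "T = (\<lambda>j n. (1 / fact (Suc j)) * cpow \<alpha> j n)"
  have wlT: "wl1 k (T j)" for j
  proof -
    have "(\<lambda>n. (1 / fact (Suc j)) * (wt k n * norm (cpow \<alpha> j n))) summable_on UNIV"
      by (rule summable_on_cmult_right) (use wl1_cpow[OF a, of j] in \<open>simp add: wl1_def\<close>)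
    then show ?thesis by (simp add: wl1_def T_def norm_mult norm_divide mult_ac del: fact_Suc)
  qed
  have wnT: "wn k (T j) \<le> wn k \<alpha> ^ Suc j / fact (Suc j)" for j
  proof -
    have "wn k (T j) = (\<Sum>\<^sub>\<infinity>n. (1 / fact (Suc j)) * (wt k n * norm (cpow \<alpha> j n)))"
      by (simp add: wn_def T_def norm_mult norm_divide mult_ac del: fact_Suc)
    also have "\<dots> = (1 / fact (Suc j)) * wn k (cpow \<alpha> j)"
      unfolding wn_def by (rule infsum_cmult_right')
    also have "\<dots> \<le> (1 / fact (Suc j)) * wn k \<alpha> ^ Suc j"
      using wl1_cpow[OF a, of j] by (intro mult_left_mono) auto
    finally show ?thesis by simp
  qed
  note E = has_sum_exp_Suc[of "wn k \<alpha>"]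
  define d where "d = (\<lambda>n. \<Sum>\<^sub>\<infinity>j. T j n)"
  note W = wl1_infsum[of k T, OF wlT wnT has_sum_imp_summable[OF E], folded d_def]
  show ?thesis
  proof
    show "wl1 k d" by (rule W(1))
    show "wn k d \<le> exp (wn k \<alpha>) - 1" using W(2) infsumI[OF E] by simp
    fix x
    have "fser (T j) x = fser \<alpha> x ^ Suc j / fact (Suc j)" for j
      unfolding T_def fser_cmult using wl1_cpow[OF a, of j x] by simp
    then have "((\<lambda>j. fser \<alpha> x ^ Suc j / fact (Suc j)) has_sum fser d x) UNIV"
      using W(3)[of x] by simp
    then have "fser d x = exp (fser \<alpha> x) - 1" using has_sum_exp_Suc by (rule has_sum_unique)
    then show "1 + fser d x = exp (fser \<alpha> x)" by simp
  qed
qed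

section \<open>Differential polynomials in logarithmic derivatives\<close>

text \<open>
  Let \<open>G\<close> be a function of \<open>t\<close> and \<open>x\<close> and \<open>h\<^sub>j = \<partial>\<^sub>x\<^sup>j\<^sup>+\<^sup>1 G / G\<close>. Then \<open>\<partial>\<^sub>x h\<^sub>j = h\<^sub>j\<^sub>+\<^sub>1 - h\<^sub>j h\<^sub>0\<close>, so all
  derivatives of the logarithmic derivative \<open>h\<^sub>0\<close> are polynomials in the variables \<open>h\<^sub>j\<close>. Bounds and
  limits pass from the variables to the polynomials by induction. There are no constants, so
  that every polynomial is small when the variables are.
\<close>

datatype dpoly = Var nat | Add dpoly dpoly | Sub dpoly dpoly | Mul dpoly dpoly

primrec dpoly_index :: "dpoly \<Rightarrow> nat" where
  "dpoly_index (Var j) = j"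
| "dpoly_index (Add P Q) = max (dpoly_index P) (dpoly_index Q)"
| "dpoly_index (Sub P Q) = max (dpoly_index P) (dpoly_index Q)"
| "dpoly_index (Mul P Q) = max (dpoly_index P) (dpoly_index Q)"

primrec dpoly_eval :: "(nat \<Rightarrow> complex) \<Rightarrow> dpoly \<Rightarrow> complex" where
  "dpoly_eval h (Var j) = h j"
| "dpoly_eval h (Add P Q) = dpoly_eval h P + dpoly_eval h Q"
| "dpoly_eval h (Sub P Q) = dpoly_eval h P - dpoly_eval h Q"
| "dpoly_eval h (Mul P Q) = dpoly_eval h P * dpoly_eval h Q"

primrec dpoly_dx :: "dpoly \<Rightarrow> dpoly" where
  "dpoly_dx (Var j) = Sub (Var (Suc j)) (Mul (Var j) (Var 0))"
| "dpoly_dx (Add P Q) = Add (dpoly_dx P) (dpoly_dx Q)"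
| "dpoly_dx (Sub P Q) = Sub (dpoly_dx P) (dpoly_dx Q)"
| "dpoly_dx (Mul P Q) = Add (Mul (dpoly_dx P) Q) (Mul P (dpoly_dx Q))"

text \<open>
  If \<open>\<partial>\<^sub>t G = b \<partial>\<^sub>x G + c \<partial>\<^sub>x\<^sup>2 G\<close>, then \<open>\<partial>\<^sub>t h\<^sub>j = b (h\<^sub>j\<^sub>+\<^sub>1 - h\<^sub>j h\<^sub>0) + c (h\<^sub>j\<^sub>+\<^sub>2 - h\<^sub>j h\<^sub>1)\<close>, and this is the
  resulting derivation on polynomials. It is a function on values and not on
  polynomials, since \<open>b\<close> depends on time.
\<close>

primrec dpoly_dt :: "complex \<Rightarrow> complex \<Rightarrow> (nat \<Rightarrow> complex) \<Rightarrow> dpoly \<Rightarrow> complex" where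
  "dpoly_dt b c h (Var j) = b * (h (j + 1) - h j * h 0) + c * (h (j + 2) - h j * h 1)"
| "dpoly_dt b c h (Add P Q) = dpoly_dt b c h P + dpoly_dt b c h Q"
| "dpoly_dt b c h (Sub P Q) = dpoly_dt b c h P - dpoly_dt b c h Q"
| "dpoly_dt b c h (Mul P Q) = dpoly_dt b c h P * dpoly_eval h Q + dpoly_eval h P * dpoly_dt b c h Q"

lemma dpoly_index_dx: "dpoly_index (dpoly_dx P) \<le> Suc (dpoly_index P)"
  by (induction P) auto

lemma dpoly_index_dx_funpow: "dpoly_index ((dpoly_dx ^^ j) P) \<le> dpoly_index P + j"
proof (induction j)
  case (Suc j)
  then show ?case using dpoly_index_dx[of "(dpoly_dx ^^ j) P"] by simp
qed simp

lemma dpoly_eval_derivative: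
  assumes "\<And>j. j \<le> dpoly_index P \<Longrightarrow> (H j has_vector_derivative H (Suc j) x - H j x * H 0 x) (at x)"
  shows "((\<lambda>x. dpoly_eval (\<lambda>j. H j x) P) has_vector_derivative dpoly_eval (\<lambda>j. H j x) (dpoly_dx P)) (at x)"
  using assms
proof (induction P)
  case (Mul P Q)
  have "((\<lambda>x. dpoly_eval (\<lambda>j. H j x) P * dpoly_eval (\<lambda>j. H j x) Q) has_vector_derivative
     dpoly_eval (\<lambda>j. H j x) P * dpoly_eval (\<lambda>j. H j x) (dpoly_dx Q) + dpoly_eval (\<lambda>j. H j x) (dpoly_dx P) * dpoly_eval (\<lambda>j. H j x) Q) (at x)"
    by (intro has_vector_derivative_mult Mul.IH Mul.prems) auto
  then show ?case by (simp add: add.commute)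
qed (auto intro!: has_vector_derivative_add has_vector_derivative_diff)

text \<open>
  The derivations in \<open>t\<close> and \<open>x\<close> commute. For a product this is formal; for a variable it is an
  identity between polynomials.
\<close>

lemma dpoly_dt_derivative:
  assumes "\<And>j. j \<le> dpoly_index P + 2 \<Longrightarrow> (H j has_vector_derivative H (Suc j) x - H j x * H 0 x) (at x)"
  shows "((\<lambda>x. dpoly_dt b c (\<lambda>j. H j x) P) has_vector_derivative dpoly_dt b c (\<lambda>j. H j x) (dpoly_dx P)) (at x)"
  using assms
proof (induction P)
  case (Var j)
  have m: "((\<lambda>x. H i x * H k x) has_vector_derivative H i x * (H (Suc k) x - H k x * H 0 x) + (H (Suc i) x - H i x * H 0 x) * H k x) (at x)"
    if "i \<le> j + 2" "k \<le> j + 2" for i k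
    by (intro has_vector_derivative_mult Var) (use that in auto)
  have "((\<lambda>x. b * (H (j + 1) x - H j x * H 0 x) + c * (H (j + 2) x - H j x * H 1 x)) has_vector_derivative
      b * ((H (Suc (j + 1)) x - H (j + 1) x * H 0 x) - (H j x * (H (Suc 0) x - H 0 x * H 0 x) + (H (Suc j) x - H j x * H 0 x) * H 0 x))
    + c * ((H (Suc (j + 2)) x - H (j + 2) x * H 0 x) - (H j x * (H (Suc 1) x - H 1 x * H 0 x) + (H (Suc j) x - H j x * H 0 x) * H 1 x))) (at x)"
    by (intro has_vector_derivative_add has_vector_derivative_diff has_vector_derivative_mult_right m Var) auto
  then show ?case by (simp add: algebra_simps numeral_2_eq_2)
next
  case (Mul P Q)
  have e: "((\<lambda>x. dpoly_eval (\<lambda>j. H j x) R) has_vector_derivative dpoly_eval (\<lambda>j. H j x) (dpoly_dx R)) (at x)"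
    if "dpoly_index R \<le> dpoly_index (Mul P Q)" for R
    by (rule dpoly_eval_derivative) (use that Mul.prems in auto)
  have "((\<lambda>x. dpoly_dt b c (\<lambda>j. H j x) P * dpoly_eval (\<lambda>j. H j x) Q + dpoly_eval (\<lambda>j. H j x) P * dpoly_dt b c (\<lambda>j. H j x) Q) has_vector_derivative
     (dpoly_dt b c (\<lambda>j. H j x) P * dpoly_eval (\<lambda>j. H j x) (dpoly_dx Q) + dpoly_dt b c (\<lambda>j. H j x) (dpoly_dx P) * dpoly_eval (\<lambda>j. H j x) Q)
   + (dpoly_eval (\<lambda>j. H j x) P * dpoly_dt b c (\<lambda>j. H j x) (dpoly_dx Q) + dpoly_eval (\<lambda>j. H j x) (dpoly_dx P) * dpoly_dt b c (\<lambda>j. H j x) Q)) (at x)"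
    by (intro has_vector_derivative_add has_vector_derivative_mult Mul.IH e Mul.prems) auto
  then show ?case by (simp add: algebra_simps)
qed (auto intro!: has_vector_derivative_add has_vector_derivative_diff)

lemma dpoly_eval_continuous:
  assumes "\<And>j. j \<le> dpoly_index P \<Longrightarrow> continuous_on UNIV (H j)"
  shows "continuous_on UNIV (\<lambda>x. dpoly_eval (\<lambda>j. H j x) P)"
  using assms by (induction P) (auto intro!: continuous_intros)

lemma dpoly_dt_continuous:
  assumes "\<And>j. j \<le> dpoly_index P + 2 \<Longrightarrow> continuous_on UNIV (H j)"
  shows "continuous_on UNIV (\<lambda>x. dpoly_dt b c (\<lambda>j. H j x) P)"
  using assms
proof (induction P)
  case (Mul P Q)
  then show ?case by (auto intro!: continuous_intros dpoly_eval_continuous)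
qed (auto intro!: continuous_intros)

text \<open>
  The factor 2 for products accounts for \<open>Im (z w) = Re z Im w + Im z Re w\<close>, so that one constant
  serves for the size of a polynomial and for its imaginary part.
\<close>

primrec dpoly_bound :: "real \<Rightarrow> dpoly \<Rightarrow> real" where
  "dpoly_bound B (Var j) = B"
| "dpoly_bound B (Add P Q) = dpoly_bound B P + dpoly_bound B Q"
| "dpoly_bound B (Sub P Q) = dpoly_bound B P + dpoly_bound B Q"
| "dpoly_bound B (Mul P Q) = 2 * dpoly_bound B P * dpoly_bound B Q"

lemma dpoly_bound_nonneg: "0 \<le> B \<Longrightarrow> 0 \<le> dpoly_bound B P"
  by (induction P) auto

lemma dpoly_eval_bound:
  assumes B: "0 \<le> B" and \<rho>: "0 \<le> \<rho>" "\<rho> \<le> 1" and h: "\<And>j. j \<le> dpoly_index P \<Longrightarrow> norm (h j) \<le> B * \<rho>"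
  shows "norm (dpoly_eval h P) \<le> dpoly_bound B P * \<rho>"
  using h
proof (induction P)
  case (Add P Q)
  have "norm (dpoly_eval h P + dpoly_eval h Q) \<le> dpoly_bound B P * \<rho> + dpoly_bound B Q * \<rho>"
    by (intro norm_triangle_le add_mono Add) (use Add.prems in auto)
  then show ?case by (simp add: algebra_simps)
next
  case (Sub P Q)
  have "norm (dpoly_eval h P - dpoly_eval h Q) \<le> dpoly_bound B P * \<rho> + dpoly_bound B Q * \<rho>"
    by (intro norm_triangle_le_diff add_mono Sub) (use Sub.prems in auto)
  then show ?case by (simp add: algebra_simps)
next
  case (Mul P Q)
  have b: "0 \<le> dpoly_bound B P" "0 \<le> dpoly_bound B Q" by (rule dpoly_bound_nonneg[OF B])+
  have "norm (dpoly_eval h P * dpoly_eval h Q) \<le> (dpoly_bound B P * \<rho>) * (dpoly_bound B Q * \<rho>)"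
    unfolding norm_mult by (intro mult_mono Mul) (use Mul.prems b \<rho> in auto)
  also have "\<dots> = (dpoly_bound B P * dpoly_bound B Q * \<rho>) * \<rho>" by simp
  also have "\<dots> \<le> (dpoly_bound B P * dpoly_bound B Q * \<rho>) * 1" using b \<rho> by (intro mult_left_mono) auto
  also have "\<dots> \<le> dpoly_bound B (Mul P Q) * \<rho>" using b \<rho> by simp
  finally show ?case by simp
qed (use assms in auto)

text \<open>
  An imaginary part of relative size \<open>t\<close> in the variables has relative size \<open>t\<close> in the polynomials,
  because they have real coefficients.
\<close>

lemma dpoly_eval_Im_bound:
  assumes B: "0 \<le> B" and \<rho>: "0 \<le> \<rho>" "\<rho> \<le> 1" and t: "0 \<le> t"
    and h: "\<And>j. j \<le> dpoly_index P \<Longrightarrow> norm (h j) \<le> B * \<rho>"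
    and im: "\<And>j. j \<le> dpoly_index P \<Longrightarrow> \<bar>Im (h j)\<bar> \<le> B * \<rho> * t"
  shows "\<bar>Im (dpoly_eval h P)\<bar> \<le> dpoly_bound B P * \<rho> * t"
  using h im
proof (induction P)
  case (Add P Q)
  have "\<bar>Im (dpoly_eval h P)\<bar> \<le> dpoly_bound B P * \<rho> * t" "\<bar>Im (dpoly_eval h Q)\<bar> \<le> dpoly_bound B Q * \<rho> * t"
    by (intro Add; use Add.prems in auto)+
  then show ?case by (simp add: distrib_right)
next
  case (Sub P Q)
  have "\<bar>Im (dpoly_eval h P)\<bar> \<le> dpoly_bound B P * \<rho> * t" "\<bar>Im (dpoly_eval h Q)\<bar> \<le> dpoly_bound B Q * \<rho> * t"
    by (intro Sub; use Sub.prems in auto)+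
  then show ?case by (simp add: distrib_right)
next
  case (Mul P Q)
  let ?p = "dpoly_eval h P" and ?q = "dpoly_eval h Q" and ?b = "dpoly_bound B P" and ?c = "dpoly_bound B Q"
  have b: "0 \<le> ?b" "0 \<le> ?c" by (rule dpoly_bound_nonneg[OF B])+
  have i: "\<bar>Im ?p\<bar> \<le> ?b * \<rho> * t" "\<bar>Im ?q\<bar> \<le> ?c * \<rho> * t"
    by (intro Mul; use Mul.prems in auto)+
  have "norm ?p \<le> ?b * \<rho>" "norm ?q \<le> ?c * \<rho>"
    by (intro dpoly_eval_bound B \<rho>; use Mul.prems in auto)+
  moreover have "?b * \<rho> \<le> ?b" "?c * \<rho> \<le> ?c" using b \<rho> by (auto intro: mult_left_le)
  ultimately have r: "\<bar>Re ?p\<bar> \<le> ?b" "\<bar>Re ?q\<bar> \<le> ?c"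
    using abs_Re_le_cmod[of ?p] abs_Re_le_cmod[of ?q] by linarith+
  have "\<bar>Im (?p * ?q)\<bar> \<le> \<bar>Re ?p\<bar> * \<bar>Im ?q\<bar> + \<bar>Im ?p\<bar> * \<bar>Re ?q\<bar>"
    by (simp add: abs_mult[symmetric])
  also have "\<dots> \<le> ?b * (?c * \<rho> * t) + (?b * \<rho> * t) * ?c"
    by (intro add_mono mult_mono i r) (use b \<rho> t in auto)
  finally show ?case by (simp add: algebra_simps)
qed simp

lemma bounded_range_mult:
  fixes f g :: "'b \<Rightarrow> complex"
  assumes "bounded (range f)" "bounded (range g)"
  shows "bounded (range (\<lambda>x. f x * g x))"
proof -
  obtain a b where "\<And>x. norm (f x) \<le> a" "\<And>x. norm (g x) \<le> b"
    using assms by (auto simp: bounded_iff)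
  then have "norm (f x * g x) \<le> a * b" for x
    unfolding norm_mult by (intro mult_mono) (auto intro: order_trans[OF norm_ge_zero])
  then show ?thesis by (auto simp: bounded_iff)
qed

lemma dpoly_eval_bounded_range:
  assumes "\<And>j. j \<le> dpoly_index P \<Longrightarrow> bounded (range (H j))"
  shows "bounded (range (\<lambda>x. dpoly_eval (\<lambda>j. H j x) P))"
  using assms
  by (induction P) (auto intro!: bounded_plus_comp bounded_minus_comp bounded_range_mult)

lemma dpoly_eval_uniform_limit:
  assumes "\<And>j. j \<le> dpoly_index P \<Longrightarrow> uniform_limit UNIV (\<lambda>r. H r j) (L j) F"
    and "\<And>j. j \<le> dpoly_index P \<Longrightarrow> bounded (range (L j))"
  shows "uniform_limit UNIV (\<lambda>r x. dpoly_eval (\<lambda>j. H r j x) P) (\<lambda>x. dpoly_eval (\<lambda>j. L j x) P) F"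
  using assms
proof (induction P)
  case (Mul P Q)
  have "uniform_limit UNIV (\<lambda>r x. dpoly_eval (\<lambda>j. H r j x) P * dpoly_eval (\<lambda>j. H r j x) Q)
     (\<lambda>x. dpoly_eval (\<lambda>j. L j x) P * dpoly_eval (\<lambda>j. L j x) Q) F"
    by (intro uniform_lim_mult Mul.IH Mul.prems dpoly_eval_bounded_range) auto
  then show ?case by simp
qed (auto intro!: uniform_limit_add uniform_limit_minus)

lemma dpoly_dt_bounded_range:
  assumes "\<And>j. j \<le> dpoly_index P + 2 \<Longrightarrow> bounded (range (H j))"
  shows "bounded (range (\<lambda>x. dpoly_dt b c (\<lambda>j. H j x) P))"
  using assms
proof (induction P)
  case (Var j)
  have k: "bounded (range (\<lambda>x. k))" for k :: complex by (auto simp: bounded_iff)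
  show ?case unfolding dpoly_dt.simps
    by (intro bounded_plus_comp bounded_minus_comp bounded_range_mult k Var) auto
next
  case (Mul P Q)
  show ?case unfolding dpoly_dt.simps
    by (intro bounded_plus_comp bounded_range_mult Mul.IH dpoly_eval_bounded_range Mul.prems) auto
qed (auto intro!: bounded_plus_comp bounded_minus_comp)

lemma dpoly_dt_uniform_limit:
  assumes UL: "\<And>j. j \<le> dpoly_index P \<Longrightarrow> uniform_limit UNIV (\<lambda>r. H r j) (H t j) F"
    and UD: "\<And>j. j \<le> dpoly_index P \<Longrightarrow> uniform_limit UNIV (\<lambda>r x. (H r j x - H t j x) /\<^sub>R (r - t))
       (\<lambda>x. dpoly_dt b c (\<lambda>j. H t j x) (Var j)) F"
    and B: "\<And>j. j \<le> dpoly_index P + 2 \<Longrightarrow> bounded (range (H t j))"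
  shows "uniform_limit UNIV (\<lambda>r x. (dpoly_eval (\<lambda>j. H r j x) P - dpoly_eval (\<lambda>j. H t j x) P) /\<^sub>R (r - t))
       (\<lambda>x. dpoly_dt b c (\<lambda>j. H t j x) P) F"
  using assms
proof (induction P)
  case (Var j)
  then show ?case by simp
next
  case (Add P Q)
  have "uniform_limit UNIV
     (\<lambda>r x. (dpoly_eval (\<lambda>j. H r j x) P - dpoly_eval (\<lambda>j. H t j x) P) /\<^sub>R (r - t)
        + (dpoly_eval (\<lambda>j. H r j x) Q - dpoly_eval (\<lambda>j. H t j x) Q) /\<^sub>R (r - t))
     (\<lambda>x. dpoly_dt b c (\<lambda>j. H t j x) P + dpoly_dt b c (\<lambda>j. H t j x) Q) F"
    by (intro uniform_limit_add Add.IH Add.prems) auto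
  then show ?case by (simp add: algebra_simps)
next
  case (Sub P Q)
  have "uniform_limit UNIV
     (\<lambda>r x. (dpoly_eval (\<lambda>j. H r j x) P - dpoly_eval (\<lambda>j. H t j x) P) /\<^sub>R (r - t)
        - (dpoly_eval (\<lambda>j. H r j x) Q - dpoly_eval (\<lambda>j. H t j x) Q) /\<^sub>R (r - t))
     (\<lambda>x. dpoly_dt b c (\<lambda>j. H t j x) P - dpoly_dt b c (\<lambda>j. H t j x) Q) F"
    by (intro uniform_limit_minus Sub.IH Sub.prems) auto
  then show ?case by (simp add: algebra_simps)
next
  case (Mul P Q)
  let ?e = "\<lambda>r P x. dpoly_eval (\<lambda>j. H r j x) P"
  have "uniform_limit UNIV
     (\<lambda>r x. ((?e r P x - ?e t P x) /\<^sub>R (r - t)) * ?e r Q x + ?e t P x * ((?e r Q x - ?e t Q x) /\<^sub>R (r - t)))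
     (\<lambda>x. dpoly_dt b c (\<lambda>j. H t j x) P * ?e t Q x + ?e t P x * dpoly_dt b c (\<lambda>j. H t j x) Q) F"
    by (intro uniform_limit_add uniform_lim_mult uniform_limit_const Mul.IH Mul.prems
        dpoly_eval_uniform_limit dpoly_eval_bounded_range dpoly_dt_bounded_range) auto
  moreover have "((?e r P x - ?e t P x) /\<^sub>R (r - t)) * ?e r Q x + ?e t P x * ((?e r Q x - ?e t Q x) /\<^sub>R (r - t))
     = (?e r (Mul P Q) x - ?e t (Mul P Q) x) /\<^sub>R (r - t)" for r x
    by (simp add: scaleR_conv_of_real algebra_simps)
  ultimately show ?case by simp
qed

section \<open>The linear advection-diffusion equation\<close>

lemma norm_exp_diff_exp_minus: "\<bar>exp a - exp (- a)\<bar> \<le> 2 * \<bar>a\<bar> * exp \<bar>a\<bar>" for a :: real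
proof -
  have *: "exp a - exp (- a) \<le> 2 * a * exp a \<and> 0 \<le> exp a - exp (- a)" if "a \<ge> 0" for a :: real
  proof -
    have "1 - 2 * a \<le> exp (- (2 * a))" using exp_ge_add_one_self[of "- (2 * a)"] by simp
    then have "exp a * (1 - 2 * a) \<le> exp a * exp (- (2 * a))" by (rule mult_left_mono) simp
    also have "exp a * exp (- (2 * a)) = exp (- a)" by (simp add: exp_add[symmetric])
    finally show ?thesis using that by (simp add: algebra_simps)
  qed
  show ?thesis using *[of a] *[of "- a"] by (cases "a \<ge> 0") (auto simp: abs_if)
qed

lemma mult_exp_minus_le_1: "x * exp (- x) \<le> 1" for x :: real
proof -
  have "x \<le> exp x" using exp_ge_add_one_self[of x] by linarith
  then have "x * exp (- x) \<le> exp x * exp (- x)" by (rule mult_right_mono) simp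
  then show ?thesis by (simp add: exp_minus)
qed

text \<open>
  \<open>c = \<delta>\<^sub>0 + d\<close> are the Fourier coefficients of the Cole-Hopf transform of the initial datum. It is close
  to 1 (\<open>\<sigma> \<le> 1/2\<close>) and real (\<open>sym\<close>). Time is the unscaled time \<open>t \<in> [0, T]\<close> and the space variable is
  \<open>z = N x\<close> with \<open>N = k0/\<epsilon>\<close>, in which functions are 1-periodic.
\<close>

locale cole_hopf =
  fixes s k0 N :: nat and abar T \<sigma> :: real and d :: "int \<Rightarrow> complex"
  assumes s: "s \<ge> 2" and k0: "k0 \<ge> 1" and N: "N \<ge> 1" and T: "0 < T" "T < 2 * pi * real k0"
    and d: "wl1 (Suc s) d" "wn (Suc s) d \<le> \<sigma>" and \<sigma>: "\<sigma> \<le> 1 / 2"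
    and sym: "\<And>n. cnj (d (- n)) = d n"
begin

definition A :: real where "A = (2 * pi) ^ Suc s"

definition c :: "int \<Rightarrow> complex" where "c n = (if n = 0 then 1 else 0) + d n"

definition rate :: "int \<Rightarrow> real \<Rightarrow> complex" where
  "rate n t = of_nat N * (- 2 * pi * \<i> * of_int n * abar + 2 * pi * of_int n * t - 4 * pi\<^sup>2 * (of_int n)\<^sup>2 * of_nat k0)"

text \<open>
  The evolution of the mode \<open>exp (2 pi \<i> n z)\<close> under \<open>\<partial>\<^sub>t G + N (abar + \<i> t) \<partial>\<^sub>z G = k0 N \<partial>\<^sub>z\<^sup>2 G\<close>: advection with
  the complex velocity \<open>abar + \<i> t\<close> makes a mode grow or decay; \<open>rate\<close> is the logarithmic derivative.
\<close>

definition \<mu> :: "int \<Rightarrow> real \<Rightarrow> complex" where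
  "\<mu> n t = exp (of_nat N * (- 2 * pi * \<i> * of_int n * abar * t + pi * of_int n * t\<^sup>2 - 4 * pi\<^sup>2 * (of_int n)\<^sup>2 * of_nat k0 * t))"

text \<open>
  The Fourier coefficients of \<open>\<partial>\<^sub>z\<^sup>j G\<close> at time \<open>t\<close>.
\<close>

definition \<gamma> :: "nat \<Rightarrow> real \<Rightarrow> int \<Rightarrow> complex" where
  "\<gamma> j t n = (2 * pi * \<i> * of_int n) ^ j * (c n * \<mu> n t)"

definition G :: "nat \<Rightarrow> real \<Rightarrow> real \<Rightarrow> complex" where
  "G j t = fser (\<gamma> j t)"

definition h :: "real \<Rightarrow> nat \<Rightarrow> real \<Rightarrow> complex" where
  "h t j x = G (Suc j) t x / G 0 t x"

lemma \<sigma>_nonneg: "0 \<le> \<sigma>" using d(2) wn_nonneg[of "Suc s" d] by linarith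

lemma A_ge_1: "1 \<le> A"
proof -
  have "1 \<le> 2 * pi" using pi_ge_two by linarith
  then show ?thesis unfolding A_def by (rule one_le_power)
qed

lemma int_abs_le_square: "\<bar>real_of_int n\<bar> \<le> (real_of_int n)\<^sup>2"
proof (cases "n = 0")
  case False
  then have "1 \<le> \<bar>real_of_int n\<bar>" by linarith
  then have "\<bar>real_of_int n\<bar> * 1 \<le> \<bar>real_of_int n\<bar> * \<bar>real_of_int n\<bar>" by (rule mult_left_mono) simp
  then show ?thesis by (simp only: power2_eq_square abs_mult_self_eq mult_1_right)
qed simp

lemma \<mu>_0 [simp]: "\<mu> 0 t = 1" by (simp add: \<mu>_def)

lemma \<mu>_init [simp]: "\<mu> n 0 = 1" by (simp add: \<mu>_def)

text \<open>
  The modulus is \<open>exp (pi n N t (t - 4 pi n k0))\<close>, and \<open>t < 2 pi k0\<close>: on the whole time interval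
  diffusion outweighs the growth caused by the imaginary part of the velocity.
\<close>

lemma norm_\<mu>:
  assumes "t \<in> {0..T}" shows "norm (\<mu> n t) \<le> 1"
proof -
  have e: "norm (\<mu> n t) = exp (real N * (pi * t * (of_int n * t - 4 * pi * (of_int n)\<^sup>2 * real k0)))"
    by (simp add: \<mu>_def norm_exp_eq_Re power2_eq_square algebra_simps)
  have "of_int n * t \<le> \<bar>of_int n\<bar> * t" using assms by (intro mult_right_mono) auto
  also have "\<dots> \<le> \<bar>of_int n\<bar> * (2 * pi * real k0)" using assms T by (intro mult_left_mono) auto
  also have "\<dots> \<le> (of_int n)\<^sup>2 * (2 * pi * real k0)" by (intro mult_right_mono int_abs_le_square) simp
  also have "\<dots> \<le> 4 * pi * (of_int n)\<^sup>2 * real k0" by simp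
  finally have "of_int n * t - 4 * pi * (of_int n)\<^sup>2 * real k0 \<le> 0" by simp
  then have "pi * t * (of_int n * t - 4 * pi * (of_int n)\<^sup>2 * real k0) \<le> 0"
    using assms by (intro mult_nonneg_nonpos) auto
  then show ?thesis unfolding e by (simp add: mult_nonneg_nonpos)
qed

lemma \<mu>_deriv: "(\<mu> n has_vector_derivative rate n t * \<mu> n t) (at t within S)"
proof -
  \<comment> \<open>Differentiate the entire function of a complex variable that extends the multiplier.\<close>
  define E where "E = (\<lambda>z::complex. exp (of_nat N * (- 2 * pi * \<i> * of_int n * abar * z + pi * of_int n * z\<^sup>2 - 4 * pi\<^sup>2 * (of_int n)\<^sup>2 * of_nat k0 * z)))"
  have "(E has_field_derivative rate n t * E (of_real t)) (at (of_real t))"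
    unfolding E_def rate_def by (auto intro!: derivative_eq_intros simp: algebra_simps)
  from has_vector_derivative_real_field[OF this]
  have "((\<lambda>t. E (of_real t)) has_vector_derivative rate n t * E (of_real t)) (at t)" .
  moreover have "(\<lambda>t. E (of_real t)) = \<mu> n" by (simp add: E_def \<mu>_def fun_eq_iff)
  ultimately have "(\<mu> n has_vector_derivative rate n t * \<mu> n t) (at t)" by (metis (mono_tags))
  then show ?thesis by (rule has_vector_derivative_at_within)
qed

definition L :: real where "L = real N * (2 * pi * \<bar>abar\<bar> + 2 * pi * T + 4 * pi\<^sup>2 * real k0)"

lemma L_nonneg: "0 \<le> L" using T unfolding L_def by (intro mult_nonneg_nonneg add_nonneg_nonneg) auto

lemma norm_rate:
  assumes "t \<in> {0..T}" shows "norm (rate n t) \<le> L * (of_int n)\<^sup>2"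
proof -
  let ?n = "real_of_int n"
  have "norm (rate n t) \<le> real N * (2 * pi * \<bar>?n\<bar> * \<bar>abar\<bar> + 2 * pi * \<bar>?n\<bar> * t + 4 * pi\<^sup>2 * ?n\<^sup>2 * real k0)"
  proof -
    have "norm (- 2 * pi * \<i> * of_int n * abar + 2 * pi * of_int n * t - 4 * pi\<^sup>2 * (of_int n)\<^sup>2 * of_nat k0 :: complex)
      \<le> norm (- 2 * pi * \<i> * of_int n * abar :: complex) + norm (2 * pi * of_int n * t :: complex) + norm (4 * pi\<^sup>2 * (of_int n)\<^sup>2 * of_nat k0 :: complex)"
      by (meson add_right_mono norm_triangle_ineq norm_triangle_ineq4 order_trans)
    also have "\<dots> = 2 * pi * \<bar>?n\<bar> * \<bar>abar\<bar> + 2 * pi * \<bar>?n\<bar> * t + 4 * pi\<^sup>2 * ?n\<^sup>2 * real k0"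
      using assms by (simp add: norm_mult norm_power)
    finally show ?thesis unfolding rate_def norm_mult by (simp add: mult_left_mono)
  qed
  also have "\<dots> \<le> real N * (2 * pi * ?n\<^sup>2 * \<bar>abar\<bar> + 2 * pi * ?n\<^sup>2 * T + 4 * pi\<^sup>2 * ?n\<^sup>2 * real k0)"
    using assms int_abs_le_square[of n] by (intro mult_left_mono add_mono mult_mono) auto
  also have "\<dots> = L * ?n\<^sup>2" by (simp add: L_def algebra_simps)
  finally show ?thesis .
qed

text \<open>
  The quadratic growth in \<open>n\<close> costs two space derivatives; it dominates the difference quotients in
  time.
\<close>

lemma \<mu>_lipschitz:
  assumes "r \<in> {0..T}" "t \<in> {0..T}"
  shows "norm (\<mu> n r - \<mu> n t) \<le> L * (of_int n)\<^sup>2 * \<bar>r - t\<bar>"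
proof -
  have "norm (\<mu> n r - \<mu> n t) \<le> L * (of_int n)\<^sup>2 * norm (r - t)"
  proof (rule differentiable_bound[where S = "{0..T}" and f' = "\<lambda>x h. h *\<^sub>R (rate n x * \<mu> n x)"])
    show "(\<mu> n has_derivative (\<lambda>h. h *\<^sub>R (rate n x * \<mu> n x))) (at x within {0..T})" for x
      using \<mu>_deriv by (simp add: has_vector_derivative_def)
    show "onorm (\<lambda>h. h *\<^sub>R (rate n x * \<mu> n x)) \<le> L * (of_int n)\<^sup>2" if "x \<in> {0..T}" for x
    proof (rule onorm_bound)
      show "0 \<le> L * (of_int n)\<^sup>2" using L_nonneg by simp
      fix h :: real
      have "norm (rate n x) * norm (\<mu> n x) \<le> (L * (of_int n)\<^sup>2) * 1"
        by (intro mult_mono norm_rate norm_\<mu> that) (use L_nonneg in auto)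
      then show "norm (h *\<^sub>R (rate n x * \<mu> n x)) \<le> L * (of_int n)\<^sup>2 * norm h"
        by (simp add: norm_mult mult.commute mult_left_mono)
    qed
  qed (use assms in auto)
  then show ?thesis by simp
qed

text \<open>
  The two multipliers differ by \<open>exp (-2 X) (exp a - exp (-a))\<close> with \<open>|a| = pi |n| N t\<^sup>2\<close> and
  \<open>X = 2 pi\<^sup>2 n\<^sup>2 k0 N t\<close>. For \<open>t < 2 pi k0\<close> one has \<open>|a| \<le> X\<close>, so the difference is at most
  \<open>2 |a| exp (-X) \<le> t X exp (-X) \<le> t\<close>: parabolic decay pays for the large factor \<open>n N\<close>, uniformly in \<open>\<epsilon>\<close>.
\<close>

lemma norm_\<mu>_conj_diff:
  assumes "t \<in> {0..T}" "n \<noteq> 0"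
  shows "norm (\<mu> n t - cnj (\<mu> (- n) t)) \<le> t"
proof -
  define a where "a = real N * (pi * of_int n * t\<^sup>2)"
  define X where "X = 2 * pi\<^sup>2 * (of_int n)\<^sup>2 * real k0 * real N * t"
  define \<theta> where "\<theta> = - real N * (2 * pi * of_int n * abar * t)"
  have n1: "1 \<le> \<bar>real_of_int n\<bar>" using assms(2) by linarith
  have m1: "\<mu> n t = of_real (exp (- 2 * X)) * cis \<theta> * of_real (exp a)"
    unfolding \<mu>_def cis_conv_exp exp_of_real[symmetric] exp_add[symmetric]
    by (rule arg_cong[of _ _ exp]) (simp add: a_def X_def \<theta>_def algebra_simps)
  have m2: "cnj (\<mu> (- n) t) = of_real (exp (- 2 * X)) * cis \<theta> * of_real (exp (- a))"
    unfolding \<mu>_def cis_conv_exp exp_of_real[symmetric] exp_add[symmetric] exp_cnj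
    by (rule arg_cong[of _ _ exp]) (simp add: a_def X_def \<theta>_def algebra_simps)
  have "norm (\<mu> n t - cnj (\<mu> (- n) t)) = norm (of_real (exp (- 2 * X)) * cis \<theta> * of_real (exp a - exp (- a)) :: complex)"
    unfolding m1 m2 by (simp add: algebra_simps)
  also have "\<dots> = exp (- 2 * X) * \<bar>exp a - exp (- a)\<bar>" by (simp only: norm_mult norm_cis norm_of_real) simp
  also have "\<dots> \<le> exp (- 2 * X) * (2 * \<bar>a\<bar> * exp \<bar>a\<bar>)"
    by (intro mult_left_mono norm_exp_diff_exp_minus) simp
  also have "\<dots> = 2 * \<bar>a\<bar> * exp (\<bar>a\<bar> - 2 * X)" by (simp add: exp_diff exp_minus field_simps)
  also have "\<dots> \<le> 2 * \<bar>a\<bar> * exp (- X)"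
  proof -
    have "\<bar>a\<bar> = real N * pi * t * (\<bar>of_int n\<bar> * t)"
      using assms(1) by (simp add: a_def abs_mult power2_eq_square)
    also have "\<dots> \<le> real N * pi * t * ((of_int n)\<^sup>2 * (2 * pi * real k0))"
      using assms(1) T int_abs_le_square[of n] by (intro mult_left_mono mult_mono) auto
    also have "\<dots> = X" by (simp add: X_def power2_eq_square)
    finally show ?thesis by (intro mult_left_mono) auto
  qed
  also have "\<dots> \<le> (t * X) * exp (- X)"
  proof (intro mult_right_mono)
    have "1 * 1 \<le> pi * real k0" using k0 pi_ge_two by (intro mult_mono) auto
    then have "2 * \<bar>a\<bar> * 1 \<le> 2 * \<bar>a\<bar> * (pi * real k0 * \<bar>of_int n\<bar>)"
      using n1 by (intro mult_left_mono) (auto intro: order_trans[OF _ mult_mono[of 1 "pi * real k0" 1]])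
    also have "\<dots> = t * X"
      using assms(1) by (simp add: a_def X_def abs_mult power2_eq_square)
    finally show "2 * \<bar>a\<bar> \<le> t * X" by simp
  qed simp
  also have "\<dots> \<le> t * 1" using mult_exp_minus_le_1[of X] assms(1) by (simp add: mult.assoc mult_left_le)
  finally show ?thesis by simp
qed

lemma weight_le:
  assumes "j \<le> Suc s"
  shows "(2 * pi * \<bar>of_int n\<bar>) ^ j \<le> A * wt (Suc s) n"
proof -
  have "(2 * pi * \<bar>of_int n\<bar>) ^ j \<le> (2 * pi * (1 + \<bar>of_int n\<bar>)) ^ j" by (intro power_mono) auto
  also have "\<dots> \<le> (2 * pi * (1 + \<bar>of_int n\<bar>)) ^ Suc s"
  proof (rule power_increasing[OF assms])
    have "1 * 1 \<le> (2 * pi) * (1 + \<bar>of_int n\<bar>)" using pi_ge_two by (intro mult_mono) auto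
    then show "1 \<le> 2 * pi * (1 + \<bar>of_int n\<bar>)" by simp
  qed
  also have "\<dots> = A * wt (Suc s) n" unfolding A_def wt_def by (rule power_mult_distrib)
  finally show ?thesis .
qed

lemma d_summable:
  assumes "j \<le> Suc s"
  shows "(\<lambda>n. (2 * pi * \<bar>of_int n\<bar>) ^ j * norm (d n)) summable_on UNIV"
    and "(\<Sum>\<^sub>\<infinity>n. (2 * pi * \<bar>of_int n\<bar>) ^ j * norm (d n)) \<le> A * \<sigma>"
proof -
  have le: "(2 * pi * \<bar>of_int n\<bar>) ^ j * norm (d n) \<le> A * (wt (Suc s) n * norm (d n))" for n
    using mult_right_mono[OF weight_le[OF assms, of n], of "norm (d n)"] by simp
  have s1: "(\<lambda>n. A * (wt (Suc s) n * norm (d n))) summable_on UNIV"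
    using d(1) by (intro summable_on_cmult_right) (simp add: wl1_def)
  show s2: "(\<lambda>n. (2 * pi * \<bar>of_int n\<bar>) ^ j * norm (d n)) summable_on UNIV"
    by (rule summable_on_comparison_test[OF s1]) (use le in auto)
  have "(\<Sum>\<^sub>\<infinity>n. (2 * pi * \<bar>of_int n\<bar>) ^ j * norm (d n)) \<le> (\<Sum>\<^sub>\<infinity>n. A * (wt (Suc s) n * norm (d n)))"
    by (rule infsum_mono[OF s2 s1 le])
  also have "\<dots> = A * wn (Suc s) d" by (simp add: infsum_cmult_right' wn_def)
  also have "\<dots> \<le> A * \<sigma>" using d(2) A_ge_1 by (intro mult_left_mono) auto
  finally show "(\<Sum>\<^sub>\<infinity>n. (2 * pi * \<bar>of_int n\<bar>) ^ j * norm (d n)) \<le> A * \<sigma>" .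
qed

lemma c_summable:
  assumes "j \<le> Suc s"
  shows "(\<lambda>n. (2 * pi * \<bar>of_int n\<bar>) ^ j * norm (c n)) summable_on UNIV"
proof (rule summable_on_comparison_test)
  have "(\<lambda>n::int. if n = 0 then 1 else 0 :: real) summable_on UNIV"
    by (rule finite_nonzero_values_imp_summable_on) (rule finite_subset[of _ "{0}"], auto)
  then show "(\<lambda>n::int. (if n = 0 then 1 else 0) + (2 * pi * \<bar>of_int n\<bar>) ^ j * norm (d n)) summable_on UNIV"
    by (rule summable_on_add[OF _ d_summable(1)[OF assms]])
  fix n :: int
  show "(2 * pi * \<bar>of_int n\<bar>) ^ j * norm (c n) \<le> (if n = 0 then 1 else 0) + (2 * pi * \<bar>of_int n\<bar>) ^ j * norm (d n)"
    using norm_triangle_ineq[of 1 "d 0"] by (cases "j = 0") (auto simp: c_def power_0_left)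
qed auto

lemma norm_\<gamma>: "norm (\<gamma> j t n) = (2 * pi * \<bar>of_int n\<bar>) ^ j * norm (c n) * norm (\<mu> n t)"
  by (simp add: \<gamma>_def norm_mult norm_power)

lemma norm_\<gamma>_le: "t \<in> {0..T} \<Longrightarrow> norm (\<gamma> j t n) \<le> (2 * pi * \<bar>of_int n\<bar>) ^ j * norm (c n)"
  unfolding norm_\<gamma> using norm_\<mu>[of t n] by (intro mult_left_le) auto

lemma l1_\<gamma>: "j \<le> Suc s \<Longrightarrow> t \<in> {0..T} \<Longrightarrow> l1 (\<gamma> j t)"
  by (rule l1_mono[OF c_summable norm_\<gamma>_le])

lemma dcoef_\<gamma>: "dcoef (\<gamma> j t) = \<gamma> (Suc j) t"
  by (simp add: dcoef_def \<gamma>_def fun_eq_iff mult_ac)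

lemma G_deriv:
  "j \<le> s \<Longrightarrow> t \<in> {0..T} \<Longrightarrow> (G j t has_vector_derivative G (Suc j) t x) (at x)"
  unfolding G_def using fser_has_vector_derivative[of "\<gamma> j t" x] l1_\<gamma>[of j t] l1_\<gamma>[of "Suc j" t]
  by (simp add: dcoef_\<gamma>)

lemma G_continuous: "j \<le> Suc s \<Longrightarrow> t \<in> {0..T} \<Longrightarrow> continuous_on UNIV (G j t)"
  unfolding G_def by (intro fser_continuous l1_\<gamma>)

lemma G_periodic: "periodic1 (G j t)"
  unfolding G_def by (rule fser_periodic)

text \<open>
  All multipliers have modulus at most 1 and the mode \<open>n = 0\<close> is constant in time, so
  smallness of \<open>d\<close> is preserved and \<open>G\<close> has no zeros.
\<close>

lemma G0_near_1:
  assumes t: "t \<in> {0..T}" shows "norm (G 0 t x - 1) \<le> \<sigma>"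
proof -
  have d1: "norm (d n * \<mu> n t) \<le> norm (d n)" for n
    using norm_\<mu>[OF t, of n] by (simp add: norm_mult mult_left_le)
  have ld: "l1 (\<lambda>n. d n * \<mu> n t)" by (rule l1_mono'[OF wl1_l1[OF d(1)] d1])
  have "\<gamma> 0 t = (\<lambda>n. (if n = 0 then 1 else 0) + d n * \<mu> n t)"
    by (auto simp: \<gamma>_def c_def fun_eq_iff)
  then have "G 0 t x - 1 = fser (\<lambda>n. d n * \<mu> n t) x"
    unfolding G_def by (simp add: fser_add[OF l1_delta ld] fser_delta)
  also have "norm \<dots> \<le> (\<Sum>\<^sub>\<infinity>n. norm (d n * \<mu> n t))" by (rule norm_fser_le[OF ld])
  also have "\<dots> \<le> wn (Suc s) d" unfolding wn_def
  proof (rule infsum_mono)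
    show "(\<lambda>n. norm (d n * \<mu> n t)) summable_on UNIV" using ld by (simp add: l1_def)
    show "(\<lambda>n. wt (Suc s) n * norm (d n)) summable_on UNIV" using d(1) by (simp add: wl1_def)
    show "norm (d n * \<mu> n t) \<le> wt (Suc s) n * norm (d n)" for n
      using d1[of n] mult_right_mono[OF wt_ge_1[of "Suc s" n], of "norm (d n)"] by simp
  qed
  also have "\<dots> \<le> \<sigma>" by (rule d(2))
  finally show ?thesis .
qed

lemma norm_G0: "t \<in> {0..T} \<Longrightarrow> 1 / 2 \<le> norm (G 0 t x)"
  using G0_near_1[of t x] norm_triangle_ineq2[of 1 "1 - G 0 t x"] \<sigma> by (simp add: norm_minus_commute)

lemma G0_nonzero: "t \<in> {0..T} \<Longrightarrow> G 0 t x \<noteq> 0"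
  using norm_G0[of t x] by auto

lemma norm_G:
  assumes t: "t \<in> {0..T}" and j: "1 \<le> j" "j \<le> Suc s"
  shows "norm (G j t x) \<le> A * \<sigma>"
proof -
  have "norm (G j t x) \<le> (\<Sum>\<^sub>\<infinity>n. norm (\<gamma> j t n))" unfolding G_def by (rule norm_fser_le[OF l1_\<gamma>[OF j(2) t]])
  also have "\<dots> \<le> (\<Sum>\<^sub>\<infinity>n. (2 * pi * \<bar>of_int n\<bar>) ^ j * norm (d n))"
  proof (rule infsum_mono[OF _ d_summable(1)[OF j(2)]])
    show "(\<lambda>n. norm (\<gamma> j t n)) summable_on UNIV" using l1_\<gamma>[OF j(2) t] by (simp add: l1_def)
    fix n
    show "norm (\<gamma> j t n) \<le> (2 * pi * \<bar>of_int n\<bar>) ^ j * norm (d n)"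
      using norm_\<gamma>_le[OF t, of j n] j by (cases "n = 0") (auto simp: c_def power_0_left)
  qed
  also have "\<dots> \<le> A * \<sigma>" by (rule d_summable(2)[OF j(2)])
  finally show ?thesis .
qed

text \<open>
  The coefficients of the conjugate function are those of \<open>G\<close> with \<open>\<mu> n\<close> replaced by \<open>cnj (\<mu> (-n))\<close>,
  since the initial function is real.
\<close>

lemma Im_G:
  assumes t: "t \<in> {0..T}" and j: "j \<le> Suc s"
  shows "\<bar>Im (G j t x)\<bar> \<le> A * \<sigma> * t"
proof -
  define \<beta> where "\<beta> = (\<lambda>n. cnj (\<gamma> j t (- n)))"
  have \<beta>: "\<beta> n = (2 * pi * \<i> * of_int n) ^ j * (c n * cnj (\<mu> (- n) t))" for n
    using sym[of n] by (auto simp: \<beta>_def \<gamma>_def c_def)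
  have lb: "l1 \<beta>"
  proof (rule l1_mono[OF c_summable[OF j]])
    show "norm (\<beta> n) \<le> (2 * pi * \<bar>of_int n\<bar>) ^ j * norm (c n)" for n
      unfolding \<beta> using norm_\<mu>[OF t, of "- n"] by (simp add: norm_mult norm_power mult_left_le mult.assoc[symmetric])
  qed
  have b: "norm (\<gamma> j t n - \<beta> n) \<le> ((2 * pi * \<bar>of_int n\<bar>) ^ j * norm (d n)) * t" for n
  proof (cases "n = 0")
    case True
    then show ?thesis using t by (simp add: \<beta> \<gamma>_def)
  next
    case False
    have "\<gamma> j t n - \<beta> n = (2 * pi * \<i> * of_int n) ^ j * (d n * (\<mu> n t - cnj (\<mu> (- n) t)))"
      using False by (simp add: \<beta> \<gamma>_def c_def algebra_simps)
    then have "norm (\<gamma> j t n - \<beta> n) = ((2 * pi * \<bar>of_int n\<bar>) ^ j * norm (d n)) * norm (\<mu> n t - cnj (\<mu> (- n) t))"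
      by (simp add: norm_mult norm_power)
    also have "\<dots> \<le> ((2 * pi * \<bar>of_int n\<bar>) ^ j * norm (d n)) * t"
      by (intro mult_left_mono norm_\<mu>_conj_diff t False) auto
    finally show ?thesis .
  qed
  have l: "l1 (\<lambda>n. \<gamma> j t n - \<beta> n)" by (rule l1_diff[OF l1_\<gamma>[OF j t] lb])
  have "2 * \<bar>Im (G j t x)\<bar> = norm (G j t x - cnj (G j t x))"
    by (simp add: complex_diff_cnj norm_mult)
  also have "G j t x - cnj (G j t x) = fser (\<lambda>n. \<gamma> j t n - \<beta> n) x"
    unfolding G_def fser_cnj by (simp add: fser_diff[OF l1_\<gamma>[OF j t] lb] \<beta>_def[symmetric])
  also have "norm \<dots> \<le> (\<Sum>\<^sub>\<infinity>n. norm (\<gamma> j t n - \<beta> n))" by (rule norm_fser_le[OF l])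
  also have "\<dots> \<le> (\<Sum>\<^sub>\<infinity>n. ((2 * pi * \<bar>of_int n\<bar>) ^ j * norm (d n)) * t)"
    by (rule infsum_mono[OF _ summable_on_cmult_left[OF d_summable(1)[OF j]] b]) (use l in \<open>simp add: l1_def\<close>)
  also have "\<dots> = (\<Sum>\<^sub>\<infinity>n. (2 * pi * \<bar>of_int n\<bar>) ^ j * norm (d n)) * t" by (rule infsum_cmult_left')
  also have "\<dots> \<le> A * \<sigma> * t" using t by (intro mult_right_mono d_summable(2) j) auto
  finally show ?thesis by simp
qed

lemma G_uniform_limit:
  assumes t: "t \<in> {0..T}" and j: "j \<le> Suc s"
  shows "uniform_limit UNIV (\<lambda>r. G j r) (G j t) (at t within {0..T})"
  unfolding G_def
proof (rule fser_uniform_limit[OF l1_\<gamma>[OF j t] summable_on_cmult_right[OF c_summable[OF j], of 2]])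
  have "\<forall>\<^sub>F r in at t within {0..T}. r \<in> {0..T}" by (simp add: eventually_at_filter)
  then show "\<forall>\<^sub>F r in at t within {0..T}. \<forall>n. norm (\<gamma> j r n - \<gamma> j t n) \<le> 2 * ((2 * pi * \<bar>of_int n\<bar>) ^ j * norm (c n))"
  proof eventually_elim
    case (elim r)
    show ?case
    proof
      fix n
      show "norm (\<gamma> j r n - \<gamma> j t n) \<le> 2 * ((2 * pi * \<bar>of_int n\<bar>) ^ j * norm (c n))"
        using norm_triangle_ineq4[of "\<gamma> j r n" "\<gamma> j t n"] norm_\<gamma>_le[OF elim, of j n] norm_\<gamma>_le[OF t, of j n] by linarith
    qed
  qed
  fix n
  have "(\<mu> n \<longlongrightarrow> \<mu> n t) (at t within {0..T})"
    using has_vector_derivative_continuous[OF \<mu>_deriv[of n t "{0..T}"]] by (simp add: continuous_within)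
  then show "((\<lambda>r. \<gamma> j r n) \<longlongrightarrow> \<gamma> j t n) (at t within {0..T})"
    unfolding \<gamma>_def by (intro tendsto_intros)
qed auto

text \<open>
  Velocity and diffusion coefficient, in the form required by \<open>dpoly_dt\<close>.
\<close>

definition b :: "real \<Rightarrow> complex" where "b t = - of_nat N * (of_real abar + \<i> * of_real t)"

definition e :: complex where "e = of_nat N * of_nat k0"

text \<open>
  The right-hand side of the equation, two space derivatives higher; hence \<open>j + 2 \<le> s + 1\<close>.
\<close>

lemma G_time_deriv:
  assumes t: "t \<in> {0..T}" and j: "j + 2 \<le> Suc s"
  shows "uniform_limit UNIV (\<lambda>r x. (G j r x - G j t x) /\<^sub>R (r - t)) (\<lambda>x. b t * G (j + 1) t x + e * G (j + 2) t x) (at t within {0..T})"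
proof -
  have jj: "j \<le> Suc s" "j + 1 \<le> Suc s" using j by auto
  define \<alpha> where "\<alpha> = (\<lambda>n. b t * \<gamma> (j + 1) t n + e * \<gamma> (j + 2) t n)"
  define q where "q = (\<lambda>r n. of_real (inverse (r - t)) * (\<gamma> j r n - \<gamma> j t n))"
  define M where "M = (\<lambda>n::int. L * (of_int n)\<^sup>2 * ((2 * pi * \<bar>of_int n\<bar>) ^ j * norm (c n)))"
  have rate: "rate n t = b t * (2 * pi * \<i> * of_int n) + e * (2 * pi * \<i> * of_int n)\<^sup>2" for n
    by (simp add: rate_def b_def e_def power2_eq_square algebra_simps)
  have \<alpha>: "\<alpha> n = rate n t * \<gamma> j t n" for n
    unfolding \<alpha>_def rate \<gamma>_def by (simp add: power_add algebra_simps) (simp add: power2_eq_square)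
  have M0: "0 \<le> M n" for n unfolding M_def using L_nonneg by simp
  have Ms: "M summable_on UNIV"
  proof (rule summable_on_comparison_test[OF summable_on_cmult_right[OF c_summable[OF j], of L]])
    fix n :: int
    \<comment> \<open>Absorb \<open>n\<^sup>2\<close> into two further powers of \<open>2 pi |n|\<close>.\<close>
    have p: "1 \<le> (2 * pi)\<^sup>2" using pi_ge_two by (intro one_le_power) linarith
    have "(of_int n)\<^sup>2 * (2 * pi * \<bar>of_int n\<bar>) ^ j = 1 * ((real_of_int n)\<^sup>2 * (2 * pi * \<bar>of_int n\<bar>) ^ j)" by simp
    also have "\<dots> \<le> (2 * pi)\<^sup>2 * ((of_int n)\<^sup>2 * (2 * pi * \<bar>of_int n\<bar>) ^ j)" by (intro mult_right_mono p) simp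
    also have "\<dots> = (2 * pi * \<bar>of_int n\<bar>) ^ (j + 2)" by (simp add: power_add power_mult_distrib power2_eq_square mult_ac)
    finally have "L * ((of_int n)\<^sup>2 * (2 * pi * \<bar>of_int n\<bar>) ^ j) * norm (c n) \<le> L * (2 * pi * \<bar>of_int n\<bar>) ^ (j + 2) * norm (c n)"
      using L_nonneg by (intro mult_right_mono mult_left_mono) auto
    then show "M n \<le> L * ((2 * pi * \<bar>of_int n\<bar>) ^ (j + 2) * norm (c n))"
      by (simp only: M_def mult.assoc)
  qed (rule M0)
  have \<alpha>M: "norm (\<alpha> n) \<le> M n" for n
    unfolding \<alpha> norm_mult M_def
    by (intro mult_mono norm_rate norm_\<gamma>_le t) (use L_nonneg in auto)
  have l\<alpha>: "l1 \<alpha>" by (rule l1_mono[OF Ms \<alpha>M])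
  have qM: "norm (q r n) \<le> M n" if r: "r \<in> {0..T}" "r \<noteq> t" for r n
  proof -
    have "\<gamma> j r n - \<gamma> j t n = (2 * pi * \<i> * of_int n) ^ j * (c n * (\<mu> n r - \<mu> n t))"
      by (simp add: \<gamma>_def algebra_simps)
    then have "norm (q r n) = inverse \<bar>r - t\<bar> * (((2 * pi * \<bar>of_int n\<bar>) ^ j * norm (c n)) * norm (\<mu> n r - \<mu> n t))"
      unfolding q_def by (simp only: norm_mult norm_of_real) (simp add: norm_mult norm_power)
    also have "\<dots> \<le> inverse \<bar>r - t\<bar> * (((2 * pi * \<bar>of_int n\<bar>) ^ j * norm (c n)) * (L * (of_int n)\<^sup>2 * \<bar>r - t\<bar>))"
      by (intro mult_left_mono \<mu>_lipschitz r t) auto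
    also have "\<dots> = M n" using r by (simp add: M_def)
    finally show ?thesis .
  qed
  have ev: "\<forall>\<^sub>F r in at t within {0..T}. r \<in> {0..T} \<and> r \<noteq> t" by (simp add: eventually_at_filter)
  have "uniform_limit UNIV (\<lambda>r. fser (q r)) (fser \<alpha>) (at t within {0..T})"
  proof (rule fser_uniform_limit[OF l\<alpha> summable_on_cmult_right[OF Ms, of 2]])
    show "\<forall>\<^sub>F r in at t within {0..T}. \<forall>n. norm (q r n - \<alpha> n) \<le> 2 * M n"
      using ev
    proof eventually_elim
      case (elim r)
      show ?case
      proof
        fix n
        show "norm (q r n - \<alpha> n) \<le> 2 * M n"
          using norm_triangle_ineq4[of "q r n" "\<alpha> n"] qM[of r n] \<alpha>M[of n] elim by linarith
      qed
    qed
    fix n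
    have "((\<lambda>r. (\<mu> n r - \<mu> n t) /\<^sub>R (r - t)) \<longlongrightarrow> rate n t * \<mu> n t) (at t within {0..T})"
      using \<mu>_deriv[of n t "{0..T}"] by (simp add: has_vector_derivative_quotient)
    then have "((\<lambda>r. ((2 * pi * \<i> * of_int n) ^ j * c n) * ((\<mu> n r - \<mu> n t) /\<^sub>R (r - t))) \<longlongrightarrow> ((2 * pi * \<i> * of_int n) ^ j * c n) * (rate n t * \<mu> n t)) (at t within {0..T})"
      by (rule tendsto_mult_left)
    moreover have "((2 * pi * \<i> * of_int n) ^ j * c n) * ((\<mu> n r - \<mu> n t) /\<^sub>R (r - t)) = q r n" for r
      by (simp add: q_def \<gamma>_def scaleR_conv_of_real algebra_simps)
    moreover have "((2 * pi * \<i> * of_int n) ^ j * c n) * (rate n t * \<mu> n t) = \<alpha> n"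
      by (simp add: \<alpha> \<gamma>_def)
    ultimately show "((\<lambda>r. q r n) \<longlongrightarrow> \<alpha> n) (at t within {0..T})" by simp
  qed (use M0 in simp)
  moreover have "fser \<alpha> = (\<lambda>x. b t * G (j + 1) t x + e * G (j + 2) t x)"
    unfolding \<alpha>_def G_def
    by (simp only: fun_eq_iff fser_add[OF l1_cmult[OF l1_\<gamma>[OF jj(2) t]] l1_cmult[OF l1_\<gamma>[OF j t]]] fser_cmult) simp
  ultimately have "uniform_limit UNIV (\<lambda>r. fser (q r)) (\<lambda>x. b t * G (j + 1) t x + e * G (j + 2) t x) (at t within {0..T})"
    by simp
  then show ?thesis
  proof (rule uniform_limit_cong[THEN iffD1, rotated -1])
    show "\<forall>\<^sub>F r in at t within {0..T}. \<forall>x\<in>UNIV. fser (q r) x = (G j r x - G j t x) /\<^sub>R (r - t)"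
      using ev
    proof eventually_elim
      case (elim r)
      show ?case unfolding q_def G_def
        using l1_\<gamma>[OF jj(1) t] l1_\<gamma>[OF jj(1), of r] elim
        by (simp only: fser_cmult fser_diff) (simp add: scaleR_conv_of_real)
    qed
  qed simp
qed

definition B :: real where "B = 2 * A + 2 * A\<^sup>2"

lemma B_nonneg: "0 \<le> B" using A_ge_1 by (simp add: B_def)

lemma norm_h:
  assumes t: "t \<in> {0..T}" and j: "j \<le> s" shows "norm (h t j x) \<le> B * \<sigma>"
proof -
  have "norm (h t j x) \<le> (A * \<sigma>) / (1 / 2)"
    unfolding h_def norm_divide using norm_G[OF t, of "Suc j" x] norm_G0[OF t, of x] j \<sigma>_nonneg A_ge_1
    by (intro frac_le) auto
  also have "\<dots> \<le> B * \<sigma>" using \<sigma>_nonneg by (simp add: B_def algebra_simps)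
  finally show ?thesis .
qed

text \<open>
  \<open>Im (f / g) = Im (f cnj g) / |g|\<^sup>2\<close> with \<open>|g| \<ge> 1/2\<close>.
\<close>

lemma Im_h:
  assumes t: "t \<in> {0..T}" and j: "j \<le> s" shows "\<bar>Im (h t j x)\<bar> \<le> B * \<sigma> * t"
proof -
  let ?g = "G 0 t x" and ?f = "G (Suc j) t x"
  have g: "norm ?g > 0" "1 / 2 \<le> norm ?g" using norm_G0[OF t, of x] by auto
  have f: "norm ?f \<le> A * \<sigma>" "\<bar>Im ?f\<bar> \<le> A * \<sigma> * t" "\<bar>Im ?g\<bar> \<le> A * \<sigma> * t"
    using norm_G[OF t, of "Suc j" x] Im_G[OF t, of "Suc j" x] Im_G[OF t, of 0 x] j by auto
  have "Im (h t j x) = (Im ?f * Re ?g - Re ?f * Im ?g) / (norm ?g)\<^sup>2"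
    by (simp add: h_def Im_divide cmod_power2)
  then have "\<bar>Im (h t j x)\<bar> \<le> (\<bar>Im ?f\<bar> * \<bar>Re ?g\<bar> + \<bar>Re ?f\<bar> * \<bar>Im ?g\<bar>) / (norm ?g)\<^sup>2"
    by (auto simp: abs_divide abs_mult[symmetric] intro!: divide_right_mono)
  also have "\<dots> \<le> ((A * \<sigma> * t) * norm ?g + (A * \<sigma>) * (A * \<sigma> * t)) / (norm ?g)\<^sup>2"
    using f abs_Re_le_cmod[of ?g] abs_Re_le_cmod[of ?f] \<sigma>_nonneg A_ge_1 t
    by (intro divide_right_mono add_mono mult_mono) auto
  also have "\<dots> = (A * \<sigma> * t) / norm ?g + (A * \<sigma>) * (A * \<sigma> * t) / (norm ?g)\<^sup>2"
    using g by (simp add: power2_eq_square add_divide_distrib)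
  also have "\<dots> \<le> (A * \<sigma> * t) / (1 / 2) + (A * \<sigma>) * (A * \<sigma> * t) / (1 / 2)\<^sup>2"
    using g \<sigma>_nonneg A_ge_1 t by (intro add_mono divide_left_mono power_mono mult_pos_pos) auto
  also have "\<dots> = 2 * A * \<sigma> * t + 4 * A\<^sup>2 * \<sigma> * (\<sigma> * t)" by (simp add: power2_eq_square)
  also have "\<dots> \<le> 2 * A * \<sigma> * t + 4 * A\<^sup>2 * \<sigma> * (1 / 2 * t)"
    using \<sigma> \<sigma>_nonneg t by (intro add_left_mono mult_left_mono mult_right_mono) auto
  also have "\<dots> = B * \<sigma> * t" by (simp add: B_def algebra_simps)
  finally show ?thesis .
qed

lemma h_deriv:
  assumes t: "t \<in> {0..T}" and j: "Suc j \<le> s"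
  shows "(h t j has_vector_derivative h t (Suc j) x - h t j x * h t 0 x) (at x)"
proof -
  have g: "G 0 t x \<noteq> 0" by (rule G0_nonzero[OF t])
  have "((\<lambda>x. G (Suc j) t x / G 0 t x) has_vector_derivative (G (Suc (Suc j)) t x * G 0 t x - G (Suc j) t x * G (Suc 0) t x) / (G 0 t x)\<^sup>2) (at x)"
  proof -
    have "((\<lambda>x. G (Suc j) t x / G 0 t x) has_derivative
       (\<lambda>y. (y *\<^sub>R G (Suc (Suc j)) t x * G 0 t x - G (Suc j) t x * (y *\<^sub>R G (Suc 0) t x)) / (G 0 t x * G 0 t x))) (at x)"
      by (rule has_derivative_divide'[OF G_deriv[unfolded has_vector_derivative_def] G_deriv[unfolded has_vector_derivative_def] g])
         (use t j in auto)
    then show ?thesis unfolding has_vector_derivative_def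
      by (rule has_derivative_eq_rhs) (simp add: fun_eq_iff scaleR_conv_of_real power2_eq_square algebra_simps)
  qed
  moreover have "(G (Suc (Suc j)) t x * G 0 t x - G (Suc j) t x * G (Suc 0) t x) / (G 0 t x)\<^sup>2 = h t (Suc j) x - h t j x * h t 0 x"
    using g by (simp add: h_def field_simps power2_eq_square)
  ultimately show ?thesis by (simp add: h_def[abs_def])
qed

lemma h_continuous: "t \<in> {0..T} \<Longrightarrow> j \<le> s \<Longrightarrow> continuous_on UNIV (h t j)"
  unfolding h_def using G0_nonzero by (intro continuous_intros G_continuous) auto

lemma h_periodic: "h t j (x + 1) = h t j x"
  using G_periodic by (simp add: h_def periodic1_def)

lemma h_bounded: "t \<in> {0..T} \<Longrightarrow> j \<le> s \<Longrightarrow> bounded (range (h t j))"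
  unfolding bounded_iff using norm_h by blast

lemma G_bounded: "t \<in> {0..T} \<Longrightarrow> j \<le> Suc s \<Longrightarrow> bounded (range (G j t))"
  using periodic1_bounded[OF G_continuous G_periodic] unfolding bounded_iff by (metis rangeE)

lemma h_uniform_limit:
  assumes t: "t \<in> {0..T}" and j: "j \<le> s"
  shows "uniform_limit UNIV (\<lambda>r. h r j) (h t j) (at t within {0..T})"
  unfolding h_def
  by (rule uniform_lim_divide[where b = "1 / 2", OF G_uniform_limit[OF t] G_uniform_limit[OF t] G_bounded[OF t] norm_G0[OF t]])
     (use j in auto)

lemma h_time_deriv:
  assumes t: "t \<in> {0..T}" and j: "j + 2 \<le> s"
  shows "uniform_limit UNIV (\<lambda>r x. (h r j x - h t j x) /\<^sub>R (r - t)) (\<lambda>x. dpoly_dt (b t) e (\<lambda>j. h t j x) (Var j)) (at t within {0..T})"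
proof -
  let ?f' = "\<lambda>x. b t * G (Suc j + 1) t x + e * G (Suc j + 2) t x"
  let ?g' = "\<lambda>x. b t * G (0 + 1) t x + e * G (0 + 2) t x"
  have k: "bounded (range (\<lambda>x. k))" for k :: complex by (auto simp: bounded_iff)
  have bd: "bounded (range ?f')" "bounded (range ?g')"
    by (intro bounded_plus_comp bounded_range_mult k G_bounded t; use j s in simp)+
  have bG: "bounded (range (G (Suc j) t))" "bounded (range (G 0 t))" by (rule G_bounded[OF t]; use j in simp)+
  have num: "uniform_limit UNIV (\<lambda>r x. (G (Suc j) r x - G (Suc j) t x) /\<^sub>R (r - t) * G 0 t x - G (Suc j) t x * ((G 0 r x - G 0 t x) /\<^sub>R (r - t)))
     (\<lambda>x. ?f' x * G 0 t x - G (Suc j) t x * ?g' x) (at t within {0..T})"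
    by (intro uniform_limit_minus uniform_lim_mult uniform_limit_const G_time_deriv t bd bG) (use j s in auto)
  have den: "uniform_limit UNIV (\<lambda>r x. G 0 r x * G 0 t x) (\<lambda>x. G 0 t x * G 0 t x) (at t within {0..T})"
    by (intro uniform_lim_mult uniform_limit_const G_uniform_limit t bG) simp
  have "uniform_limit UNIV
     (\<lambda>r x. ((G (Suc j) r x - G (Suc j) t x) /\<^sub>R (r - t) * G 0 t x - G (Suc j) t x * ((G 0 r x - G 0 t x) /\<^sub>R (r - t))) / (G 0 r x * G 0 t x))
     (\<lambda>x. (?f' x * G 0 t x - G (Suc j) t x * ?g' x) / (G 0 t x * G 0 t x)) (at t within {0..T})"
  proof (rule uniform_lim_divide[OF num den, where b = "1 / 2 * (1 / 2)"])
    show "bounded (range (\<lambda>x. ?f' x * G 0 t x - G (Suc j) t x * ?g' x))"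
      by (intro bounded_minus_comp bounded_range_mult bd bG)
    show "1 / 2 * (1 / 2) \<le> norm (G 0 t x * G 0 t x)" for x
      unfolding norm_mult by (intro mult_mono norm_G0 t) auto
  qed simp
  moreover have "(?f' x * G 0 t x - G (Suc j) t x * ?g' x) / (G 0 t x * G 0 t x) = dpoly_dt (b t) e (\<lambda>j. h t j x) (Var j)" for x
    using G0_nonzero[OF t, of x] by (simp add: h_def field_simps numeral_2_eq_2)
  ultimately have "uniform_limit UNIV
     (\<lambda>r x. ((G (Suc j) r x - G (Suc j) t x) /\<^sub>R (r - t) * G 0 t x - G (Suc j) t x * ((G 0 r x - G 0 t x) /\<^sub>R (r - t))) / (G 0 r x * G 0 t x))
     (\<lambda>x. dpoly_dt (b t) e (\<lambda>j. h t j x) (Var j)) (at t within {0..T})" by simp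
  then show ?thesis
  proof (rule uniform_limit_cong[THEN iffD1, rotated -1])
    have "\<forall>\<^sub>F r in at t within {0..T}. r \<in> {0..T}" by (simp add: eventually_at_filter)
    then show "\<forall>\<^sub>F r in at t within {0..T}. \<forall>x\<in>UNIV.
      ((G (Suc j) r x - G (Suc j) t x) /\<^sub>R (r - t) * G 0 t x - G (Suc j) t x * ((G 0 r x - G 0 t x) /\<^sub>R (r - t))) / (G 0 r x * G 0 t x)
      = (h r j x - h t j x) /\<^sub>R (r - t)"
    proof eventually_elim
      case (elim r)
      have "(a /\<^sub>R k * g0 - f0 * (q /\<^sub>R k)) = (a * g0 - f0 * q) /\<^sub>R k" for a q g0 f0 :: complex and k :: real
        by (simp add: scaleR_conv_of_real algebra_simps)
      then show ?case using G0_nonzero[OF t] G0_nonzero[OF elim]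
        by (auto simp: h_def divide_simps) (simp add: algebra_simps)
    qed
  qed simp
qed

end

section \<open>The Cole-Hopf solution\<close>

lemma uniform_limit_compose_inner:
  "uniform_limit UNIV f l F \<Longrightarrow> uniform_limit UNIV (\<lambda>r x. f r (g x)) (\<lambda>x. l (g x)) F"
  unfolding uniform_limit_iff by (auto elim!: eventually_mono)

text \<open>
  The polynomial that expresses the derivative of order \<open>j\<close> of \<open>h\<^sub>0\<close>.
\<close>

definition hopf_poly :: "nat \<Rightarrow> dpoly" where "hopf_poly j = (dpoly_dx ^^ j) (Var 0)"

lemma hopf_poly_simps [simp]: "hopf_poly 0 = Var 0" "dpoly_dx (hopf_poly j) = hopf_poly (Suc j)"
  by (simp_all add: hopf_poly_def)

lemma hopf_poly_index: "dpoly_index (hopf_poly j) \<le> j"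
  using dpoly_index_dx_funpow[of j "Var 0"] by (simp add: hopf_poly_def)

context cole_hopf
begin

text \<open>
  The space derivatives of \<open>z - 2 k0 h\<^sub>0 (k x)\<close> at time \<open>t\<close>. The solution \<open>u\<close> has \<open>k = N\<close>; its rescaling \<open>v\<close> has
  \<open>k = k0\<close>, so that its norms do not involve \<open>\<epsilon>\<close>.
\<close>

definition profile :: "complex \<Rightarrow> nat \<Rightarrow> real \<Rightarrow> nat \<Rightarrow> real \<Rightarrow> complex" where
  "profile z k t j x = (if j = 0 then z else 0) - 2 * of_nat k0 * (of_nat k ^ j * dpoly_eval (\<lambda>i. h t i (real k * x)) (hopf_poly j))"

lemma rescale_derivative:
  fixes F :: "real \<Rightarrow> complex"
  assumes "(F has_vector_derivative F') (at (real k * x))"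
  shows "((\<lambda>x. F (real k * x)) has_vector_derivative of_nat k * F') (at x)"
proof -
  have "((\<lambda>x. real k * x) has_vector_derivative real k) (at x)"
    by (auto intro!: derivative_eq_intros simp: has_real_derivative_iff_has_vector_derivative[symmetric])
  from vector_diff_chain_at[OF this assms] show ?thesis
    by (simp add: o_def scaleR_conv_of_real)
qed

lemma rescale_periodic:
  assumes "periodic1 w" shows "periodic1 (\<lambda>x. w (real k * x))"
  unfolding periodic1_def
proof
  fix x
  show "w (real k * (x + 1)) = w (real k * x)"
    using periodic1_int[OF assms, of "real k * x" "int k"] by (simp add: algebra_simps)
qed

lemma profile_eval_derivative:
  assumes t: "t \<in> {0..T}" and j: "Suc j \<le> s"
  shows "((\<lambda>x. dpoly_eval (\<lambda>i. h t i x) (hopf_poly j)) has_vector_derivative dpoly_eval (\<lambda>i. h t i x) (hopf_poly (Suc j))) (at x)"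
  using dpoly_eval_derivative[of "hopf_poly j" "h t" x] h_deriv[OF t] hopf_poly_index[of j] j by simp

lemma profile_eval_continuous:
  "t \<in> {0..T} \<Longrightarrow> j \<le> s \<Longrightarrow> continuous_on UNIV (\<lambda>x. dpoly_eval (\<lambda>i. h t i x) (hopf_poly j))"
  by (intro dpoly_eval_continuous h_continuous) (use hopf_poly_index[of j] in auto)

lemma cchain_profile:
  assumes t: "t \<in> {0..T}"
  shows "cchain s (profile z k t)"
  unfolding cchain_def
proof (intro conjI allI impI)
  fix j x assume j: "j < s"
  have "((\<lambda>x. dpoly_eval (\<lambda>i. h t i (real k * x)) (hopf_poly j)) has_vector_derivative
     of_nat k * dpoly_eval (\<lambda>i. h t i (real k * x)) (hopf_poly (Suc j))) (at x)"
    by (rule rescale_derivative[OF profile_eval_derivative[OF t]]) (use j in simp)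
  then have "(profile z k t j has_vector_derivative
     0 - 2 * of_nat k0 * (of_nat k ^ j * (of_nat k * dpoly_eval (\<lambda>i. h t i (real k * x)) (hopf_poly (Suc j))))) (at x)"
    unfolding profile_def
    by (intro has_vector_derivative_diff has_vector_derivative_const has_vector_derivative_mult_right)
  then show "(profile z k t j has_vector_derivative profile z k t (Suc j) x) (at x)"
    by (simp add: profile_def mult_ac)
next
  fix j assume j: "j \<le> s"
  have "continuous_on UNIV (\<lambda>x. dpoly_eval (\<lambda>i. h t i (real k * x)) (hopf_poly j))"
    by (rule continuous_on_compose2[OF profile_eval_continuous[OF t j]]) (auto intro!: continuous_intros)
  then show "continuous_on UNIV (profile z k t j)"
    unfolding profile_def by (intro continuous_intros)
  have "periodic1 (\<lambda>x. dpoly_eval (\<lambda>i. h t i x) (hopf_poly j))"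
    by (simp add: periodic1_def h_periodic)
  from rescale_periodic[OF this, of k] show "periodic1 (profile z k t j)"
    by (simp add: periodic1_def profile_def)
qed

text \<open>
  The space derivatives of \<open>\<partial>\<^sub>t u\<close>, for \<open>k = N\<close>.
\<close>

definition profile_dt :: "nat \<Rightarrow> real \<Rightarrow> nat \<Rightarrow> real \<Rightarrow> complex" where
  "profile_dt k t j x = (if j = 0 then \<i> else 0)
     - 2 * of_nat k0 * (of_nat k ^ j * dpoly_dt (b t) e (\<lambda>i. h t i (real k * x)) (hopf_poly j))"

lemma cchain_profile_dt:
  assumes t: "t \<in> {0..T}"
  shows "cchain (s - 2) (profile_dt k t)"
  unfolding cchain_def
proof (intro conjI allI impI)
  fix j x assume j: "j < s - 2"
  have "((\<lambda>x. dpoly_dt (b t) e (\<lambda>i. h t i x) (hopf_poly j)) has_vector_derivative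
     dpoly_dt (b t) e (\<lambda>i. h t i y) (dpoly_dx (hopf_poly j))) (at y)" for y
    by (rule dpoly_dt_derivative) (use h_deriv[OF t] hopf_poly_index[of j] j in auto)
  then have "((\<lambda>x. dpoly_dt (b t) e (\<lambda>i. h t i x) (hopf_poly j)) has_vector_derivative
     dpoly_dt (b t) e (\<lambda>i. h t i y) (hopf_poly (Suc j))) (at y)" for y by simp
  then have "((\<lambda>x. dpoly_dt (b t) e (\<lambda>i. h t i (real k * x)) (hopf_poly j)) has_vector_derivative
     of_nat k * dpoly_dt (b t) e (\<lambda>i. h t i (real k * x)) (hopf_poly (Suc j))) (at x)"
    by (rule rescale_derivative)
  then have "(profile_dt k t j has_vector_derivative
     0 - 2 * of_nat k0 * (of_nat k ^ j * (of_nat k * dpoly_dt (b t) e (\<lambda>i. h t i (real k * x)) (hopf_poly (Suc j))))) (at x)"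
    unfolding profile_dt_def
    by (intro has_vector_derivative_diff has_vector_derivative_const has_vector_derivative_mult_right)
  then show "(profile_dt k t j has_vector_derivative profile_dt k t (Suc j) x) (at x)"
    by (simp add: profile_dt_def mult_ac)
next
  fix j assume j: "j \<le> s - 2"
  have "continuous_on UNIV (\<lambda>x. dpoly_dt (b t) e (\<lambda>i. h t i x) (hopf_poly j))"
    by (intro dpoly_dt_continuous h_continuous t) (use hopf_poly_index[of j] j s in auto)
  then have "continuous_on UNIV (\<lambda>x. dpoly_dt (b t) e (\<lambda>i. h t i (real k * x)) (hopf_poly j))"
    by (rule continuous_on_compose2) (auto intro!: continuous_intros)
  then show "continuous_on UNIV (profile_dt k t j)"
    unfolding profile_dt_def by (intro continuous_intros)
  have "periodic1 (\<lambda>x. dpoly_dt (b t) e (\<lambda>i. h t i x) (hopf_poly j))"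
    by (simp add: periodic1_def h_periodic)
  from rescale_periodic[OF this, of k] show "periodic1 (profile_dt k t j)"
    by (simp add: periodic1_def profile_dt_def)
qed

text \<open>
  The Cole-Hopf formula \<open>u = \<i> t + abar - 2 \<epsilon> \<partial>\<^sub>x G / G\<close>, with \<open>\<partial>\<^sub>x = N \<partial>\<^sub>z\<close> and \<open>\<epsilon> N = k0\<close>.
\<close>

definition u :: "real \<Rightarrow> real \<Rightarrow> complex" where
  "u t x = \<i> * of_real t + of_real abar - 2 * of_nat k0 * h t 0 (real N * x)"

abbreviation uchain :: "real \<Rightarrow> nat \<Rightarrow> real \<Rightarrow> complex" where
  "uchain t \<equiv> profile (\<i> * of_real t + of_real abar) N t"

lemma u_uchain: "u t = uchain t 0"
  by (simp add: u_def profile_def fun_eq_iff)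

lemma eventually_in_interval: "\<forall>\<^sub>F r in at t within {0..T}. r \<in> {0..T} \<and> r \<noteq> t"
  by (simp add: eventually_at_filter)

lemma u_tendsto:
  assumes t: "t \<in> {0..T}"
  shows "sobolev_tendsto s u (u t) (at t within {0..T})"
proof -
  have "sobolev_tendsto s (\<lambda>r. uchain r 0) (uchain t 0) (at t within {0..T})"
  proof (rule cchain_sobolev_tendsto)
    show "\<forall>\<^sub>F r in at t within {0..T}. cchain s (uchain r)"
      using eventually_in_interval by eventually_elim (simp add: cchain_profile)
    show "cchain s (uchain t)" by (rule cchain_profile[OF t])
    fix j assume j: "j \<le> s"
    have "uniform_limit UNIV (\<lambda>r x. dpoly_eval (\<lambda>i. h r i x) (hopf_poly j)) (\<lambda>x. dpoly_eval (\<lambda>i. h t i x) (hopf_poly j)) (at t within {0..T})"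
      by (intro dpoly_eval_uniform_limit h_uniform_limit h_bounded t) (use hopf_poly_index[of j] j in auto)
    from uniform_limit_compose_inner[OF this, of "\<lambda>x. real N * x"]
    have "uniform_limit UNIV (\<lambda>r x. of_nat N ^ j * dpoly_eval (\<lambda>i. h r i (real N * x)) (hopf_poly j)) (\<lambda>x. of_nat N ^ j * dpoly_eval (\<lambda>i. h t i (real N * x)) (hopf_poly j)) (at t within {0..T})"
      by (rule bounded_linear.uniform_limit[OF bounded_linear_mult_right])
    then have 1: "uniform_limit UNIV (\<lambda>r x. 2 * of_nat k0 * (of_nat N ^ j * dpoly_eval (\<lambda>i. h r i (real N * x)) (hopf_poly j))) (\<lambda>x. 2 * of_nat k0 * (of_nat N ^ j * dpoly_eval (\<lambda>i. h t i (real N * x)) (hopf_poly j))) (at t within {0..T})"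
      by (rule bounded_linear.uniform_limit[OF bounded_linear_mult_right])
    have "((\<lambda>r. if j = 0 then \<i> * of_real r + of_real abar else 0) \<longlongrightarrow> (if j = 0 then \<i> * of_real t + of_real abar else 0 :: complex)) (at t within {0..T})"
      by (auto intro!: tendsto_intros)
    then have "uniform_limit UNIV (\<lambda>r x. if j = 0 then \<i> * of_real r + of_real abar else 0) (\<lambda>x. if j = 0 then \<i> * of_real t + of_real abar else 0 :: complex) (at t within {0..T})"
      by (auto simp: uniform_limit_iff tendsto_iff)
    from uniform_limit_minus[OF this 1]
    show "uniform_limit UNIV (\<lambda>r. uchain r j) (uchain t j) (at t within {0..T})"
      by (simp add: profile_def[abs_def])
  qed
  then show ?thesis by (simp add: u_uchain[symmetric] eta_contract_eq)
qed

lemma u_time_deriv: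
  assumes t: "t \<in> {0..T}"
  shows "sobolev_has_time_deriv (s - 2) u (profile_dt N t 0) t {0..T}"
proof -
  have "sobolev_tendsto (s - 2) (\<lambda>r. (\<lambda>j x. (uchain r j x - uchain t j x) /\<^sub>R (r - t)) 0) (profile_dt N t 0) (at t within {0..T})"
  proof (rule cchain_sobolev_tendsto)
    have m: "cchain (s - 2) D" if "cchain s D" for D :: "nat \<Rightarrow> real \<Rightarrow> complex"
      using that by (auto simp: cchain_def)
    show "\<forall>\<^sub>F r in at t within {0..T}. cchain (s - 2) (\<lambda>j x. (uchain r j x - uchain t j x) /\<^sub>R (r - t))"
      using eventually_in_interval
      by eventually_elim (intro cchain_linear[OF cchain_diff bounded_linear_scaleR_right] m cchain_profile t, simp)
    show "cchain (s - 2) (profile_dt N t)" by (rule cchain_profile_dt[OF t])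
    fix j assume j: "j \<le> s - 2"
    have "uniform_limit UNIV (\<lambda>r x. (dpoly_eval (\<lambda>i. h r i x) (hopf_poly j) - dpoly_eval (\<lambda>i. h t i x) (hopf_poly j)) /\<^sub>R (r - t))
       (\<lambda>x. dpoly_dt (b t) e (\<lambda>i. h t i x) (hopf_poly j)) (at t within {0..T})"
      by (intro dpoly_dt_uniform_limit h_uniform_limit h_bounded h_time_deriv t) (use hopf_poly_index[of j] j s in auto)
    from uniform_limit_compose_inner[OF this, of "\<lambda>x. real N * x"]
    have "uniform_limit UNIV (\<lambda>r x. of_nat N ^ j * ((dpoly_eval (\<lambda>i. h r i (real N * x)) (hopf_poly j) - dpoly_eval (\<lambda>i. h t i (real N * x)) (hopf_poly j)) /\<^sub>R (r - t)))
       (\<lambda>x. of_nat N ^ j * dpoly_dt (b t) e (\<lambda>i. h t i (real N * x)) (hopf_poly j)) (at t within {0..T})"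
      by (rule bounded_linear.uniform_limit[OF bounded_linear_mult_right])
    then have 1: "uniform_limit UNIV (\<lambda>r x. 2 * of_nat k0 * (of_nat N ^ j * ((dpoly_eval (\<lambda>i. h r i (real N * x)) (hopf_poly j) - dpoly_eval (\<lambda>i. h t i (real N * x)) (hopf_poly j)) /\<^sub>R (r - t))))
       (\<lambda>x. 2 * of_nat k0 * (of_nat N ^ j * dpoly_dt (b t) e (\<lambda>i. h t i (real N * x)) (hopf_poly j))) (at t within {0..T})"
      by (rule bounded_linear.uniform_limit[OF bounded_linear_mult_right])
    have "uniform_limit UNIV (\<lambda>r x. if j = 0 then \<i> else 0) (\<lambda>x. if j = 0 then \<i> else 0) (at t within {0..T})"
      by (rule uniform_limit_const)
    note 2 = uniform_limit_minus[OF this 1]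
    show "uniform_limit UNIV (\<lambda>r x. (uchain r j x - uchain t j x) /\<^sub>R (r - t)) (profile_dt N t j) (at t within {0..T})"
    proof (rule uniform_limit_cong[THEN iffD1, OF _ _ 2])
      show "\<forall>\<^sub>F r in at t within {0..T}. \<forall>x\<in>UNIV. (if j = 0 then \<i> else 0) - 2 * of_nat k0 * (of_nat N ^ j * ((dpoly_eval (\<lambda>i. h r i (real N * x)) (hopf_poly j) - dpoly_eval (\<lambda>i. h t i (real N * x)) (hopf_poly j)) /\<^sub>R (r - t)))
         = (uchain r j x - uchain t j x) /\<^sub>R (r - t)"
        using eventually_in_interval
      proof eventually_elim
        case (elim r)
        then have "complex_of_real r - complex_of_real t \<noteq> 0" by auto
        then show ?case by (auto simp: profile_def scaleR_conv_of_real field_simps)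
      qed
      show "(if j = 0 then \<i> else 0) - 2 * of_nat k0 * (of_nat N ^ j * dpoly_dt (b t) e (\<lambda>i. h t i (real N * x)) (hopf_poly j)) = profile_dt N t j x" for x
        by (simp add: profile_dt_def)
    qed
  qed
  then show ?thesis unfolding sobolev_has_time_deriv_def by (simp add: u_uchain)
qed

text \<open>
  Given the evolution of the variables \<open>h\<^sub>j\<close>, the equation is a polynomial identity in \<open>h\<^sub>0\<close>, \<open>h\<^sub>1\<close>, \<open>h\<^sub>2\<close>.
\<close>

lemma u_equation:
  assumes t: "t \<in> {0..T}" and \<epsilon>: "\<epsilon> * real N = real k0"
  shows "AE x in lebesgue. profile_dt N t 0 x + u t x * weak_deriv 1 (u t) x - of_real \<epsilon> * weak_deriv 2 (u t) x = \<i>"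
proof -
  have w1: "AE x in lebesgue. weak_deriv 1 (u t) x = uchain t 1 x"
    unfolding u_uchain by (rule cchain_weak_deriv_AE[OF cchain_profile[OF t]]) (use s in simp)
  have w2: "AE x in lebesgue. weak_deriv 2 (u t) x = uchain t 2 x"
    unfolding u_uchain by (rule cchain_weak_deriv_AE[OF cchain_profile[OF t]]) (use s in simp)
  show ?thesis using w1 w2
  proof eventually_elim
    case (elim x)
    define y where "y = real N * x"
    define h0 where "h0 = h t 0 y"
    define h1 where "h1 = h t 1 y"
    define h2 where "h2 = h t 2 y"
    define n where "n = complex_of_nat N"
    define k where "k = complex_of_nat k0"
    \<comment> \<open>The relation \<open>\<epsilon> N = k0\<close> is what makes the viscous term match.\<close>
    have \<epsilon>n: "of_real \<epsilon> * n = k"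
      unfolding n_def k_def using arg_cong[OF \<epsilon>, of complex_of_real] by simp
    have p: "hopf_poly 1 = Sub (Var 1) (Mul (Var 0) (Var 0))"
      "hopf_poly 2 = Sub (Sub (Var 2) (Mul (Var 1) (Var 0)))
         (Add (Mul (Sub (Var 1) (Mul (Var 0) (Var 0))) (Var 0)) (Mul (Var 0) (Sub (Var 1) (Mul (Var 0) (Var 0)))))"
      by (simp_all add: hopf_poly_def numeral_2_eq_2)
    have d1: "weak_deriv 1 (u t) x = - 2 * k * (n * (h1 - h0 * h0))"
      unfolding elim(1) profile_def p by (simp add: h0_def h1_def y_def n_def k_def)
    have d2: "weak_deriv 2 (u t) x = - 2 * k * (n\<^sup>2 * (h2 - h1 * h0 - ((h1 - h0 * h0) * h0 + h0 * (h1 - h0 * h0))))"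
      unfolding elim(2) profile_def p by (simp add: h0_def h1_def h2_def y_def n_def k_def)
    have d0: "profile_dt N t 0 x = \<i> - 2 * k * (- n * (of_real abar + \<i> * of_real t) * (h1 - h0 * h0) + n * k * (h2 - h0 * h1))"
      by (simp add: profile_dt_def b_def e_def h0_def h1_def h2_def y_def n_def k_def numeral_2_eq_2)
    have u: "u t x = \<i> * of_real t + of_real abar - 2 * k * h0"
      by (simp add: u_def h0_def y_def k_def)
    have "of_real \<epsilon> * weak_deriv 2 (u t) x = - 2 * k * (n * (of_real \<epsilon> * n) * (h2 - h1 * h0 - ((h1 - h0 * h0) * h0 + h0 * (h1 - h0 * h0))))"
      unfolding d2 by (simp add: power2_eq_square mult_ac)
    then have d3: "of_real \<epsilon> * weak_deriv 2 (u t) x = - 2 * k * (n * k * (h2 - h1 * h0 - ((h1 - h0 * h0) * h0 + h0 * (h1 - h0 * h0))))"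
      unfolding \<epsilon>n .
    show ?case unfolding d3 d0 d1 u by (simp add: algebra_simps)
  qed
qed

lemma u_burgers_solution:
  assumes \<epsilon>: "\<epsilon> * real N = real k0" and init: "AE x in lebesgue. u 0 x = u0 x"
  shows "burgers_solution s \<epsilon> T u0 u"
  unfolding burgers_solution_def sobolev_continuous_on_def
proof (intro conjI ballI init u_tendsto)
  show "u t \<in> sobolev s" if "t \<in> {0..T}" for t
    unfolding u_uchain by (rule cchain_sobolev[OF cchain_profile[OF that]])
  show "\<exists>ut. sobolev_has_time_deriv (s - 2) u ut t {0..T} \<and>
      (AE x in lebesgue. ut x + u t x * weak_deriv 1 (u t) x - of_real \<epsilon> * weak_deriv 2 (u t) x = \<i>)"
    if "t \<in> {0..T}" for t
    using u_time_deriv[OF that] u_equation[OF that \<epsilon>] by blast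
qed

definition bound_const :: real where
  "bound_const = (\<Sum>j\<le>s. 2 * real k0 * (real k0 ^ j * dpoly_bound B (hopf_poly j)))"

lemma bound_const_nonneg: "0 \<le> bound_const"
  unfolding bound_const_def by (intro sum_nonneg mult_nonneg_nonneg dpoly_bound_nonneg B_nonneg) auto

text \<open>
  The real part minus the mean and the imaginary part are those of \<open>- 2 k0 h\<^sub>0 (k0 y)\<close>, whose
  derivatives are polynomials in the small variables.
\<close>

lemma profile_sobolev_bounds:
  assumes t: "t \<in> {0..T}"
  defines "v \<equiv> \<lambda>y. of_real abar - 2 * of_nat k0 * h t 0 (real k0 * y)"
  shows "v \<in> sobolev s"
    and "sobolev_norm s (\<lambda>y. Re (v y) - abar) \<le> bound_const * \<sigma>"
    and "sobolev_norm s (\<lambda>y. Im (v y)) \<le> bound_const * \<sigma> * t"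
proof -
  have \<sigma>1: "\<sigma> \<le> 1" using \<sigma> by simp
  have ev: "norm (dpoly_eval (\<lambda>i. h t i y) (hopf_poly j)) \<le> dpoly_bound B (hopf_poly j) * \<sigma>"
       "\<bar>Im (dpoly_eval (\<lambda>i. h t i y) (hopf_poly j))\<bar> \<le> dpoly_bound B (hopf_poly j) * \<sigma> * t" if "j \<le> s" for j y
    using that hopf_poly_index[of j] t
    by (auto intro!: dpoly_eval_bound dpoly_eval_Im_bound B_nonneg \<sigma>_nonneg \<sigma>1 norm_h[OF t] Im_h[OF t])
  show "v \<in> sobolev s"
  proof -
    have "v = profile (of_real abar) k0 t 0" by (simp add: fun_eq_iff profile_def v_def)
    then show ?thesis using cchain_sobolev[OF cchain_profile[OF t]] by simp
  qed
  have "sobolev_norm s ((\<lambda>j x. Re (profile 0 k0 t j x)) 0) \<le> (\<Sum>j\<le>s. 2 * real k0 * (real k0 ^ j * (dpoly_bound B (hopf_poly j) * \<sigma>)))"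
  proof (rule cchain_sobolev_norm_le[OF cchain_linear[OF cchain_profile[OF t] bounded_linear_Re]])
    fix j x assume j: "j \<le> s"
    have "norm (Re (profile 0 k0 t j x)) \<le> norm (profile 0 k0 t j x)" using abs_Re_le_cmod by simp
    also have "\<dots> = 2 * real k0 * (real k0 ^ j * norm (dpoly_eval (\<lambda>i. h t i (real k0 * x)) (hopf_poly j)))"
      by (simp add: profile_def norm_mult norm_power)
    also have "\<dots> \<le> 2 * real k0 * (real k0 ^ j * (dpoly_bound B (hopf_poly j) * \<sigma>))"
      by (intro mult_left_mono ev j) auto
    finally show "norm (Re (profile 0 k0 t j x)) \<le> 2 * real k0 * (real k0 ^ j * (dpoly_bound B (hopf_poly j) * \<sigma>))" .
  qed
  then show "sobolev_norm s (\<lambda>y. Re (v y) - abar) \<le> bound_const * \<sigma>"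
    by (simp add: profile_def v_def bound_const_def sum_distrib_right mult.assoc)
  have "sobolev_norm s ((\<lambda>j x. Im (profile 0 k0 t j x)) 0) \<le> (\<Sum>j\<le>s. 2 * real k0 * (real k0 ^ j * (dpoly_bound B (hopf_poly j) * \<sigma> * t)))"
  proof (rule cchain_sobolev_norm_le[OF cchain_linear[OF cchain_profile[OF t] bounded_linear_Im]])
    fix j x assume j: "j \<le> s"
    let ?z = "dpoly_eval (\<lambda>i. h t i (real k0 * x)) (hopf_poly j)"
    have "profile 0 k0 t j x = of_real (- 2 * real k0 * real k0 ^ j) * ?z"
      by (simp add: profile_def)
    moreover have "Im (of_real r * w) = r * Im w" for r and w :: complex by simp
    ultimately have "Im (profile 0 k0 t j x) = (- 2 * real k0 * real k0 ^ j) * Im ?z" by (simp only:)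
    then have "norm (Im (profile 0 k0 t j x)) = 2 * real k0 * (real k0 ^ j * \<bar>Im ?z\<bar>)"
      by (simp add: abs_mult)
    also have "\<dots> \<le> 2 * real k0 * (real k0 ^ j * (dpoly_bound B (hopf_poly j) * \<sigma> * t))"
      by (intro mult_left_mono ev j) auto
    finally show "norm (Im (profile 0 k0 t j x)) \<le> 2 * real k0 * (real k0 ^ j * (dpoly_bound B (hopf_poly j) * \<sigma> * t))" .
  qed
  then show "sobolev_norm s (\<lambda>y. Im (v y)) \<le> bound_const * \<sigma> * t"
    by (simp add: profile_def v_def bound_const_def sum_distrib_right mult.assoc)
qed

text \<open>
  If \<open>G = exp P\<close> initially, then \<open>h\<^sub>0 = P'\<close>.
\<close>

lemma h_initial:
  assumes P: "wl1 (Suc s) \<alpha>" "\<And>x. 1 + fser d x = exp (fser \<alpha> x)"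
  shows "h 0 0 x = fser (dcoef \<alpha>) x"
proof -
  have t0: "0 \<in> {0..T}" using T by simp
  have G0: "G 0 0 = (\<lambda>x. exp (fser \<alpha> x))"
  proof
    fix x
    have "\<gamma> 0 0 = (\<lambda>n. (if n = 0 then 1 else 0) + d n)" by (simp add: \<gamma>_def c_def fun_eq_iff)
    then have "G 0 0 x = 1 + fser d x"
      unfolding G_def by (simp add: fser_add[OF l1_delta wl1_l1[OF d(1)]] fser_delta)
    then show "G 0 0 x = exp (fser \<alpha> x)" by (simp add: P(2))
  qed
  have "l1 (dcoef \<alpha>)"
  proof (rule l1_mono)
    show "(\<lambda>n. 2 * pi * (wt (Suc s) n * norm (\<alpha> n))) summable_on UNIV"
      using P(1) by (intro summable_on_cmult_right) (simp add: wl1_def)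
    fix n
    have "\<bar>of_int n\<bar> \<le> (1 + \<bar>real_of_int n\<bar>) ^ 1" by simp
    also have "\<dots> \<le> wt (Suc s) n" unfolding wt_def by (rule power_increasing) auto
    finally show "norm (dcoef \<alpha> n) \<le> 2 * pi * (wt (Suc s) n * norm (\<alpha> n))"
      by (simp add: dcoef_def norm_mult mult_right_mono)
  qed
  from fser_has_vector_derivative[OF wl1_l1[OF P(1)] this]
  have "(fser \<alpha> has_vector_derivative fser (dcoef \<alpha>) x) (at x)" .
  from field_vector_diff_chain_at[OF this DERIV_exp]
  have "(G 0 0 has_vector_derivative fser (dcoef \<alpha>) x * exp (fser \<alpha> x)) (at x)"
    unfolding G0 by (simp add: o_def)
  moreover have "(G 0 0 has_vector_derivative G (Suc 0) 0 x) (at x)" by (rule G_deriv[OF _ t0]) simp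
  ultimately have "G (Suc 0) 0 x = fser (dcoef \<alpha>) x * exp (fser \<alpha> x)" by (rule vector_derivative_unique_at[rotated])
  then show ?thesis by (simp add: h_def G0)
qed

end

section \<open>Solutions for small initial data\<close>

lemma fcoef_real_valued:
  assumes "\<And>x. cnj (f x) = f x"
  shows "cnj (fcoef f (- n)) = fcoef f n"
  unfolding fcoef_def Bochner_Integration.integral_cnj[symmetric]
  by (simp add: assms del: Bochner_Integration.integral_cnj)

lemma sobolev_const: "(\<lambda>x. c) \<in> sobolev m"
  using cchain_sobolev[OF cchain_const[of m c]] by simp

lemma sobolev_diff_mean: "a \<in> sobolev m \<Longrightarrow> (\<lambda>x. a x - c) \<in> sobolev m"
  by (rule sobolev_diff(1)[OF _ sobolev_const])

lemma sobolev_of_real: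
  fixes w :: "real \<Rightarrow> real"
  assumes w: "w \<in> sobolev m"
  shows "(\<lambda>x. complex_of_real (w x)) \<in> sobolev m"
    and "j \<le> m \<Longrightarrow> l2norm (weak_deriv j (\<lambda>x. complex_of_real (w x))) = l2norm (weak_deriv j w)"
proof -
  have bl: "bounded_linear complex_of_real" by (rule bounded_linear_of_real)
  note L = sobolev_linear[OF w bl]
  show s: "(\<lambda>x. complex_of_real (w x)) \<in> sobolev m" by (rule L(1))
  assume j: "j \<le> m"
  have "l2norm (weak_deriv j (\<lambda>x. complex_of_real (w x))) = l2norm (\<lambda>x. complex_of_real (weak_deriv j w x))"
    by (rule l2norm_cong_AE[OF L(2)[OF j] sobolev_weak_deriv(1)[OF s j]])
       (rule torus_L2_linear[OF sobolev_weak_deriv(1)[OF w j] bounded_linear_of_real])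
  then show "l2norm (weak_deriv j (\<lambda>x. complex_of_real (w x))) = l2norm (weak_deriv j w)"
    by (simp add: l2norm_def)
qed

lemma real_fcoef_sum_le:
  fixes w :: "real \<Rightarrow> real"
  assumes w: "w \<in> sobolev (Suc m)" and F: "finite F" "0 \<notin> F"
  shows "(\<Sum>n\<in>F. \<bar>of_int n\<bar> ^ m * norm (fcoef (\<lambda>x. complex_of_real (w x)) n)) \<le> 2 * sobolev_norm (Suc m) w"
  using sobolev_fcoef_sum_le[OF sobolev_of_real(1)[OF w] F] sobolev_of_real(2)[OF w, of "Suc m"]
    l2norm_le_sobolev_norm[of "Suc m" "Suc m" w] by simp

text \<open>
  The frequencies of \<open>w (k \<cdot>)\<close> are the multiples of \<open>k\<close>, so the weights only increase. The
  smallness condition is in terms of \<open>a\<close> and the conclusion in terms of \<open>a (k0 \<cdot>)\<close>: both versions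
  are needed.
\<close>

lemma real_fcoef_sum_le_rescale:
  fixes w :: "real \<Rightarrow> real"
  assumes w: "w \<in> sobolev (Suc m)" and F: "finite F" "0 \<notin> F" and k: "k \<ge> (1::nat)"
  shows "(\<Sum>n\<in>F. \<bar>of_int n\<bar> ^ m * norm (fcoef (\<lambda>x. complex_of_real (w x)) n)) \<le> 2 * sobolev_norm (Suc m) (\<lambda>y. w (real k * y))"
proof -
  let ?f = "fcoef (\<lambda>x. complex_of_real (w x))" and ?g = "fcoef (\<lambda>y. complex_of_real (w (real k * y)))"
  have inj: "inj_on ((*) (int k)) F" using k by (auto simp: inj_on_def)
  have "(\<Sum>n\<in>F. \<bar>of_int n\<bar> ^ m * norm (?f n)) \<le> (\<Sum>n\<in>F. \<bar>of_int (int k * n)\<bar> ^ m * norm (?g (int k * n)))"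
  proof (rule sum_mono)
    fix n
    have "?g (int k * n) = ?f n"
      by (rule fcoef_rescale[OF sobolev_L2[OF sobolev_of_real(1)[OF w]] k])
    moreover have "\<bar>real_of_int n\<bar> ^ m \<le> \<bar>of_int (int k * n)\<bar> ^ m"
    proof (rule power_mono)
      have "1 * \<bar>real_of_int n\<bar> \<le> real k * \<bar>real_of_int n\<bar>" using k by (intro mult_right_mono) auto
      then show "\<bar>real_of_int n\<bar> \<le> \<bar>of_int (int k * n)\<bar>" by (simp add: abs_mult)
    qed simp
    ultimately show "\<bar>of_int n\<bar> ^ m * norm (?f n) \<le> \<bar>of_int (int k * n)\<bar> ^ m * norm (?g (int k * n))"
      by (simp only: mult_right_mono norm_ge_zero)
  qed
  also have "\<dots> = (\<Sum>n\<in>(*) (int k) ` F. \<bar>of_int n\<bar> ^ m * norm (?g n))"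
    by (simp only: sum.reindex[OF inj] o_def)
  also have "\<dots> \<le> 2 * sobolev_norm (Suc m) (\<lambda>y. w (real k * y))"
    by (rule real_fcoef_sum_le[OF sobolev_rescale[OF w k]]) (use F k in auto)
  finally show ?thesis .
qed

text \<open>
  The coefficients of the mean-free primitive of \<open>\<kappa> p\<close>, for \<open>p\<close> with vanishing mean.
\<close>

definition primitive_coef :: "complex \<Rightarrow> (int \<Rightarrow> complex) \<Rightarrow> int \<Rightarrow> complex" where
  "primitive_coef \<kappa> p n = (if n = 0 then 0 else \<kappa> * p n / (2 * pi * \<i> * of_int n))"

text \<open>
  The primitive gains the factor \<open>1/|n|\<close>, which compensates for passing from the power \<open>m\<close> to the
  weight of order \<open>m + 1\<close>.
\<close>

lemma primitive_coef_weight: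
  assumes \<kappa>: "norm \<kappa> \<le> 1" and X: "\<And>F. finite F \<Longrightarrow> 0 \<notin> F \<Longrightarrow> (\<Sum>n\<in>F. \<bar>of_int n\<bar> ^ m * norm (p n)) \<le> X"
  shows "wl1 (Suc m) (primitive_coef \<kappa> p)" "wn (Suc m) (primitive_coef \<kappa> p) \<le> 2 ^ Suc m * X"
proof -
  let ?\<alpha> = "primitive_coef \<kappa> p"
  have le: "wt (Suc m) n * norm (?\<alpha> n) \<le> 2 ^ Suc m * (\<bar>of_int n\<bar> ^ m * norm (p n))" if n: "n \<noteq> 0" for n
  proof -
    have n1: "1 \<le> \<bar>real_of_int n\<bar>" using n by linarith
    have "wt (Suc m) n \<le> (2 * \<bar>of_int n\<bar>) ^ Suc m" unfolding wt_def by (rule power_mono) (use n1 in auto)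
    also have "\<dots> = 2 ^ Suc m * \<bar>of_int n\<bar> ^ m * \<bar>of_int n\<bar>" by (simp add: power_mult_distrib)
    finally have 1: "wt (Suc m) n \<le> 2 ^ Suc m * \<bar>of_int n\<bar> ^ m * \<bar>of_int n\<bar>" .
    have "norm (?\<alpha> n) = norm \<kappa> * norm (p n) / (2 * pi * \<bar>of_int n\<bar>)"
      using n by (simp add: primitive_coef_def norm_mult norm_divide)
    also have "\<dots> \<le> 1 * norm (p n) / (1 * \<bar>of_int n\<bar>)"
      using n1 \<kappa> pi_ge_two by (intro frac_le mult_mono) auto
    finally have "norm (?\<alpha> n) \<le> norm (p n) / \<bar>of_int n\<bar>" by simp
    with 1 have "wt (Suc m) n * norm (?\<alpha> n) \<le> (2 ^ Suc m * \<bar>of_int n\<bar> ^ m * \<bar>of_int n\<bar>) * (norm (p n) / \<bar>of_int n\<bar>)"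
      by (intro mult_mono) auto
    also have "\<dots> = 2 ^ Suc m * (\<bar>of_int n\<bar> ^ m * norm (p n))" using n by simp
    finally show ?thesis .
  qed
  have fin: "(\<Sum>n\<in>F. wt (Suc m) n * norm (?\<alpha> n)) \<le> 2 ^ Suc m * X" if "finite F" for F
  proof -
    have "(\<Sum>n\<in>F. wt (Suc m) n * norm (?\<alpha> n)) = (\<Sum>n\<in>F - {0}. wt (Suc m) n * norm (?\<alpha> n))"
      using that by (intro sum.mono_neutral_right) (auto simp: primitive_coef_def)
    also have "\<dots> \<le> (\<Sum>n\<in>F - {0}. 2 ^ Suc m * (\<bar>of_int n\<bar> ^ m * norm (p n)))"
      by (intro sum_mono le) auto
    also have "\<dots> \<le> 2 ^ Suc m * X"
      unfolding sum_distrib_left[symmetric] using X[of "F - {0}"] that by (intro mult_left_mono) auto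
    finally show ?thesis .
  qed
  show s: "wl1 (Suc m) ?\<alpha>" unfolding wl1_def
  proof (rule nonneg_bdd_above_summable_on)
    show "bdd_above (sum (\<lambda>n. wt (Suc m) n * norm (?\<alpha> n)) ` {F. F \<subseteq> UNIV \<and> finite F})"
      by (rule bdd_aboveI2[where M = "2 ^ Suc m * X"]) (use fin in blast)
  qed simp
  show "wn (Suc m) ?\<alpha> \<le> 2 ^ Suc m * X" unfolding wn_def
    by (rule infsum_le_finite_sums[OF s[unfolded wl1_def] fin])
qed

lemma exp_minus_1_le:
  fixes x :: real
  assumes "0 \<le> x" "x \<le> 1"
  shows "exp x - 1 \<le> 2 * x"
proof -
  have "x\<^sup>2 \<le> x * 1" unfolding power2_eq_square by (rule mult_left_mono) (use assms in auto)
  then show ?thesis using exp_bound[OF assms] by linarith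
qed

text \<open>
  The initial transform is \<open>exp P\<close>, where \<open>P\<close> is the mean-free primitive of \<open>-(a - abar)/(2 k0)\<close>. Smallness
  of \<open>a\<close> makes the Wiener norm of \<open>P\<close> at most \<open>1/4\<close>, which puts \<open>exp P\<close> within distance \<open>\<sigma> \<le> 1/2\<close> of 1, and
  \<open>\<sigma>\<close> is also at most a multiple of the norm \<open>R\<close> of the rescaled datum.
\<close>

lemma small_data_solution:
  fixes a :: "real \<Rightarrow> real"
  assumes k0: "k0 \<ge> 1" and s: "s \<ge> 2" and T_range: "0 < T" "T < 2 * pi * real k0"
    and a: "a \<in> sobolev (Suc s)" and small: "sobolev_norm (Suc s) (\<lambda>x. a x - torus_mean a) \<le> 1 / 2 ^ (s + 4)"
    and \<epsilon>: "0 < \<epsilon>" "real k0 / \<epsilon> \<in> \<int>"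
  defines "R \<equiv> sobolev_norm (Suc s) (\<lambda>y. a (real k0 * y) - torus_mean a)"
    and "K \<equiv> cole_hopf.bound_const s k0 * 2 ^ (s + 3)"
  obtains u v where "burgers_solution s \<epsilon> T (\<lambda>x. of_real (a (real k0 * x / \<epsilon>))) u"
    and "\<And>t x. u t x = \<i> * of_real t + v (t / \<epsilon>) (x / \<epsilon>)"
    and "\<And>\<tau>. \<tau> \<in> {0..T / \<epsilon>} \<Longrightarrow> v \<tau> \<in> sobolev s"
    and "\<And>\<tau>. \<tau> \<in> {0..T / \<epsilon>} \<Longrightarrow> sobolev_norm s (\<lambda>y. Re (v \<tau> y) - torus_mean a) \<le> K * R"
    and "\<And>\<tau>. \<tau> \<in> {0..T / \<epsilon>} \<Longrightarrow> sobolev_norm s (\<lambda>y. Im (v \<tau> y)) \<le> K * (\<epsilon> * \<tau>) * R"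
proof -
  define abar where "abar = torus_mean a"
  define p where "p = (\<lambda>x. a x - abar)"
  have p: "p \<in> sobolev (Suc s)" unfolding p_def by (rule sobolev_diff_mean[OF a])
  obtain z where z: "real k0 / \<epsilon> = of_int z" using \<epsilon>(2) by (auto elim: Ints_cases)
  have "0 < real k0 / \<epsilon>" using k0 \<epsilon>(1) by simp
  then have z0: "z > 0" using z by simp
  define N where "N = nat z"
  have Nk: "N \<ge> 1" "real k0 / \<epsilon> = real N" using z z0 by (auto simp: N_def)
  have \<epsilon>N: "\<epsilon> * real N = real k0" unfolding Nk(2)[symmetric] using \<epsilon>(1) by simp
  define pc where "pc = (\<lambda>x. complex_of_real (p x))"
  have pc: "pc \<in> sobolev (Suc s)" unfolding pc_def by (rule sobolev_of_real(1)[OF p])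
  define ph where "ph = fcoef pc"
  define \<kappa> where "\<kappa> = - 1 / (2 * complex_of_nat k0)"
  have \<kappa>: "norm \<kappa> \<le> 1" using k0 by (simp add: \<kappa>_def norm_divide norm_mult)
  define \<alpha> where "\<alpha> = primitive_coef \<kappa> ph"
  note X1 = real_fcoef_sum_le[OF p, folded pc_def, folded ph_def]
  note X2 = real_fcoef_sum_le_rescale[OF p _ _ k0, folded pc_def, folded ph_def]
  have \<alpha>1: "wl1 (Suc s) \<alpha>" "wn (Suc s) \<alpha> \<le> 2 ^ Suc s * (2 * sobolev_norm (Suc s) p)"
    unfolding \<alpha>_def
    by (rule primitive_coef_weight[OF \<kappa>, where X = "2 * sobolev_norm (Suc s) p"], rule X1, assumption, assumption)+
  have \<alpha>2: "wn (Suc s) \<alpha> \<le> 2 ^ Suc s * (2 * sobolev_norm (Suc s) (\<lambda>y. p (real k0 * y)))"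
    unfolding \<alpha>_def
    by (rule primitive_coef_weight(2)[OF \<kappa>], rule X2, assumption, assumption)
  have "sobolev_norm (Suc s) p \<le> 1 / 2 ^ (s + 4)" using small by (simp add: p_def abar_def)
  then have "2 ^ Suc s * (2 * sobolev_norm (Suc s) p) \<le> 2 ^ Suc s * (2 * (1 / 2 ^ (s + 4)))" by (intro mult_left_mono) auto
  also have "\<dots> = 1 / 4" by (simp add: field_simps power_add)
  finally have \<alpha>small: "wn (Suc s) \<alpha> \<le> 1 / 4" using \<alpha>1(2) by linarith
  have \<alpha>R: "wn (Suc s) \<alpha> \<le> 2 ^ (s + 2) * R"
    using \<alpha>2 by (simp add: R_def p_def abar_def power_add)
  obtain d where d: "wl1 (Suc s) d" "wn (Suc s) d \<le> exp (wn (Suc s) \<alpha>) - 1" "\<And>x. 1 + fser d x = exp (fser \<alpha> x)"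
    using wiener_exp[OF \<alpha>1(1)] by metis
  note d_exp = d(3)
  define \<sigma> where "\<sigma> = wn (Suc s) d"
  have "\<sigma> \<le> 2 * wn (Suc s) \<alpha>"
    using d(2) exp_minus_1_le[of "wn (Suc s) \<alpha>"] \<alpha>small by (simp add: \<sigma>_def)
  with \<alpha>small \<alpha>R have \<sigma>R: "\<sigma> \<le> 1 / 2" "\<sigma> \<le> 2 ^ (s + 3) * R" by (simp_all add: power_add)
  have \<alpha>sym: "cnj (\<alpha> (- n)) = \<alpha> n" for n
  proof -
    have "cnj (ph (- n)) = ph n" unfolding ph_def pc_def by (rule fcoef_real_valued) simp
    then show ?thesis by (simp add: \<alpha>_def primitive_coef_def \<kappa>_def)
  qed
  \<comment> \<open>The function \<open>exp P - 1\<close> is real, hence so is the sequence of its coefficients in the sense of \<open>sym\<close>.\<close>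
  have dsym: "cnj (d (- n)) = d n" for n
  proof -
    have "cnj (fser \<alpha> x) = fser \<alpha> x" for x unfolding fser_cnj by (simp add: \<alpha>sym)
    then have "cnj (exp (fser \<alpha> x) - 1) = exp (fser \<alpha> x) - 1" for x by (simp add: exp_cnj)
    moreover have "fser d x = exp (fser \<alpha> x) - 1" for x using d(3)[of x] by (simp add: algebra_simps)
    ultimately have "cnj (fser d x) = fser d x" for x by simp
    from fcoef_real_valued[of "fser d", OF this, of n]
    show ?thesis by (simp add: fcoef_fser[OF wl1_l1[OF d(1)]])
  qed
  interpret cole_hopf s k0 N abar T \<sigma> d
    by unfold_locales (use k0 s Nk(1) T_range d(1) \<sigma>R(1) dsym in \<open>auto simp: \<sigma>_def\<close>)
  have init: "AE x in lebesgue. u 0 x = of_real (a (real k0 * x / \<epsilon>))"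
  proof -
    have ph0: "ph 0 = 0"
    proof -
      have i: "integrable T01 a" by (rule torus_L2_integrable[OF sobolev_L2[OF a]])
      have "integral\<^sup>L T01 p = 0" unfolding p_def abar_def torus_mean_def lint_T01 using i by simp
      then have "integral\<^sup>L T01 pc = 0" unfolding pc_def by (simp only: integral_complex_of_real) simp
      then show ?thesis by (simp add: ph_def fcoef_def)
    qed
    have dc: "dcoef \<alpha> = (\<lambda>n. \<kappa> * ph n)"
      using ph0 by (auto simp: dcoef_def \<alpha>_def primitive_coef_def fun_eq_iff)
    have hi: "h 0 0 x = \<kappa> * fser ph x" for x
      by (simp only: h_initial[OF \<alpha>1(1) d_exp] dc fser_cmult)
    have k: "2 * of_nat k0 * \<kappa> = - 1" using k0 by (simp add: \<kappa>_def)
    have "AE x in lebesgue. pc x = fser ph x"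
      unfolding ph_def
      by (rule fourier_inversion[OF sobolev_L2[OF pc] sobolev_l1_fcoef[OF sobolev_mono[OF pc]]]) simp
    from AE_lebesgue_affine[OF this, of "real N" 0] Nk(1)
    have "AE x in lebesgue. pc (real N * x) = fser ph (real N * x)" by simp
    then show ?thesis
    proof eventually_elim
      case (elim x)
      have "u 0 x = of_real abar - (2 * of_nat k0 * \<kappa>) * fser ph (real N * x)"
        by (simp add: u_def hi mult.assoc)
      also have "\<dots> = of_real abar + pc (real N * x)" unfolding k elim by simp
      also have "\<dots> = of_real (a (real N * x))" by (simp add: pc_def p_def)
      also have "real N * x = real k0 * x / \<epsilon>" unfolding Nk(2)[symmetric] by simp
      finally show ?case .
    qed
  qed
  have sol: "burgers_solution s \<epsilon> T (\<lambda>x. of_real (a (real k0 * x / \<epsilon>))) u"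
    by (rule u_burgers_solution[OF \<epsilon>N init])
  define v where "v = (\<lambda>\<tau> y. of_real abar - 2 * of_nat k0 * h (\<epsilon> * \<tau>) 0 (real k0 * y))"
  have K: "bound_const * \<sigma> \<le> K * R"
    unfolding K_def using mult_left_mono[OF \<sigma>R(2) bound_const_nonneg] by (simp add: mult.assoc)
  have t: "\<epsilon> * \<tau> \<in> {0..T}" if "\<tau> \<in> {0..T / \<epsilon>}" for \<tau> using that \<epsilon>(1) by (auto simp: field_simps)
  show thesis
  proof (rule that[OF sol, of v])
    show "u t x = \<i> * of_real t + v (t / \<epsilon>) (x / \<epsilon>)" for t x
    proof -
      have "real k0 * (x / \<epsilon>) = real N * x" unfolding Nk(2)[symmetric] by simp
      then show ?thesis using \<epsilon>(1) by (simp add: u_def v_def)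
    qed
    fix \<tau> assume \<tau>: "\<tau> \<in> {0..T / \<epsilon>}"
    note V = profile_sobolev_bounds[OF t[OF \<tau>]]
    show "v \<tau> \<in> sobolev s" using V(1) by (simp add: v_def)
    show "sobolev_norm s (\<lambda>y. Re (v \<tau> y) - torus_mean a) \<le> K * R"
      using V(2) K unfolding v_def abar_def[symmetric] by linarith
    have "sobolev_norm s (\<lambda>y. Im (v \<tau> y)) \<le> (bound_const * \<sigma>) * (\<epsilon> * \<tau>)" using V(3) by (simp add: v_def)
    also have "\<dots> \<le> (K * R) * (\<epsilon> * \<tau>)" using K t[OF \<tau>] by (intro mult_right_mono) auto
    finally show "sobolev_norm s (\<lambda>y. Im (v \<tau> y)) \<le> K * (\<epsilon> * \<tau>) * R" by (simp only: mult_ac)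
  qed
qed

theorem theorem1:
  fixes k0 s :: nat
  assumes "k0 \<ge> 1" and "s \<ge> 2"
  shows "\<exists>K::real. \<exists>C::real \<Rightarrow> real. K > 0 \<and>
    (\<forall>T\<in>{0<..<2 * pi * real k0}. C T > 0) \<and>
    filterlim C at_top (at_left (2 * pi * real k0)) \<and>
    (\<forall>T\<in>{0<..<2 * pi * real k0}. \<exists>\<delta>>0.
      \<forall>a::real \<Rightarrow> real.
        a \<in> sobolev (s + 1) \<and> sobolev_norm (s + 1) (\<lambda>x. a x - torus_mean a) \<le> \<delta> \<longrightarrow>
        (\<exists>\<epsilon>0>0. \<forall>\<epsilon>::real. 0 < \<epsilon> \<and> \<epsilon> < \<epsilon>0 \<and> real k0 / \<epsilon> \<in> \<int> \<longrightarrow>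
          (\<exists>u. burgers_solution s \<epsilon> T (\<lambda>x. of_real (a (real k0 * x / \<epsilon>))) u \<and>
            (\<forall>w. burgers_solution s \<epsilon> T (\<lambda>x. of_real (a (real k0 * x / \<epsilon>))) w \<longrightarrow>
                 (\<forall>t\<in>{0..T}. AE x in lebesgue. w t x = u t x)) \<and>
            (\<exists>v::real \<Rightarrow> real \<Rightarrow> complex.
              (\<forall>t\<in>{0..T}. \<forall>x. u t x = \<i> * of_real t + v (t / \<epsilon>) (x / \<epsilon>)) \<and>
              (\<forall>t\<in>{0..T / \<epsilon>}.
                v t \<in> sobolev s \<and>
                sobolev_norm s (\<lambda>y. Re (v t y) - torus_mean a)
                  \<le> K * (1 + \<epsilon> * t * C T)
                    * sobolev_norm (s + 1) (\<lambda>y. a (real k0 * y) - torus_mean a) \<and>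
                sobolev_norm s (\<lambda>y. Im (v t y))
                  \<le> K * (\<epsilon> * t) * (1 + \<epsilon> * t * C T)
                    * sobolev_norm (s + 1) (\<lambda>y. a (real k0 * y) - torus_mean a))))))"
proof -
  define C where "C = (\<lambda>T. inverse (2 * pi * real k0 - T))"
  define K1 where "K1 = cole_hopf.bound_const s k0 * 2 ^ (s + 3)"
  \<comment> \<open>The summand 1 makes \<open>K\<close> positive, whatever the value of \<open>K1\<close>.\<close>
  define K where "K = K1 + 1"
  define \<delta> where "\<delta> = (1 :: real) / 2 ^ (s + 4)"
  have Clim: "filterlim C at_top (at_left (2 * pi * real k0))"
    unfolding C_def
  proof (rule filterlim_inverse_at_top)
    have "((\<lambda>T. 2 * pi * real k0 - T) \<longlongrightarrow> 2 * pi * real k0 - 2 * pi * real k0) (at_left (2 * pi * real k0))"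
      by (intro tendsto_intros)
    then show "((\<lambda>T. 2 * pi * real k0 - T) \<longlongrightarrow> 0) (at_left (2 * pi * real k0))" by simp
    show "\<forall>\<^sub>F T in at_left (2 * pi * real k0). 0 < 2 * pi * real k0 - T" by (simp add: eventually_at_filter)
  qed
  have K1: "0 \<le> K1"
  proof -
    \<comment> \<open>The constant is defined inside the locale; the trivial datum gives access to its sign.\<close>
    interpret cole_hopf s k0 1 0 1 0 "\<lambda>_. 0"
      using assms pi_ge_two by unfold_locales (auto simp: wl1_def wn_def intro: less_le_trans[of 1 "2 * pi"] order_trans)
    show ?thesis unfolding K1_def using bound_const_nonneg by simp
  qed
  have Kpos: "0 < K" using K1 by (simp add: K_def)
  have \<delta>_pos: "\<delta> > 0" by (simp add: \<delta>_def)
  show ?thesis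
  proof (rule exI[of _ K], rule exI[of _ C], intro conjI Kpos Clim, goal_cases)
    case 1
    show ?case by (simp add: C_def)
  next
    case 2
    show ?case
    proof (rule ballI, rule exI[of _ \<delta>], intro conjI \<delta>_pos allI impI, rule exI[of _ 1],
        intro conjI zero_less_one allI impI, elim conjE, goal_cases)
      case (1 T a \<epsilon>)
      define R where "R = sobolev_norm (Suc s) (\<lambda>y. a (real k0 * y) - torus_mean a)"
      have T: "0 < T" "T < 2 * pi * real k0" and a: "a \<in> sobolev (Suc s)"
        and small: "sobolev_norm (Suc s) (\<lambda>x. a x - torus_mean a) \<le> 1 / 2 ^ (s + 4)"
        using 1 by (simp_all add: \<delta>_def)
      obtain u v where sol: "burgers_solution s \<epsilon> T (\<lambda>x. of_real (a (real k0 * x / \<epsilon>))) u"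
        and uv: "\<And>t x. u t x = \<i> * of_real t + v (t / \<epsilon>) (x / \<epsilon>)"
        and v: "\<And>\<tau>. \<tau> \<in> {0..T / \<epsilon>} \<Longrightarrow> v \<tau> \<in> sobolev s"
          "\<And>\<tau>. \<tau> \<in> {0..T / \<epsilon>} \<Longrightarrow> sobolev_norm s (\<lambda>y. Re (v \<tau> y) - torus_mean a) \<le> K1 * R"
          "\<And>\<tau>. \<tau> \<in> {0..T / \<epsilon>} \<Longrightarrow> sobolev_norm s (\<lambda>y. Im (v \<tau> y)) \<le> K1 * (\<epsilon> * \<tau>) * R"
        using small_data_solution[OF assms T a small 1(4) 1(6)] unfolding R_def K1_def by metis
      \<comment> \<open>The time factor is at least 1, so the estimates of \<open>small_data_solution\<close> imply the claimed ones.\<close>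
      have weaken: "K1 * x * R \<le> K * x * (1 + \<epsilon> * \<tau> * C T) * R" if "0 \<le> x" "0 \<le> \<tau>" for x \<tau>
      proof -
        have "0 \<le> \<epsilon> * \<tau> * C T" using that(2) T 1(4) by (simp add: C_def)
        then have "K1 * x * 1 \<le> K * x * (1 + \<epsilon> * \<tau> * C T)"
          using that(1) K1 Kpos by (intro mult_mono) (auto simp: K_def)
        then show ?thesis unfolding mult_1_right by (rule mult_right_mono) (simp add: R_def)
      qed
      show ?case
      proof (rule exI[of _ u], intro conjI sol allI impI ballI exI[of _ v] uv)
        show "AE x in lebesgue. w t x = u t x"
          if "burgers_solution s \<epsilon> T (\<lambda>x. of_real (a (real k0 * x / \<epsilon>))) w" "t \<in> {0..T}" for w t
          by (rule burgers_solution_unique[OF assms(2) 1(4) sol that])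
        fix \<tau> assume \<tau>: "\<tau> \<in> {0..T / \<epsilon>}"
        then have \<tau>0: "0 \<le> \<tau>" "0 \<le> \<epsilon> * \<tau>" using 1(4) by auto
        show "v \<tau> \<in> sobolev s" by (rule v(1)[OF \<tau>])
        show "sobolev_norm s (\<lambda>y. Re (v \<tau> y) - torus_mean a)
            \<le> K * (1 + \<epsilon> * \<tau> * C T) * sobolev_norm (s + 1) (\<lambda>y. a (real k0 * y) - torus_mean a)"
          using v(2)[OF \<tau>] weaken[of 1 \<tau>] \<tau>0 by (simp add: R_def)
        show "sobolev_norm s (\<lambda>y. Im (v \<tau> y))
            \<le> K * (\<epsilon> * \<tau>) * (1 + \<epsilon> * \<tau> * C T) * sobolev_norm (s + 1) (\<lambda>y. a (real k0 * y) - torus_mean a)"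
          using v(3)[OF \<tau>] weaken[OF \<tau>0(2) \<tau>0(1)] by (simp add: R_def)
      qed
    qed
  qed
qed

end
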